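(* Let $n$ be a positive integer with $n\geq 13$, let $c\in\mathbb{C}$ with $c\neq 0,1$, and let $$P(z)=\frac{(n-1)(n-2)}{2}z^{n}-n(n-2)z^{n-1}+\frac{n(n-1)}{2}z^{n-2}-c.$$ Let $S=\{z\in\mathbb{C} : P(z)=0\}$. If $f$ and $g$ are two non-constant meromorphic functions on $\mathbb{C}$ satisfying $E_{f}(S,1)=E_{g}(S,1)$, then $f\equiv g$.
   Context: A meromorphic function means a function that is meromorphic on the whole complex plane $\mathbb{C}$. For a non-constant meromorphic function $f$, a set $S\subset\mathbb{C}\cup\{\infty\}$ and $l\in\mathbb{N}\cup\{0\}\cup\{\infty\}$, define $$E_{f}(S,l)=\bigcup_{a\in S}\{(z,t)\in\mathbb{C}\times\mathbb{N} : f(z)=a \text{ with multiplicity } p\},$$ where $t=p$ if $p\leq l$ and $t=p+1$ if $p>l$, as in the paper's definition of weighted sharing. Here $\mathbb{N}$ is the set of natural numbers, and "$f(z)=a$ with multiplicity $p$" means that $z$ is an $a$-point of $f$ of exact multiplicity $p\ge 1$. *)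

theory Defs
  imports "HOL-Complex_Analysis.Complex_Analysis" "HOL-Library.Extended_Nat"
begin

text \<open>
  A meromorphic function on the plane is represented by its normalised library form
  \<open>f nicely_meromorphic_on UNIV\<close>: \<open>f\<close> is continuous away from its poles (no removable
  singularities), and the value at a pole is the dummy value \<open>0\<close>.  Every meromorphic function
  has exactly one such representative, so \<open>f \<equiv> g\<close> is \<open>f = g\<close>.
\<close>

text \<open>The sphere \<open>\<complex> \<union> {\<infinity>}\<close>, in which meromorphic functions take their values.\<close>

datatype ext_complex = Finite complex | Infinity

text \<open>
  \<open>takes_value f a z p\<close>: \<open>z\<close> is an \<open>a\<close>-point of \<open>f\<close> of exact multiplicity \<open>p\<close>.
  The condition \<open>\<not> is_pole f z\<close> is needed because of the dummy value at poles.
\<close>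

fun takes_value :: "(complex \<Rightarrow> complex) \<Rightarrow> ext_complex \<Rightarrow> complex \<Rightarrow> nat \<Rightarrow> bool" where
  "takes_value f (Finite a) z p \<longleftrightarrow>
     p \<ge> 1 \<and> \<not> is_pole f z \<and> f z = a \<and> zorder (\<lambda>w. f w - a) z = int p"
| "takes_value f Infinity z p \<longleftrightarrow>
     p \<ge> 1 \<and> is_pole f z \<and> zorder f z = - int p"

text \<open>
  The weighted preimage \<open>E\<^sub>f(S,l)\<close>.  A point of multiplicity \<open>p > l\<close> is recorded with
  \<open>p + 1\<close> (not with \<open>l + 1\<close>, as in another common convention for weighted sharing).
\<close>

definition weighted_preimage ::
    "(complex \<Rightarrow> complex) \<Rightarrow> ext_complex set \<Rightarrow> enat \<Rightarrow> (complex \<times> nat) set" where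
  "weighted_preimage f S l =
     (\<Union>a\<in>S. {(z, t). \<exists>p. takes_value f a z p \<and> t = (if enat p \<le> l then p else p + 1)})"

definition frank_reinders :: "nat \<Rightarrow> complex \<Rightarrow> complex \<Rightarrow> complex" where
  "frank_reinders n c z =
     (of_nat n - 1) * (of_nat n - 2) / 2 * z ^ n
     - of_nat n * (of_nat n - 2) * z ^ (n - 1)
     + of_nat n * (of_nat n - 1) / 2 * z ^ (n - 2) - c"

end

theory Submission
  imports Defs "HOL-Computational_Algebra.Fundamental_Theorem_Algebra"
begin

text \<open>
  The second component of \<open>E\<^sub>f(S, 1)\<close> determines the multiplicity, so \<open>f\<close> and \<open>g\<close> share \<open>S\<close> counting
  multiplicities. Writing \<open>f = f1 / f0\<close> and \<open>g = g1 / g0\<close> with entire functions without common zeros,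
  and absorbing a zero-free factor into \<open>g0\<close> and \<open>g1\<close>, this becomes \<open>f0^n P(f) = g0^n P(g)\<close>, that is,
  \<open>A1 - A2 = c (A3 - A4)\<close> with \<open>A3 = f0^n\<close>, \<open>A4 = g0^n\<close>. Cartan's second main theorem in the plane
  with truncation level 2 forces a linear relation between \<open>A1\<close>, \<open>A2\<close>, \<open>A3\<close>: the truncated zeros of
  the four terms are bounded by \<open>4 + 4 + 2 + 2 = 12 < n\<close> characteristics, as
  \<open>A1 = f1^(n-2) Q(f0, f1)\<close> with a quadratic form \<open>Q\<close>. The second main theorem on the line leaves only
  \<open>A1 = A2\<close> or the swap of \<open>A1\<close> and \<open>A3\<close>, and the ramification rules out the swap. If \<open>A1 = A2\<close> and
  \<open>f \<noteq> g\<close>, then \<open>P(f) = P(g)\<close> is a quadratic equation for \<open>g\<close> over the field generated by \<open>f / g\<close>,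
  so its discriminant, a polynomial in \<open>f / g\<close> with at least five simple roots, is a square, and
  \<open>f / g\<close> is totally ramified over too many values.

  Nevanlinna theory is expressed by circle means of \<open>log |F|\<close> for entire \<open>F\<close>, on radii avoiding the
  zeros, without counting functions. The logarithmic derivative is controlled by differentiating
  the Poisson--Jensen formula.
\<close>

section \<open>Circle means\<close>

text \<open>The derivative of P is n(n-1)(n-2)/2 z^(n-3) (z-1)^2, and P + c takes the values 0 and 1
  at its critical points 0 and 1. Hence c \<noteq> 0, 1 makes every root of P simple, and
  multiplicities of f over S become orders of zeros of the entire function f0^n P(f). The count of
  characteristics is done pointwise. An entire function \<open>s\<close> dividing the power
  \<open>k\<close> of a Wronskian plays the part of the ramification term. Taking \<open>k\<close> =
  n turns fractions of a characteristic into integers: |A1| + |A3| is comparable with (|f0| +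
  |f1|)^n, so a leftover factor of degree e in f0, f1 costs, after raising to the power n, the e-th
  power of |A1| + |A3|. A second main theorem then compares an exponent \<open>\<kappa>\<close> with
  a multiple of \<open>k\<close>. Logarithmic derivatives enter only through differences, so that a
  common zero-free factor of the terms, whose growth nothing controls, cancels.\<close>

definition circle_mean :: "complex \<Rightarrow> real \<Rightarrow> (complex \<Rightarrow> 'a::banach) \<Rightarrow> 'a" where
  "circle_mean z r F = integral {0..1} (\<lambda>t. F (z + of_real r * cis (2 * pi * t)))"

lemma circle_mean_dilate:
  "circle_mean z r F = circle_mean 0 1 (\<lambda>w. F (z + of_real r * w))"
  by (simp add: circle_mean_def)

lemma circle_mean_dilate2:
  "circle_mean 0 \<rho> (\<lambda>w. F (z + of_real r * w)) = circle_mean z (r * \<rho>) F"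
  by (simp add: circle_mean_def mult.assoc)

lemma continuous_on_circle_param:
  assumes "continuous_on (sphere z r) F" "r \<ge> 0"
  shows "continuous_on {0..1} (\<lambda>t. F (z + of_real r * cis (2 * pi * t)))"
  by (rule continuous_on_compose2[OF assms(1)])
     (use assms(2) in \<open>auto intro!: continuous_intros simp: dist_norm norm_mult\<close>)

lemma circle_integrable:
  fixes F :: "complex \<Rightarrow> 'a::banach"
  assumes "continuous_on (sphere z r) F" "r \<ge> 0"
  shows "(\<lambda>t. F (z + of_real r * cis (2 * pi * t))) integrable_on {0..1}"
  by (intro integrable_continuous_real continuous_on_circle_param assms)

lemma circle_mean_add:
  fixes F G :: "complex \<Rightarrow> 'a::banach"
  assumes "continuous_on (sphere z r) F" "continuous_on (sphere z r) G" "r \<ge> 0"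
  shows "circle_mean z r (\<lambda>w. F w + G w) = circle_mean z r F + circle_mean z r G"
  unfolding circle_mean_def by (intro integral_add circle_integrable assms)

lemma circle_mean_diff:
  fixes F G :: "complex \<Rightarrow> 'a::banach"
  assumes "continuous_on (sphere z r) F" "continuous_on (sphere z r) G" "r \<ge> 0"
  shows "circle_mean z r (\<lambda>w. F w - G w) = circle_mean z r F - circle_mean z r G"
  unfolding circle_mean_def by (intro integral_diff circle_integrable assms)

lemma circle_mean_const [simp]: "circle_mean z r (\<lambda>_. c) = c"
  by (simp add: circle_mean_def)

lemma circle_mean_cmult:
  fixes F :: "complex \<Rightarrow> real"
  shows "circle_mean z r (\<lambda>w. c * F w) = c * circle_mean z r F"
  by (simp add: circle_mean_def)

lemma circle_mean_sum:
  fixes F :: "'i \<Rightarrow> complex \<Rightarrow> 'a::banach"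
  assumes "finite I" "\<And>i. i \<in> I \<Longrightarrow> continuous_on (sphere z r) (F i)" "r \<ge> 0"
  shows "circle_mean z r (\<lambda>w. \<Sum>i\<in>I. F i w) = (\<Sum>i\<in>I. circle_mean z r (F i))"
  unfolding circle_mean_def by (intro integral_sum circle_integrable assms)

lemma circle_mean_sum_list:
  fixes F :: "'i \<Rightarrow> complex \<Rightarrow> 'a::banach"
  assumes "\<And>i. i \<in> set xs \<Longrightarrow> continuous_on (sphere z r) (F i)" "r \<ge> 0"
  shows "circle_mean z r (\<lambda>w. \<Sum>i\<leftarrow>xs. F i w) = (\<Sum>i\<leftarrow>xs. circle_mean z r (F i))"
  using assms(1)
proof (induction xs)
  case (Cons a xs)
  have "continuous_on (sphere z r) (\<lambda>w. \<Sum>i\<leftarrow>xs. F i w)"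
    using Cons.prems by (induction xs) (auto intro!: continuous_intros)
  then show ?case
    using Cons assms(2) by (simp add: circle_mean_add)
qed simp

lemma circle_mean_mono:
  fixes F G :: "complex \<Rightarrow> real"
  assumes "continuous_on (sphere z r) F" "continuous_on (sphere z r) G" "r \<ge> 0"
    and "\<And>w. w \<in> sphere z r \<Longrightarrow> F w \<le> G w"
  shows "circle_mean z r F \<le> circle_mean z r G"
  unfolding circle_mean_def
  by (intro integral_le circle_integrable assms) (use assms in \<open>auto simp: dist_norm norm_mult\<close>)

lemma circle_mean_cong:
  assumes "\<And>w. w \<in> sphere z r \<Longrightarrow> F w = G w" "r \<ge> 0"
  shows "circle_mean z r F = circle_mean z r G"
  unfolding circle_mean_def
  by (intro integral_cong) (use assms in \<open>auto simp: dist_norm norm_mult\<close>)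

lemma norm_circle_mean_le:
  fixes F :: "complex \<Rightarrow> 'a::euclidean_space" and G :: "complex \<Rightarrow> real"
  assumes "continuous_on (sphere z r) F" "continuous_on (sphere z r) G" "r \<ge> 0"
    and "\<And>w. w \<in> sphere z r \<Longrightarrow> norm (F w) \<le> G w"
  shows "norm (circle_mean z r F) \<le> circle_mean z r G"
  unfolding circle_mean_def
  by (intro integral_norm_bound_integral circle_integrable assms) 
     (use assms in \<open>auto simp: dist_norm norm_mult\<close>)

lemma circle_mean_cnj:
  fixes F :: "complex \<Rightarrow> complex"
  assumes "continuous_on (sphere z r) F" "r \<ge> 0"
  shows "circle_mean z r (\<lambda>w. cnj (F w)) = cnj (circle_mean z r F)"
  unfolding circle_mean_def
  using integral_linear[OF circle_integrable[OF assms] bounded_linear_cnj] by (simp add: o_def)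

lemma circle_mean_Re:
  fixes F :: "complex \<Rightarrow> complex"
  assumes "continuous_on (sphere z r) F" "r \<ge> 0"
  shows "circle_mean z r (\<lambda>w. Re (F w)) = Re (circle_mean z r F)"
  unfolding circle_mean_def
  using integral_linear[OF circle_integrable[OF assms] bounded_linear_Re] by (simp add: o_def)

section \<open>Cauchy and Schwarz formulas as circle means\<close>

lemma contour_integral_unit_circle:
  "contour_integral (circlepath 0 1) F = 2 * of_real pi * \<i> * circle_mean 0 1 (\<lambda>w. w * F w)"
proof -
  have "contour_integral (circlepath 0 1) F =
      integral {0..1} (\<lambda>t. 2 * of_real pi * \<i> * (cis (2 * pi * t) * F (cis (2 * pi * t))))"
    unfolding contour_integral_integral vector_derivative_circlepath
    by (intro integral_cong) (simp add: circlepath cis_conv_exp mult_ac)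
  then show ?thesis
    by (simp add: circle_mean_def)
qed

lemma Cauchy_circle_mean:
  assumes "k holomorphic_on cball 0 1" "norm z < 1"
  shows "circle_mean 0 1 (\<lambda>w. k w * (w / (w - z) ^ Suc n)) = (deriv ^^ n) k z / fact n"
proof -
  have "contour_integral (circlepath 0 1) (\<lambda>u. k u / (u - z) ^ Suc n) 
        = 2 * pi * \<i> * (deriv ^^ n) k z / fact n"
    by (rule Cauchy_contour_integral_circlepath)
       (use assms in \<open>auto intro: holomorphic_on_imp_continuous_on holomorphic_on_subset\<close>)
  then show ?thesis
    by (simp add: contour_integral_unit_circle field_simps)
qed

text \<open>On the unit circle \<open>cnj w\<close> is 1/w, which turns the integrand into the
  conjugate of a function \<open>h\<close> holomorphic on the closed disc. Its mean is the conjugate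
  of \<open>h 0\<close>, and \<open>h\<close> contains the factor w^n, which vanishes at 0 because n
  \<ge> 1.\<close>

lemma Cauchy_circle_mean_conj:
  assumes "k holomorphic_on cball 0 1" "norm z < 1" "n \<ge> 1"
  shows "circle_mean 0 1 (\<lambda>w. cnj (k w) * (w / (w - z) ^ Suc n)) = 0"
proof -
  have z1: "1 - cnj z * w \<noteq> 0" if "norm w \<le> 1" for w
  proof -
    have "norm (cnj z * w) \<le> norm z * 1"
      unfolding norm_mult complex_mod_cnj using that by (intro mult_left_mono) auto
    then show ?thesis using assms(2) by auto
  qed
  define h where "h = (\<lambda>w. k w * w ^ n / (1 - cnj z * w) ^ Suc n)"
  have h: "h holomorphic_on cball 0 1"
    unfolding h_def using z1 by (intro holomorphic_intros assms(1)) auto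
  have eq: "cnj (k w) * (w / (w - z) ^ Suc n) = cnj (h w)" if "w \<in> sphere 0 1" for w
  proof -
    have w: "norm w = 1" and w0: "w \<noteq> 0" using that by auto
    have cw: "cnj w = inverse w"
      using w w0 complex_norm_square[of w] by (simp add: field_simps)
    have "cnj (h w) = cnj (k w) * inverse w ^ n / (1 - z * inverse w) ^ Suc n"
      by (simp add: h_def cw)
    also have "(1 - z * inverse w) = (w - z) * inverse w"
      using w0 by (simp add: field_simps)
    finally have "cnj (h w) = cnj (k w) * inverse w ^ n / ((w - z) ^ Suc n * inverse w ^ Suc n)"
      by (simp only: power_mult_distrib)
    then show ?thesis
      using w0 by (simp add: field_simps)
  qed
  have "circle_mean 0 1 (\<lambda>w. cnj (k w) * (w / (w - z) ^ Suc n)) = circle_mean 0 1 (\<lambda>w. cnj (h w))"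
    by (intro circle_mean_cong eq) auto
  also have "\<dots> = cnj (circle_mean 0 1 h)"
    by (intro circle_mean_cnj) (auto intro!: holomorphic_on_imp_continuous_on holomorphic_on_subset[OF h])
  also have "circle_mean 0 1 h = circle_mean 0 1 (\<lambda>w. h w * (w / (w - 0) ^ Suc 0))"
    by (intro circle_mean_cong) auto
  also have "\<dots> = 0"
    using Cauchy_circle_mean[OF h, of 0 0] assms(3) by (simp add: h_def)
  finally show ?thesis by simp
qed

text \<open>Write 2 Re k = k + cnj k: the first summand gives Cauchy's formula, the second has mean
  0. So every derivative of order n \<ge> 1 is recovered from the boundary values of Re k alone; for
  n = 0 an additional constant would appear.\<close>

lemma Schwarz_circle_mean:
  assumes "k holomorphic_on cball 0 1" "norm z < 1" "n \<ge> 1"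
  shows "circle_mean 0 1 (\<lambda>w. of_real (Re (k w)) * (2 * w / (w - z) ^ Suc n)) = (deriv ^^ n) k z / fact n"
proof -
  have ck: "continuous_on (sphere 0 1) k"
    by (rule holomorphic_on_imp_continuous_on[OF holomorphic_on_subset[OF assms(1)]]) auto
  have nz: "w \<noteq> z" if "norm w = 1" for w using that assms(2) by auto
  have "circle_mean 0 1 (\<lambda>w. of_real (Re (k w)) * (2 * w / (w - z) ^ Suc n))
     = circle_mean 0 1 (\<lambda>w. k w * (w / (w - z) ^ Suc n) + cnj (k w) * (w / (w - z) ^ Suc n))"
  proof (rule circle_mean_cong)
    fix w :: complex
    have "2 * of_real (Re (k w)) = k w + cnj (k w)" by (simp add: complex_add_cnj)
    then have "2 * of_real (Re (k w)) * (w / (w - z) ^ Suc n) = (k w + cnj (k w)) * (w / (w - z) ^ Suc n)"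
      by (simp only:)
    then show "of_real (Re (k w)) * (2 * w / (w - z) ^ Suc n) = 
       k w * (w / (w - z) ^ Suc n) + cnj (k w) * (w / (w - z) ^ Suc n)"
      by (simp only: distrib_right mult.assoc times_divide_eq_right mult.left_commute[of 2] add_divide_distrib)
  qed auto
  also have "\<dots> = circle_mean 0 1 (\<lambda>w. k w * (w / (w - z) ^ Suc n)) +
     circle_mean 0 1 (\<lambda>w. cnj (k w) * (w / (w - z) ^ Suc n))"
    using nz by (intro circle_mean_add) (auto intro!: continuous_intros ck)
  finally show ?thesis
    by (simp only: Cauchy_circle_mean[OF assms(1,2)] Cauchy_circle_mean_conj[OF assms]) simp
qed

section \<open>The Poisson--Jensen formula\<close>

abbreviation entire :: "(complex \<Rightarrow> complex) \<Rightarrow> bool" where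
  "entire f \<equiv> f holomorphic_on UNIV"

section \<open>Zeros of entire functions and Blaschke factorization\<close>

lemma entire_factor_at:
  assumes "entire f" "f w \<noteq> 0"
  obtains m g where "entire g" "g a \<noteq> 0" "\<And>z. f z = (z - a) ^ m * g z" "zorder f a = int m"
proof -
  define m where "m = nat (zorder f a)"
  define p where "p = zor_poly f a"
  have "\<exists>w\<in>UNIV. f w \<noteq> 0" using assms(2) by auto
  note * = zorder_exist_zero[OF assms(1) open_UNIV connected_UNIV UNIV_I this, of a]
  have "zorder f a \<ge> 0"
    using conjunct1[OF *] by (cases "f a = 0") auto
  moreover obtain r where "r > 0" "p holomorphic_on cball a r"
    "\<forall>w\<in>cball a r. f w = p w * (w - a) ^ m \<and> p w \<noteq> 0"
    using conjunct2[OF *] unfolding p_def m_def by blast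
  ultimately have r: "r > 0" "p a \<noteq> 0" "p holomorphic_on cball a r"
    "\<And>w. w \<in> cball a r \<Longrightarrow> f w = p w * (w - a) ^ m" "zorder f a \<ge> 0"
    by simp_all
  define g where "g = (\<lambda>z. if z \<in> ball a r then p z else f z / (z - a) ^ m)"
  have g1: "g z = f z / (z - a) ^ m" if "z \<noteq> a" for z
    using r(4)[of z] that by (auto simp: g_def)
  have "g holomorphic_on ball a r"
    by (rule holomorphic_transform[of p]) (auto simp: g_def intro: holomorphic_on_subset[OF r(3)])
  moreover have "g holomorphic_on - {a}"
    by (rule holomorphic_transform[of "\<lambda>z. f z / (z - a) ^ m"])
       (auto simp: g1 intro!: holomorphic_intros holomorphic_on_subset[OF assms(1)])
  ultimately have "g holomorphic_on (ball a r \<union> - {a})"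
    by (intro holomorphic_on_Un) auto
  also have "ball a r \<union> - {a} = UNIV" using r(1) by auto
  finally have "entire g" .
  moreover have "f z = (z - a) ^ m * g z" for z
    using g1[of z] r(1) r(4)[of z] by (cases "z = a") (auto simp: g_def)
  moreover have "g a \<noteq> 0" using r(1,2) by (simp add: g_def)
  moreover have "zorder f a = int m" using r(5) by (simp add: m_def)
  ultimately show thesis using that by blast
qed

lemma entire_zeros_finite:
  assumes "entire f" "f w \<noteq> 0" "compact K"
  shows "finite {z\<in>K. f z = 0}"
proof (cases "f constant_on UNIV")
  case True
  then have "f z \<noteq> 0" for z using assms(2) unfolding constant_on_def by (metis UNIV_I)
  then show ?thesis by simp
next
  case False
  then show ?thesis
    using holomorphic_compact_finite_zeros[of f UNIV K] assms by auto
qed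

lemma entire_zeros_countable:
  assumes "entire f" "f w \<noteq> 0"
  shows "countable {z. f z = 0}"
proof -
  have "{z. f z = 0} = (\<Union>n::nat. {z\<in>cball 0 (real n). f z = 0})"
    using real_arch_simple by auto
  moreover have "countable \<dots>"
    by (intro countable_UN[OF countableI_type] countable_finite entire_zeros_finite[OF assms]) auto
  ultimately show ?thesis by simp
qed

text \<open>The list \<open>xs\<close> repeats each zero as often as its multiplicity. The induction
  runs over the finite set of zeros in the closed disc and splits off one zero with its full
  multiplicity at a time.\<close>

lemma entire_factor_disc:
  assumes "entire f" "f w \<noteq> 0"
  shows "\<exists>xs h. set xs = {z\<in>cball 0 1. f z = 0} \<and> entire h \<and>
           (\<forall>z\<in>cball 0 1. h z \<noteq> 0) \<and> (\<forall>z. f z = (\<Prod>a\<leftarrow>xs. z - a) * h z)"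
proof -
  have "finite Z \<Longrightarrow> entire f \<Longrightarrow> f w \<noteq> 0 \<Longrightarrow> {z\<in>cball 0 1. f z = 0} = Z \<Longrightarrow> 
          \<exists>xs h. set xs = Z \<and> entire h \<and>
           (\<forall>z\<in>cball 0 1. h z \<noteq> 0) \<and> (\<forall>z. f z = (\<Prod>a\<leftarrow>xs. z - a) * h z)" for Z
  proof (induction Z arbitrary: f rule: finite_induct)
    case empty
    then show ?case by (intro exI[of _ "[]"] exI[of _ f]) auto
  next
    case (insert a Z)
    obtain m g where g: "entire g" "g a \<noteq> 0" "\<And>z. f z = (z - a) ^ m * g z"
      using entire_factor_at[OF insert.prems(1,2), of a] by metis
    have fa: "f a = 0" using insert.prems(3) by auto
    have m: "m > 0" using fa g(2) g(3)[of a] by (cases m) auto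
    have gw: "g w \<noteq> 0" using g(3)[of w] insert.prems(2) by auto
    have "{z\<in>cball 0 1. g z = 0} = {z\<in>cball 0 1. f z = 0} - {a}"
      using g(2,3) m by auto
    also have "\<dots> = Z" using insert.prems(3) insert.hyps(2) by auto
    finally obtain xs h where xs: "set xs = Z" "entire h"
           "\<forall>z\<in>cball 0 1. h z \<noteq> 0" "\<forall>z. g z = (\<Prod>a\<leftarrow>xs. z - a) * h z"
      using insert.IH[OF g(1) gw] by blast
    have "set (replicate m a @ xs) = insert a Z" using m xs by auto
    moreover have "f z = (\<Prod>a\<leftarrow>(replicate m a @ xs). z - a) * h z" for z
      using g(3)[of z] xs(4) by (simp add: prod_list_replicate)
    ultimately show ?case
      using xs(2,3) by metis
  qed
  moreover have "finite {z\<in>cball 0 1. f z = 0}"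
    by (rule entire_zeros_finite[OF assms]) auto
  ultimately show ?thesis using assms by (metis (mono_tags, lifting))
qed

lemma one_minus_cnj_mult_nonzero:
  fixes a z :: complex
  assumes "norm a < 1" "norm z \<le> 1"
  shows "1 - cnj a * z \<noteq> 0"
proof -
  have "norm (cnj a * z) \<le> norm a * 1"
    unfolding norm_mult complex_mod_cnj using assms by (intro mult_left_mono) auto
  then show ?thesis using assms by auto
qed

lemma norm_one_minus_cnj_mult:
  fixes a z :: complex
  assumes "norm z = 1"
  shows "norm (1 - cnj a * z) = norm (z - a)"
proof -
  have "norm (1 - cnj a * z) = norm (cnj (1 - cnj a * z))" by (simp only: complex_mod_cnj)
  also have "\<dots> = norm z * norm (1 - a * cnj z)" using assms by simp
  also have "\<dots> = norm (z - a * (z * cnj z))" by (simp add: norm_mult[symmetric] algebra_simps)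
  also have "z * cnj z = 1" using assms complex_norm_square[of z] by simp
  finally show ?thesis by simp
qed

lemma prod_list_nonzero:
  fixes F :: "'i \<Rightarrow> 'a::field"
  shows "(\<And>i. i \<in> set xs \<Longrightarrow> F i \<noteq> 0) \<Longrightarrow> (\<Prod>i\<leftarrow>xs. F i) \<noteq> 0"
  by (induction xs) auto

lemma holomorphic_on_prod_list:
  "(\<And>i. i \<in> set xs \<Longrightarrow> F i holomorphic_on S) \<Longrightarrow> (\<lambda>z. \<Prod>i\<leftarrow>xs. F i z) holomorphic_on S"
  by (induction xs) (auto intro!: holomorphic_intros)

lemma ln_norm_prod_list:
  fixes F :: "'i \<Rightarrow> complex"
  shows "(\<And>i. i \<in> set xs \<Longrightarrow> F i \<noteq> 0) \<Longrightarrow> ln (norm (\<Prod>i\<leftarrow>xs. F i)) = (\<Sum>i\<leftarrow>xs. ln (norm (F i)))"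
  by (induction xs) (auto simp: norm_mult ln_mult prod_list_nonzero)

text \<open>The denominators of the Blaschke factors are collected in \<open>H\<close>, which has no
  zero on the closed disc and, by compactness, none on a slightly larger disc; there it has a
  logarithm \<open>k\<close>. The radius e > 1 makes \<open>k\<close> holomorphic across the unit
  circle, as the Cauchy formulas require.\<close>

lemma entire_Blaschke:
  assumes f: "entire f" "\<And>z. norm z = 1 \<Longrightarrow> f z \<noteq> 0"
  obtains xs k e where "set xs = {z\<in>ball 0 1. f z = 0}" "e > 1" "k holomorphic_on ball 0 e"
    "\<And>z. norm z \<le> 1 \<Longrightarrow> f z = (\<Prod>a\<leftarrow>xs. (z - a) / (1 - cnj a * z)) * exp (k z)"
proof -
  have "f 1 \<noteq> 0" using f(2) by simp
  from entire_factor_disc[OF f(1) this] obtain xs h where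
    xs: "set xs = {z\<in>cball 0 1. f z = 0}" and h: "entire h"
    "\<And>z. norm z \<le> 1 \<Longrightarrow> h z \<noteq> 0" and fh: "\<And>z. f z = (\<Prod>a\<leftarrow>xs. z - a) * h z"
    using mem_cball_0 by metis
  have "norm z \<noteq> 1" if "f z = 0" for z using f(2) that by auto
  then have "norm z \<le> 1 \<and> f z = 0 \<longleftrightarrow> norm z < 1 \<and> f z = 0" for z
    by (metis nless_le)
  then have xs': "set xs = {z\<in>ball 0 1. f z = 0}"
    unfolding xs by simp
  have xs1: "norm a < 1" if "a \<in> set xs" for a using that xs' by auto
  define H where "H = (\<lambda>z. (\<Prod>a\<leftarrow>xs. 1 - cnj a * z) * h z)"
  have H: "entire H"
    unfolding H_def by (intro holomorphic_intros holomorphic_on_prod_list h)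
  have H0: "H z \<noteq> 0" if "norm z \<le> 1" for z
    unfolding H_def using h(2)[OF that] one_minus_cnj_mult_nonzero[OF xs1 that]
    by (simp add: prod_list_nonzero)
  have "open {z. H z \<noteq> 0}"
    using holomorphic_on_imp_continuous_on[OF H] by (intro open_Collect_neq) auto
  moreover have "cball 0 1 \<subseteq> {z. H z \<noteq> 0}" using H0 by auto
  ultimately obtain d where d: "d > 0" "(\<Union>x\<in>cball 0 1. ball x d) \<subseteq> {z. H z \<noteq> 0}"
    using compact_subset_open_imp_ball_epsilon_subset[OF compact_cball] by metis
  have Hd: "H z \<noteq> 0" if "z \<in> ball 0 (1 + d)" for z
  proof (cases "norm z \<le> 1")
    case False
    have "dist (sgn z) z = norm z - 1"
    proof -
      have "z = of_real (norm z) * sgn z" by (simp add: sgn_eq)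
      then have "sgn z - z = of_real (1 - norm z) * sgn z" by (metis left_diff_distrib mult_1 of_real_1 of_real_diff)
      then have "norm (sgn z - z) = \<bar>1 - norm z\<bar> * norm (sgn z)" by (metis norm_mult norm_of_real)
      then show ?thesis using False by (simp add: dist_norm norm_sgn split: if_splits)
    qed
    then have "z \<in> ball (sgn z) d" "sgn z \<in> cball 0 1" using that by (auto simp: norm_sgn)
    then show ?thesis using d(2) by blast
  qed (use H0 in auto)
  obtain k where k: "k holomorphic_on ball 0 (1 + d)" "\<And>z. z \<in> ball 0 (1 + d) \<Longrightarrow> exp (k z) = H z"
    using holomorphic_logarithm_exists[of "ball 0 (1+d)" H 0] Hd d(1) H
    by (auto intro: holomorphic_on_subset)
  show thesis
  proof (rule that[of xs "1 + d" k])
    fix z :: complex assume z: "norm z \<le> 1"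
    have "(\<Prod>a\<leftarrow>xs. (z - a) / (1 - cnj a * z)) * (\<Prod>a\<leftarrow>xs. 1 - cnj a * z) = (\<Prod>a\<leftarrow>xs. z - a)"
      using xs1
    proof (induction xs)
      case (Cons b ys)
      then show ?case
        using one_minus_cnj_mult_nonzero[of b z] z by (simp add: field_simps)
    qed simp
    then show "f z = (\<Prod>a\<leftarrow>xs. (z - a) / (1 - cnj a * z)) * exp (k z)"
      using k(2)[of z] z d(1) fh[of z] by (simp add: H_def mult.assoc[symmetric])
  next
    show "1 + d > 1" using d(1) by simp
  qed (fact xs' k(1))+
qed

lemma continuous_on_ln_norm:
  assumes "entire f" "\<And>w. w \<in> S \<Longrightarrow> f w \<noteq> 0"
  shows "continuous_on S (\<lambda>w. ln (norm (f w)))"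
  using assms(2) 
  by (intro continuous_intros continuous_on_subset[OF holomorphic_on_imp_continuous_on[OF assms(1)]]) auto

section \<open>The Poisson--Jensen formula and its derivatives\<close>

lemma has_field_derivative_Blaschke_list:
  assumes "\<And>a. a \<in> set xs \<Longrightarrow> z \<noteq> a \<and> 1 - cnj a * z \<noteq> 0"
  shows "((\<lambda>z. \<Prod>a\<leftarrow>xs. (z - a) / (1 - cnj a * z)) has_field_derivative
          (\<Prod>a\<leftarrow>xs. (z - a) / (1 - cnj a * z)) * (\<Sum>a\<leftarrow>xs. 1 / (z - a) + cnj a / (1 - cnj a * z))) (at z)"
  using assms
proof (induction xs)
  case (Cons a xs)
  let ?P = "\<lambda>z. \<Prod>a\<leftarrow>xs. (z - a) / (1 - cnj a * z)" and ?b = "\<lambda>z. (z - a) / (1 - cnj a * z)"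
  let ?S = "\<Sum>a\<leftarrow>xs. 1 / (z - a) + cnj a / (1 - cnj a * z)"
  have nz: "z - a \<noteq> 0" "1 - cnj a * z \<noteq> 0" using Cons.prems[of a] by auto
  have IH: "(?P has_field_derivative ?P z * ?S) (at z)"
    using Cons by simp
  have b: "(?b has_field_derivative ?b z * (1 / (z - a) + cnj a / (1 - cnj a * z))) (at z)"
    using nz by (auto intro!: derivative_eq_intros simp: divide_simps)
  have *: "p * s * q + (q * t) * p = (p * q) * (s + t)" for p q s t :: complex
    by (simp add: algebra_simps)
  show ?case
    using DERIV_mult[OF b IH] unfolding * by simp
qed auto

lemma has_field_derivative_Blaschke_sum:
  assumes "\<And>a. a \<in> set xs \<Longrightarrow> z \<noteq> a \<and> 1 - cnj a * z \<noteq> 0"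
  shows "((\<lambda>z. \<Sum>a\<leftarrow>xs. 1 / (z - a) + cnj a / (1 - cnj a * z)) has_field_derivative
          (\<Sum>a\<leftarrow>xs. (cnj a / (1 - cnj a * z))\<^sup>2 - (1 / (z - a))\<^sup>2)) (at z)"
  using assms
proof (induction xs)
  case (Cons a xs)
  have nz: "z - a \<noteq> 0" "1 - cnj a * z \<noteq> 0" using Cons.prems[of a] by auto
  have "((\<lambda>z. 1 / (z - a) + cnj a / (1 - cnj a * z)) has_field_derivative
      (cnj a / (1 - cnj a * z))\<^sup>2 - (1 / (z - a))\<^sup>2) (at z)"
    using nz by (auto intro!: derivative_eq_intros) (simp add: power2_eq_square divide_simps)
  from DERIV_add[OF this Cons.IH] show ?case
    using Cons.prems by simp
qed auto

text \<open>A Blaschke product has modulus 1 on the unit circle, so ln |f| = Re k there. The Schwarz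
  formula for n = 1 and n = 2 recovers k' and k''/2, and the zeros contribute the logarithmic
  derivative of the Blaschke product and its derivative. The value of Re k at 0 is Jensen's
  formula.\<close>

theorem Poisson_Jensen_unit_disc:
  assumes f: "entire f" "\<And>z. norm z = 1 \<Longrightarrow> f z \<noteq> 0" "f 0 \<noteq> 0"
  obtains xs where "set xs = {z\<in>ball 0 1. f z = 0}"
    "circle_mean 0 1 (\<lambda>w. ln (norm (f w))) = ln (norm (f 0)) + (\<Sum>a\<leftarrow>xs. - ln (norm a))"
    "\<And>z. norm z < 1 \<Longrightarrow> f z \<noteq> 0 \<Longrightarrow> deriv f z / f z =
       circle_mean 0 1 (\<lambda>w. of_real (ln (norm (f w))) * (2 * w / (w - z) ^ 2))
       + (\<Sum>a\<leftarrow>xs. 1 / (z - a) + cnj a / (1 - cnj a * z))"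
    "\<And>z. norm z < 1 \<Longrightarrow> f z \<noteq> 0 \<Longrightarrow> deriv (\<lambda>z. deriv f z / f z) z =
       2 * circle_mean 0 1 (\<lambda>w. of_real (ln (norm (f w))) * (2 * w / (w - z) ^ 3))
       + (\<Sum>a\<leftarrow>xs. (cnj a / (1 - cnj a * z))\<^sup>2 - (1 / (z - a))\<^sup>2)"
proof -
  obtain xs k e where xs: "set xs = {z\<in>ball 0 1. f z = 0}" and e: "e > 1" 
    and k: "k holomorphic_on ball 0 e"
    and fk: "\<And>z. norm z \<le> 1 \<Longrightarrow> f z = (\<Prod>a\<leftarrow>xs. (z - a) / (1 - cnj a * z)) * exp (k z)"
    by (rule entire_Blaschke[OF f(1,2)]) (assumption, blast)
  let ?B = "\<lambda>z. \<Prod>a\<leftarrow>xs. (z - a) / (1 - cnj a * z)"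
  let ?S = "\<lambda>z. \<Sum>a\<leftarrow>xs. 1 / (z - a) + cnj a / (1 - cnj a * z)"
  have kc: "k holomorphic_on cball 0 1"
    using e by (intro holomorphic_on_subset[OF k]) auto
  have xs1: "norm a < 1" "f a = 0" if "a \<in> set xs" for a using that xs by auto
  have nz: "z \<noteq> a \<and> 1 - cnj a * z \<noteq> 0" if "norm z \<le> 1" "f z \<noteq> 0" "a \<in> set xs" for z a
    using that xs1 one_minus_cnj_mult_nonzero by metis
  have Rek: "ln (norm (f w)) = Re (k w)" if "norm w = 1" for w
  proof -
    have "norm (?B w) = 1"
    proof -
      have "\<forall>a\<in>set xs. norm ((w - a) / (1 - cnj a * w)) = 1"
        using nz[of w] f(2)[of w] that by (auto simp: norm_divide norm_one_minus_cnj_mult)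
      then show ?thesis by (induction xs) (auto simp: norm_mult norm_divide)
    qed
    then show ?thesis using fk[of w] that by (simp add: norm_mult)
  qed
  have ck: "continuous_on (sphere 0 1) k"
    by (rule holomorphic_on_imp_continuous_on[OF holomorphic_on_subset[OF kc]]) auto
  have Schwarz: "circle_mean 0 1 (\<lambda>w. of_real (ln (norm (f w))) * (2 * w / (w - z) ^ Suc n)) = (deriv ^^ n) k z / fact n"
    if "norm z < 1" "n \<ge> 1" for z n
  proof -
    have "circle_mean 0 1 (\<lambda>w. of_real (ln (norm (f w))) * (2 * w / (w - z) ^ Suc n))
        = circle_mean 0 1 (\<lambda>w. of_real (Re (k w)) * (2 * w / (w - z) ^ Suc n))"
      by (intro circle_mean_cong) (auto simp: Rek)
    then show ?thesis by (simp only: Schwarz_circle_mean[OF kc that])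
  qed
  define U where "U = {z\<in>ball 0 1. f z \<noteq> 0}"
  have "U = ball 0 1 \<inter> {z. f z \<noteq> 0}" by (auto simp: U_def)
  then have U: "open U"
    using holomorphic_on_imp_continuous_on[OF f(1)] by (auto intro!: open_Int open_Collect_neq)
  have dk: "(k has_field_derivative deriv k z) (at z)" if "norm z < 1" for z
    using k e that by (intro holomorphic_derivI[OF k]) auto
  have ld: "deriv f z / f z = deriv k z + ?S z" if z: "z \<in> U" for z
  proof -
    have zz: "norm z < 1" "f z \<noteq> 0" using z by (auto simp: U_def)
    have "((\<lambda>z. ?B z * exp (k z)) has_field_derivative ?B z * ?S z * exp (k z) + exp (k z) * deriv k z * ?B z) (at z)"
      by (intro DERIV_mult has_field_derivative_Blaschke_list DERIV_fun_exp dk) (use zz nz in auto)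
    then have "(f has_field_derivative ?B z * ?S z * exp (k z) + exp (k z) * deriv k z * ?B z) (at z)"
      by (rule has_field_derivative_transform_within_open[OF _ U z]) (auto simp: fk U_def)
    also have "?B z * ?S z * exp (k z) + exp (k z) * deriv k z * ?B z = f z * (deriv k z + ?S z)"
      using fk[of z] zz by (simp add: algebra_simps)
    finally have "deriv f z = f z * (deriv k z + ?S z)" by (rule DERIV_imp_deriv)
    then show ?thesis using zz by simp
  qed
  show thesis
  proof (rule that[of xs])
    show "set xs = {z\<in>ball 0 1. f z = 0}" by fact
    have "circle_mean 0 1 (\<lambda>w. ln (norm (f w))) = circle_mean 0 1 (\<lambda>w. Re (k w))"
      by (intro circle_mean_cong) (auto simp: Rek)
    also have "\<dots> = Re (circle_mean 0 1 (\<lambda>w. k w * (w / (w - 0) ^ Suc 0)))"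
      by (subst circle_mean_Re[OF ck]) (auto intro!: arg_cong[of _ _ Re] circle_mean_cong)
    also have "\<dots> = Re (k 0)"
      by (subst Cauchy_circle_mean[OF kc]) auto
    also have "Re (k 0) = ln (norm (f 0)) + (\<Sum>a\<leftarrow>xs. - ln (norm a))"
    proof -
      have "0 \<notin> set xs" using xs1 f(3) by auto
      then have "ln (norm (\<Prod>a\<leftarrow>xs. - a)) = (\<Sum>a\<leftarrow>xs. ln (norm a))"
        by (subst ln_norm_prod_list) auto
      moreover have "(\<Prod>a\<leftarrow>xs. - a) \<noteq> 0" using \<open>0 \<notin> set xs\<close> by (intro prod_list_nonzero) auto
      moreover have "(\<Sum>a\<leftarrow>xs. - ln (norm a)) = - (\<Sum>a\<leftarrow>xs. ln (norm a))"
        by (induction xs) auto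
      ultimately show ?thesis
        using fk[of 0] by (simp add: norm_mult ln_mult)
    qed
    finally show "circle_mean 0 1 (\<lambda>w. ln (norm (f w))) = ln (norm (f 0)) + (\<Sum>a\<leftarrow>xs. - ln (norm a))" .
  next
    fix z :: complex assume z: "norm z < 1" "f z \<noteq> 0"
    then have zU: "z \<in> U" by (auto simp: U_def)
    show "deriv f z / f z = circle_mean 0 1 (\<lambda>w. of_real (ln (norm (f w))) * (2 * w / (w - z) ^ 2)) + ?S z"
      using ld[OF zU] Schwarz[OF z(1), of 1] by (simp add: numeral_2_eq_2)
    have "((\<lambda>z. deriv k z + ?S z) has_field_derivative deriv (deriv k) z + 
        (\<Sum>a\<leftarrow>xs. (cnj a / (1 - cnj a * z))\<^sup>2 - (1 / (z - a))\<^sup>2)) (at z)"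
      using nz z e by (intro DERIV_add has_field_derivative_Blaschke_sum 
             holomorphic_derivI[OF holomorphic_deriv[OF k]]) auto
    then have "((\<lambda>z. deriv f z / f z) has_field_derivative deriv (deriv k) z + 
        (\<Sum>a\<leftarrow>xs. (cnj a / (1 - cnj a * z))\<^sup>2 - (1 / (z - a))\<^sup>2)) (at z)"
      by (rule has_field_derivative_transform_within_open[OF _ U zU]) (simp add: ld)
    then have D: "deriv (\<lambda>z. deriv f z / f z) z = deriv (deriv k) z +
        (\<Sum>a\<leftarrow>xs. (cnj a / (1 - cnj a * z))\<^sup>2 - (1 / (z - a))\<^sup>2)"
      by (rule DERIV_imp_deriv)
    have d2: "(deriv ^^ 2) k = deriv (deriv k)" by (simp add: numeral_2_eq_2)
    have "circle_mean 0 1 (\<lambda>w. of_real (ln (norm (f w))) * (2 * w / (w - z) ^ 3)) = deriv (deriv k) z / 2"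
      using Schwarz[OF z(1), of 2] d2 by simp
    then show "deriv (\<lambda>z. deriv f z / f z) z =
       2 * circle_mean 0 1 (\<lambda>w. of_real (ln (norm (f w))) * (2 * w / (w - z) ^ 3))
       + (\<Sum>a\<leftarrow>xs. (cnj a / (1 - cnj a * z))\<^sup>2 - (1 / (z - a))\<^sup>2)"
      unfolding D by (simp only:) simp
  qed
qed

section \<open>Logarithmic derivatives\<close>

text \<open>Up to pi/3 the derivative cos x - 1/2 is nonnegative; beyond it sin x is at least sqrt 3
  / 2, which exceeds pi/4.\<close>

lemma sin_ge_half: 
  assumes "0 \<le> x" "x \<le> pi / 2"
  shows "sin x \<ge> x / (2::real)"
proof (cases "x \<le> pi / 3")
  case True
  have "sin 0 - 0 / 2 \<le> sin x - x / 2"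
  proof (rule DERIV_nonneg_imp_nondecreasing[OF assms(1)])
    fix y assume y: "0 \<le> y" "y \<le> x"
    have "cos (pi / 3) \<le> cos y"
      by (rule cos_monotone_0_pi_le) (use y True pi_gt_zero in auto)
    then show "\<exists>d. ((\<lambda>x. sin x - x / 2) has_real_derivative d) (at y) \<and> 0 \<le> d"
      by (intro exI[of _ "cos y - 1/2"]) (auto intro!: derivative_eq_intros simp: cos_60)
  qed
  then show ?thesis by simp
next
  case False
  have "sin (pi / 3) \<le> sin x"
    by (rule sin_monotone_2pi_le) (use False assms pi_gt_zero in auto)
  moreover have "sqrt 3 \<ge> 1.7" by (rule real_le_rsqrt) (simp add: power2_eq_square)
  ultimately show ?thesis using assms pi_less_4 pi_approx by (simp add: sin_60)
qed

lemma abs_sin_pi_ge: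
  assumes "\<bar>x\<bar> \<le> 1"
  shows "\<bar>sin (pi * x)\<bar> \<ge> min \<bar>x\<bar> (1 - \<bar>x\<bar>)"
proof -
  have main: "sin (pi * y) \<ge> min y (1 - y)" if "0 \<le> y" "y \<le> 1" for y :: real
  proof (cases "y \<le> 1 / 2")
    case True
    have "sin (pi * y) \<ge> pi * y / 2" using True that by (intro sin_ge_half) auto
    moreover have "pi * y \<ge> 2 * y" using that pi_ge_two by (intro mult_right_mono) auto
    ultimately show ?thesis by simp
  next
    case False
    have "sin (pi * (1 - y)) \<ge> pi * (1 - y) / 2" using False that by (intro sin_ge_half) auto
    moreover have "pi * (1 - y) \<ge> 2 * (1 - y)" using that pi_ge_two by (intro mult_right_mono) auto
    moreover have "sin (pi * (1 - y)) = sin (pi * y)" by (simp add: right_diff_distrib)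
    ultimately show ?thesis by simp
  qed
  show ?thesis
    using main[of "\<bar>x\<bar>"] assms by (cases "x \<ge> 0") auto
qed

lemma norm_cis_diff: "norm (cis x - cis y) = 2 * \<bar>sin ((x - y) / 2)\<bar>"
proof -
  have "cis x - cis y = cis y * (exp (\<i> * of_real (x - y)) - 1)"
    by (simp add: cis_conv_exp right_diff_distrib exp_diff)
  then have "norm (cis x - cis y) = dist (exp (\<i> * of_real (x - y))) 1"
    by (simp add: norm_mult dist_norm)
  also have "\<dots> = 2 * \<bar>sin ((x - y) / 2)\<bar>" using dist_exp_i_1[of "x - y"] by (simp add: dist_norm norm_minus_commute)
  finally show ?thesis .
qed

lemma has_integral_inverse_sqrt_abs:
  fixes u :: real
  shows "((\<lambda>t. 1 / sqrt \<bar>t - u\<bar>) has_integral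
     (2 * sgn (1 - u) * sqrt \<bar>1 - u\<bar> - 2 * sgn (0 - u) * sqrt \<bar>0 - u\<bar>)) {0..1}"
proof (rule fundamental_theorem_of_calculus_interior_strong[of "{u}"])
  fix x assume x: "x \<in> {0<..<1} - {u}"
  show "((\<lambda>t. 2 * sgn (t - u) * sqrt \<bar>t - u\<bar>) has_vector_derivative 1 / sqrt \<bar>x - u\<bar>) (at x)"
  proof (cases "x > u")
    case True
    have "((\<lambda>t. 2 * sqrt (t - u)) has_real_derivative 1 / sqrt \<bar>x - u\<bar>) (at x)"
      using True by (auto intro!: derivative_eq_intros simp: field_simps)
    then have "((\<lambda>t. 2 * sgn (t - u) * sqrt \<bar>t - u\<bar>) has_real_derivative 1 / sqrt \<bar>x - u\<bar>) (at x)"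
      by (rule has_field_derivative_transform_within_open[of _ _ _ "{u<..}"]) (use True in auto)
    then show ?thesis by (simp add: has_real_derivative_iff_has_vector_derivative)
  next
    case False
    then have "x < u" using x by auto
    then have "((\<lambda>t. - 2 * sqrt (u - t)) has_real_derivative 1 / sqrt \<bar>x - u\<bar>) (at x)"
      by (auto intro!: derivative_eq_intros simp: field_simps)
    then have "((\<lambda>t. 2 * sgn (t - u) * sqrt \<bar>t - u\<bar>) has_real_derivative 1 / sqrt \<bar>x - u\<bar>) (at x)"
      by (rule has_field_derivative_transform_within_open[of _ _ _ "{..<u}"]) (use \<open>x < u\<close> in auto)
    then show ?thesis by (simp add: has_real_derivative_iff_has_vector_derivative)
  qed
next
  have "2 * sgn (t - u) * sqrt \<bar>t - u\<bar> = (if t \<le> u then - 2 * sqrt (u - t) else 2 * sqrt (t - u))" for t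
    by (cases t u rule: linorder_cases) simp_all
  moreover have "continuous_on {0..1} (\<lambda>t. if t \<le> u then - 2 * sqrt (u - t) else 2 * sqrt (t - u))"
    by (rule continuous_on_cases_le[where h = "\<lambda>t. t"]; (intro continuous_intros)?) simp
  ultimately show "continuous_on {0..1} (\<lambda>t. 2 * sgn (t - u) * sqrt \<bar>t - u\<bar>)"
    by presburger
qed auto

lemma integral_inverse_sqrt_abs_le:
  fixes u :: real
  assumes "-1 \<le> u" "u \<le> 2"
  shows "integral {0..1} (\<lambda>t. 1 / sqrt \<bar>t - u\<bar>) \<le> 6"
proof -
  have b: "sqrt \<bar>y\<bar> \<le> 3/2" if "\<bar>y\<bar> \<le> 2" for y :: real
    using that by (intro real_le_lsqrt) (auto simp: power2_eq_square)
  have c: "\<bar>2 * sgn y * sqrt \<bar>y\<bar>\<bar> \<le> 3" if "\<bar>y\<bar> \<le> 2" for y :: real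
    using b[OF that] by (auto simp: sgn_if abs_mult)
  have "\<bar>2 * sgn (1 - u) * sqrt \<bar>1 - u\<bar>\<bar> \<le> 3" "\<bar>2 * sgn (0 - u) * sqrt \<bar>0 - u\<bar>\<bar> \<le> 3"
    using assms by (intro c; simp)+
  then show ?thesis
    using integral_unique[OF has_integral_inverse_sqrt_abs[of u]] by linarith
qed

text \<open>Sliding the point r v along its ray to the circle of radius \<open>\<rho>\<close> moves
  it by |\<rho> - r|, which is at most the distance from z to r v. This reduces estimates for an
  arbitrary point to points on the circle.\<close>

lemma norm_diff_ge_projection:
  fixes z v :: complex
  assumes "norm v = 1" "norm z = \<rho>" "r \<ge> 0"
  shows "norm (z - of_real r * v) \<ge> norm (z - of_real \<rho> * v) / 2"
proof -
  have "\<bar>\<rho> - r\<bar> \<le> norm (z - of_real r * v)"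
    using norm_triangle_ineq3[of z "of_real r * v"] assms by (simp add: norm_mult)
  moreover have "norm (z - of_real \<rho> * v) \<le> norm (z - of_real r * v) + norm (of_real r * v - of_real \<rho> * v)"
    by (metis norm_triangle_sub add.commute diff_diff_eq2 diff_add_cancel norm_triangle_ineq)
  moreover have "norm (of_real r * v - of_real \<rho> * v) = \<bar>\<rho> - r\<bar>"
    using assms(1) by (metis abs_minus_commute left_diff_distrib mult.right_neutral norm_mult norm_of_real of_real_diff)
  ultimately show ?thesis by simp
qed

text \<open>The singularity |z - a|^(-1) is not uniformly integrable along the circle as a
  approaches it, but its square root is. After projecting a to the circle, |z - a| is at least half
  the distance of the parameters t and s modulo 1; the three centres s, s - 1, s + 1 cover that
  distance, each integral is at most 6, and 2 (6 + 6 + 6) = 36.\<close>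

lemma circle_mean_inverse_sqrt_le:
  fixes a :: complex
  assumes "\<rho> \<ge> 1/2" "norm a \<noteq> \<rho>"
  shows "circle_mean 0 \<rho> (\<lambda>z. 1 / sqrt (norm (z - a))) \<le> 36"
proof -
  define s where "s = Arg2pi a / (2 * pi)"
  have s: "0 \<le> s" "s \<le> 1" using Arg2pi_ge_0[of a] Arg2pi_lt_2pi[of a] by (auto simp: s_def field_simps)
  have a: "a = of_real (norm a) * cis (2 * pi * s)"
    using Arg2pi_eq[of a] by (simp add: s_def cis_conv_exp mult_ac)
  let ?F = "\<lambda>t. 1 / sqrt (norm (of_real \<rho> * cis (2 * pi * t) - a))"
  let ?\<phi> = "\<lambda>u t. 1 / sqrt \<bar>t - u\<bar>"
  let ?G = "\<lambda>t. 2 * (?\<phi> s t + ?\<phi> (s - 1) t + ?\<phi> (s + 1) t)"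
  have \<phi>: "?\<phi> u integrable_on {0..1}" for u
    using has_integral_inverse_sqrt_abs by blast
  have G: "?G integrable_on {0..1}"
    using integrable_on_cmult_left[OF integrable_add[OF integrable_add[OF \<phi>[of s] \<phi>[of "s-1"]] \<phi>[of "s+1"]], of 2]
    by simp
  have le: "?F t \<le> ?G t" if t: "t \<in> {0..1} - {0, 1, s}" for t
  proof -
    define m where "m = min \<bar>t - s\<bar> (1 - \<bar>t - s\<bar>)"
    have ts: "\<bar>t - s\<bar> \<le> 1" using t s by auto
    have "norm (of_real \<rho> * cis (2 * pi * t) - of_real \<rho> * cis (2 * pi * s)) = \<rho> * norm (cis (2 * pi * t) - cis (2 * pi * s))"
      using assms(1) by (metis abs_of_nonneg norm_mult norm_of_real right_diff_distrib order_trans zero_le_divide_1_iff zero_le_numeral)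
    also have "norm (cis (2 * pi * t) - cis (2 * pi * s)) = 2 * \<bar>sin (pi * (t - s))\<bar>"
    proof -
      have "(2 * pi * t - 2 * pi * s) / 2 = pi * (t - s)" by (simp add: field_simps)
      then show ?thesis unfolding norm_cis_diff by simp
    qed
    finally have 1: "norm (of_real \<rho> * cis (2 * pi * t) - of_real \<rho> * cis (2 * pi * s)) = 2 * \<rho> * \<bar>sin (pi * (t - s))\<bar>" by simp
    have "norm (of_real \<rho> * cis (2 * pi * t) - a) \<ge> \<rho> * \<bar>sin (pi * (t - s))\<bar>"
      using norm_diff_ge_projection[of "cis (2 * pi * s)" "of_real \<rho> * cis (2 * pi * t)" \<rho> "norm a"] 1 a assms(1)
      by (simp add: norm_mult)
    moreover have "\<rho> * \<bar>sin (pi * (t - s))\<bar> \<ge> (1/2) * m"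
      using abs_sin_pi_ge[OF ts] assms(1) ts by (intro mult_mono) (auto simp: m_def)
    ultimately have n: "norm (of_real \<rho> * cis (2 * pi * t) - a) \<ge> m / 2" by simp
    have nn: "?\<phi> u t \<ge> 0" for u by simp
    have m: "m > 0" using t s by (auto simp: m_def)
    show ?thesis
    proof -
      have "?F t \<le> 1 / sqrt (m / 2)" using n m by (intro divide_left_mono) (auto intro!: mult_pos_pos)
      also have "\<dots> = sqrt 2 * (1 / sqrt m)" by (simp add: real_sqrt_divide)
      also have "\<dots> \<le> 2 * (1 / sqrt m)"
        using m by (intro mult_right_mono) (auto intro: real_le_lsqrt)
      also have "1 / sqrt m \<le> ?\<phi> s t + ?\<phi> (s - 1) t + ?\<phi> (s + 1) t"
      proof -
        have "m = \<bar>t - s\<bar> \<or> m = \<bar>t - (s - 1)\<bar> \<or> m = \<bar>t - (s + 1)\<bar>" using t s by (auto simp: m_def min_def)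
        then show ?thesis using nn[of s] nn[of "s - 1"] nn[of "s + 1"] by fastforce
      qed
      finally show ?thesis by simp
    qed
  qed
  have cF: "continuous_on (sphere 0 \<rho>) (\<lambda>z. 1 / sqrt (norm (z - a)))"
    using assms(2) by (auto intro!: continuous_intros)
  have iF: "?F integrable_on {0..1}"
    using circle_integrable[OF cF] assms(1) by simp
  \<comment> \<open>At a centre such as t = s a summand of the majorant is 1/0 = 0, so domination
    may fail there. \<open>H\<close> repairs these finitely many parameters without changing the
    integral.\<close>
  define H where "H = (\<lambda>t. if t \<in> {0, 1, s} then ?F t else ?G t)"
  have "?F t \<le> H t" if "t \<in> {0..1}" for t
    using le[of t] that by (simp add: H_def)
  moreover have "H integrable_on {0..1}"
    by (rule integrable_spike_finite[OF _ _ G, of "{0, 1, s}"]) (auto simp: H_def)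
  ultimately have "integral {0..1} ?F \<le> integral {0..1} H"
    by (intro integral_le iF) auto
  also have "\<dots> = integral {0..1} ?G"
    by (rule integral_spike[of "{0, 1, s}"]) (auto simp: H_def)
  also have "\<dots> = 2 * (integral {0..1} (?\<phi> s) + integral {0..1} (?\<phi> (s - 1)) + integral {0..1} (?\<phi> (s + 1)))"
    by (simp only: integral_mult_right integral_add[OF integrable_add[OF \<phi> \<phi>] \<phi>] integral_add[OF \<phi> \<phi>])
  also have "\<dots> \<le> 2 * (6 + 6 + 6)"
    using s by (intro mult_left_mono add_mono integral_inverse_sqrt_abs_le) auto
  finally show ?thesis by (simp add: circle_mean_def)
qed

section \<open>A common majorant for differences of logarithmic derivatives\<close>

lemma sqrt_sum_list_le:
  assumes "\<And>a. a \<in> set xs \<Longrightarrow> f a \<ge> 0"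
  shows "sqrt (\<Sum>a\<leftarrow>xs. f a) \<le> (\<Sum>a\<leftarrow>xs. sqrt (f a))"
  using assms
proof (induction xs)
  case (Cons a xs)
  have "sqrt (f a + (\<Sum>a\<leftarrow>xs. f a)) \<le> sqrt (f a) + sqrt (\<Sum>a\<leftarrow>xs. f a)"
    using Cons.prems by (intro sqrt_add_le_add_sqrt sum_list_nonneg) auto
  then show ?case using Cons by force
qed auto

lemma sqrt_sum_le:
  assumes "finite A" "\<And>a. a \<in> A \<Longrightarrow> f a \<ge> 0"
  shows "sqrt (\<Sum>a\<in>A. f a) \<le> (\<Sum>a\<in>A. sqrt (f a))"
  using assms
proof (induction A)
  case (insert a A)
  have "sqrt (f a + (\<Sum>a\<in>A. f a)) \<le> sqrt (f a) + sqrt (\<Sum>a\<in>A. f a)"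
    using insert.prems by (intro sqrt_add_le_add_sqrt sum_nonneg) auto
  then show ?case using insert by force
qed auto

lemma sum_list_squares_le:
  fixes f :: "'a \<Rightarrow> real"
  assumes "\<And>a. a \<in> set xs \<Longrightarrow> f a \<ge> 0"
  shows "(\<Sum>a\<leftarrow>xs. (f a)\<^sup>2) \<le> (\<Sum>a\<leftarrow>xs. f a)\<^sup>2"
  using assms
proof (induction xs)
  case (Cons a xs)
  have "0 \<le> f a * (\<Sum>a\<leftarrow>xs. f a)"
    using Cons.prems by (intro mult_nonneg_nonneg sum_list_nonneg) auto
  then show ?case using Cons by (force simp: power2_sum)
qed auto

text \<open>All costs are charged to -ln |a|, whose sum over the zeros Jensen's formula controls.
  For a zero beyond the middle radius (1 + \<rho>)/2 the two parts of the term combine to (1 -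
  |a|^2) / ((z - a)(1 - cnj a z)), and 1 - |a|^2 \<le> -2 ln |a|. For a zero inside it the singular
  part is kept as \<open>x\<close>, and the bounded part is absorbed because -ln |a| is at least
  1/(2D). The third estimate serves to count the inner zeros.\<close>

lemma Blaschke_term_bounds:
  fixes a z :: complex
  assumes \<rho>: "norm z = \<rho>" "\<rho> < 1" and a: "0 < norm a" "norm a < 1" "a \<noteq> z"
    and D: "D = 1 / (1 - \<rho>)"
  defines "x \<equiv> (if norm a \<le> (1 + \<rho>) / 2 then 1 / norm (z - a) else 0)"
  shows "norm (1 / (z - a) + cnj a / (1 - cnj a * z)) \<le> x + 4 * D ^ 2 * (- ln (norm a))"
    and "norm ((cnj a / (1 - cnj a * z))\<^sup>2 - (1 / (z - a))\<^sup>2) \<le> x ^ 2 + 12 * D ^ 3 * (- ln (norm a))"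
    and "norm a \<le> (1 + \<rho>) / 2 \<Longrightarrow> 1 \<le> 2 * D * (- ln (norm a))"
proof -
  define l where "l = - ln (norm a)"
  have l: "l \<ge> 1 - norm a" using ln_le_minus_one[of "norm a"] a by (simp add: l_def)
  have l0: "l > 0" using l a by simp
  have \<rho>0: "\<rho> \<ge> 0" using \<rho>(1) by auto
  have D1: "D \<ge> 1" unfolding D using \<rho> \<rho>0 by simp
  have lin: "1 - norm a * \<rho> \<ge> 1 - \<rho>" using a \<rho>0 by (simp add: mult_left_le_one_le)
  have "norm (1 - cnj a * z) \<ge> 1 - norm a * \<rho>"
    using norm_triangle_ineq2[of 1 "cnj a * z"] \<rho> by (simp add: norm_mult)
  then have n1: "norm (1 - cnj a * z) \<ge> 1 - \<rho>" using lin by linarith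
  then have n0: "norm (1 - cnj a * z) > 0" using \<rho> by linarith
  have i1: "1 / norm (1 - cnj a * z) \<le> D" unfolding D using n1 \<rho> by (intro divide_left_mono) (auto intro: mult_pos_pos n0)
  have "norm (cnj a / (1 - cnj a * z)) = norm a * (1 / norm (1 - cnj a * z))" by (simp add: norm_divide)
  also have "\<dots> \<le> 1 * D" using a i1 by (intro mult_mono) auto
  finally have Yb: "norm (cnj a / (1 - cnj a * z)) \<le> D" by simp
  have nz: "z - a \<noteq> 0" "1 - cnj a * z \<noteq> 0" using a n0 by auto
  have tD: "1 \<le> 2 * D * l" if "norm a \<le> (1 + \<rho>) / 2"
  proof -
    have "l \<ge> (1 - \<rho>) / 2" using l that by (simp add: field_simps)
    then have "2 * D * l \<ge> 2 * D * ((1 - \<rho>) / 2)" using D1 by (intro mult_left_mono) auto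
    moreover have "2 * D * ((1 - \<rho>) / 2) = 1" using \<rho> by (simp add: D)
    ultimately show ?thesis by simp
  qed
  then show "norm a \<le> (1 + \<rho>) / 2 \<Longrightarrow> 1 \<le> 2 * D * (- ln (norm a))" by (simp add: l_def)
  have pos: "D ^ 2 * l \<ge> 0" "D ^ 3 * l \<ge> 0" using D1 l0 by auto
  have "norm (1 / (z - a) + cnj a / (1 - cnj a * z)) \<le> x + 4 * D ^ 2 * l \<and>
        norm ((cnj a / (1 - cnj a * z))\<^sup>2 - (1 / (z - a))\<^sup>2) \<le> x ^ 2 + 12 * D ^ 3 * l"
  proof (cases "norm a \<le> (1 + \<rho>) / 2")
    case True
    then have x: "x = norm (1 / (z - a))" by (simp add: x_def norm_divide)
    have "norm (1 / (z - a) + cnj a / (1 - cnj a * z)) \<le> x + D * 1"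
      using norm_triangle_ineq[of "1 / (z - a)" "cnj a / (1 - cnj a * z)"] Yb x by simp
    also have "D * 1 \<le> D * (2 * D * l)" using tD[OF True] D1 by (intro mult_left_mono) auto
    also have "\<dots> = 2 * (D ^ 2 * l)" by (simp add: power2_eq_square)
    finally have 1: "norm (1 / (z - a) + cnj a / (1 - cnj a * z)) \<le> x + 4 * D ^ 2 * l" using pos by simp
    have "norm ((cnj a / (1 - cnj a * z))\<^sup>2 - (1 / (z - a))\<^sup>2) \<le> norm (cnj a / (1 - cnj a * z)) ^ 2 + x ^ 2"
      using norm_triangle_ineq4[of "(cnj a / (1 - cnj a * z))\<^sup>2" "(1 / (z - a))\<^sup>2"] unfolding x norm_power by simp
    also have "norm (cnj a / (1 - cnj a * z)) ^ 2 \<le> D ^ 2 * 1" using power_mono[OF Yb, of 2] by simp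
    also have "D ^ 2 * 1 \<le> D ^ 2 * (2 * D * l)" using tD[OF True] D1 by (intro mult_left_mono) auto
    also have "\<dots> = 2 * (D ^ 3 * l)" by (simp add: power2_eq_square power3_eq_cube)
    finally have "norm ((cnj a / (1 - cnj a * z))\<^sup>2 - (1 / (z - a))\<^sup>2) \<le> x ^ 2 + 12 * D ^ 3 * l" using pos by simp
    with 1 show ?thesis ..
  next
    case False
    then have x: "x = 0" by (simp add: x_def)
    have "norm (z - a) \<ge> norm a - \<rho>" using norm_triangle_ineq3[of a z] \<rho> by (simp add: norm_minus_commute)
    then have "norm (z - a) \<ge> (1 - \<rho>) / 2" using False by (simp add: field_simps)
    then have "1 / norm (z - a) \<le> 1 / ((1 - \<rho>) / 2)" using nz \<rho> by (intro divide_left_mono) (auto intro!: mult_pos_pos)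
    then have Xb: "1 / norm (z - a) \<le> 2 * D" by (simp add: D)
    have eq: "1 / (z - a) + cnj a / (1 - cnj a * z) = (1 - a * cnj a) * (1 / (z - a)) * (1 / (1 - cnj a * z))"
      using nz by (simp add: divide_simps) (simp add: algebra_simps)
    have "norm (1 - a * cnj a) = 1 - norm a ^ 2"
    proof -
      have "1 - a * cnj a = of_real (1 - norm a ^ 2)" by (simp add: complex_norm_square[symmetric])
      then show ?thesis using a by (simp only: norm_of_real) (simp add: abs_square_le_1 power_le_one)
    qed
    also have "\<dots> = (1 - norm a) * (1 + norm a)" by (simp add: power2_eq_square algebra_simps)
    also have "\<dots> \<le> l * 2" using l a by (intro mult_mono) auto
    finally have w: "norm (1 - a * cnj a) \<le> 2 * l" by simp
    have "norm (1 / (z - a) + cnj a / (1 - cnj a * z)) = norm (1 - a * cnj a) * (1 / norm (z - a)) * (1 / norm (1 - cnj a * z))"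
      unfolding eq by (simp add: norm_mult norm_divide)
    also have "\<dots> \<le> 2 * l * (2 * D) * D"
      using w Xb i1 l0 D1 by (intro mult_mono) auto
    finally have 1: "norm (1 / (z - a) + cnj a / (1 - cnj a * z)) \<le> 4 * D ^ 2 * l" by (simp add: power2_eq_square mult_ac)
    have "(cnj a / (1 - cnj a * z))\<^sup>2 - (1 / (z - a))\<^sup>2 = 
        (1 / (z - a) + cnj a / (1 - cnj a * z)) * (cnj a / (1 - cnj a * z) - 1 / (z - a))"
      by (simp add: power2_eq_square algebra_simps)
    then have "norm ((cnj a / (1 - cnj a * z))\<^sup>2 - (1 / (z - a))\<^sup>2) = 
       norm (1 / (z - a) + cnj a / (1 - cnj a * z)) * norm (cnj a / (1 - cnj a * z) - 1 / (z - a))"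
      by (simp only: norm_mult)
    also have "\<dots> \<le> (4 * D ^ 2 * l) * (D + 2 * D)"
    proof (intro mult_mono 1)
      have "norm (1 / (z - a)) \<le> 2 * D" using Xb by (simp add: norm_divide)
      then show "norm (cnj a / (1 - cnj a * z) - 1 / (z - a)) \<le> D + 2 * D"
        using norm_triangle_ineq4[of "cnj a / (1 - cnj a * z)" "1 / (z - a)"] Yb by linarith
    qed (use D1 l0 in auto)
    also have "\<dots> = 12 * D ^ 3 * l" by (simp add: power2_eq_square power3_eq_cube)
    finally show ?thesis using 1 x by simp
  qed
  then show "norm (1 / (z - a) + cnj a / (1 - cnj a * z)) \<le> x + 4 * D ^ 2 * (- ln (norm a))"
    "norm ((cnj a / (1 - cnj a * z))\<^sup>2 - (1 / (z - a))\<^sup>2) \<le> x ^ 2 + 12 * D ^ 3 * (- ln (norm a))"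
    by (simp_all add: l_def)
qed

lemma Schwarz_kernel_bound:
  fixes u :: "complex \<Rightarrow> real"
  assumes "continuous_on (sphere 0 1) u" "norm z = \<rho>" "\<rho> < 1" "D = 1 / (1 - \<rho>)"
  shows "norm (circle_mean 0 1 (\<lambda>w. of_real (u w) * (2 * w / (w - z) ^ n))) \<le> 2 * D ^ n * circle_mean 0 1 (\<lambda>w. \<bar>u w\<bar>)"
proof -
  have ne: "w \<noteq> z" if "norm w = 1" for w using that assms by auto
  have "norm (circle_mean 0 1 (\<lambda>w. of_real (u w) * (2 * w / (w - z) ^ n))) \<le> circle_mean 0 1 (\<lambda>w. 2 * D ^ n * \<bar>u w\<bar>)"
  proof (rule norm_circle_mean_le)
    show "continuous_on (sphere 0 1) (\<lambda>w. complex_of_real (u w) * (2 * w / (w - z) ^ n))"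
      using ne by (auto intro!: continuous_intros assms(1))
    show "continuous_on (sphere 0 1) (\<lambda>w. 2 * D ^ n * \<bar>u w\<bar>)"
      by (intro continuous_intros assms(1))
    fix w :: complex assume "w \<in> sphere 0 1"
    then have w: "norm w = 1" by simp
    have "norm (w - z) \<ge> 1 - \<rho>" using norm_triangle_ineq2[of w z] w assms by simp
    then have "1 / norm (w - z) \<le> D" unfolding assms(4) using assms(3) ne[OF w] by (intro divide_left_mono) auto
    then have "(1 / norm (w - z)) ^ n \<le> D ^ n" by (intro power_mono) auto
    then have "\<bar>u w\<bar> * (2 * (1 / norm (w - z)) ^ n) \<le> \<bar>u w\<bar> * (2 * D ^ n)" by (intro mult_left_mono) auto
    then show "norm (of_real (u w) * (2 * w / (w - z) ^ n)) \<le> 2 * D ^ n * \<bar>u w\<bar>"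
      using w by (simp add: norm_mult norm_divide norm_power power_divide mult_ac)
  qed auto
  then show ?thesis by (simp only: circle_mean_cmult)
qed

abbreviation log_deriv :: "(complex \<Rightarrow> complex) \<Rightarrow> complex \<Rightarrow> complex" where
  "log_deriv p \<equiv> (\<lambda>z. deriv p z / p z)"

text \<open>If x and y are at most m, then |x - y| \<le> 2m - x - y, which trades the absolute value
  for means that Jensen's formula bounds from below.\<close>

lemma ln_norm_difference_mean:
  fixes p q :: "complex \<Rightarrow> complex"
  assumes p: "entire p" "\<And>z. norm z = 1 \<Longrightarrow> p z \<noteq> 0"
    and q: "entire q" "\<And>z. norm z = 1 \<Longrightarrow> q z \<noteq> 0"
    and M: "continuous_on (sphere 0 1) M" 
      "\<And>w. norm w = 1 \<Longrightarrow> norm (p w) \<le> M w" "\<And>w. norm w = 1 \<Longrightarrow> norm (q w) \<le> M w"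
  shows "circle_mean 0 1 (\<lambda>w. \<bar>ln (norm (p w)) - ln (norm (q w))\<bar>) \<le>
     2 * circle_mean 0 1 (\<lambda>w. ln (M w)) - circle_mean 0 1 (\<lambda>w. ln (norm (p w))) - circle_mean 0 1 (\<lambda>w. ln (norm (q w)))"
proof -
  have M0: "M w > 0" if "norm w = 1" for w
    using M(2)[OF that] p(2)[OF that] by (meson order_less_le_trans zero_less_norm_iff)
  have cp: "continuous_on (sphere 0 1) (\<lambda>w. ln (norm (p w)))" and cq: "continuous_on (sphere 0 1) (\<lambda>w. ln (norm (q w)))"
    using p q by (auto intro!: continuous_on_ln_norm)
  have cM: "continuous_on (sphere 0 1) (\<lambda>w. ln (M w))"
    using M(1) M0 by (intro continuous_on_ln) (auto simp: less_le)
  have "circle_mean 0 1 (\<lambda>w. \<bar>ln (norm (p w)) - ln (norm (q w))\<bar>) \<le>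
     circle_mean 0 1 (\<lambda>w. 2 * ln (M w) - ln (norm (p w)) - ln (norm (q w)))"
  proof (rule circle_mean_mono)
    fix w :: complex assume "w \<in> sphere 0 1"
    then have w: "norm w = 1" by simp
    have "ln (norm (p w)) \<le> ln (M w)" "ln (norm (q w)) \<le> ln (M w)"
      using M(2,3)[OF w] p(2)[OF w] q(2)[OF w] M0[OF w] by (auto intro: ln_mono)
    then show "\<bar>ln (norm (p w)) - ln (norm (q w))\<bar> \<le> 2 * ln (M w) - ln (norm (p w)) - ln (norm (q w))"
      by linarith
  qed (auto intro!: continuous_intros cp cq cM)
  also have "\<dots> = circle_mean 0 1 (\<lambda>w. 2 * ln (M w) - ln (norm (p w))) - circle_mean 0 1 (\<lambda>w. ln (norm (q w)))"
    by (intro circle_mean_diff continuous_intros cp cq cM) auto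
  also have "circle_mean 0 1 (\<lambda>w. 2 * ln (M w) - ln (norm (p w))) = 
      circle_mean 0 1 (\<lambda>w. 2 * ln (M w)) - circle_mean 0 1 (\<lambda>w. ln (norm (p w)))"
    by (intro circle_mean_diff continuous_intros cp cq cM) auto
  finally show ?thesis by (simp only: circle_mean_cmult)
qed

lemma norm_sum_list_le2:
  fixes f :: "'a \<Rightarrow> 'b::real_normed_vector"
  assumes "\<And>a. a \<in> set xs \<Longrightarrow> norm (f a) \<le> g a + c * h a"
  shows "norm (\<Sum>a\<leftarrow>xs. f a) \<le> (\<Sum>a\<leftarrow>xs. g a) + c * (\<Sum>a\<leftarrow>xs. h a)"
  using assms
proof (induction xs)
  case (Cons a xs)
  have "norm (f a + (\<Sum>a\<leftarrow>xs. f a)) \<le> norm (f a) + norm (\<Sum>a\<leftarrow>xs. f a)"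
    by (rule norm_triangle_ineq)
  also have "\<dots> \<le> (g a + c * h a) + ((\<Sum>a\<leftarrow>xs. g a) + c * (\<Sum>a\<leftarrow>xs. h a))"
    using Cons by (intro add_mono) auto
  finally show ?case by (simp add: algebra_simps)
qed auto

lemma sum_list_filter_if:
  "(\<Sum>a\<leftarrow>filter P xs. f a) = (\<Sum>a\<leftarrow>xs. if P a then f a else (0::real))"
  by (induction xs) auto

lemma ln_le_ln_tangent:
  fixes x s :: real
  assumes "x > 0" "s > 0"
  shows "ln x \<le> ln s + x / s - 1"
  using ln_le_minus_one[of "x / s"] assms by (simp add: ln_div)

text \<open>This is the lemma on the logarithmic derivative for all quotients p/q at once. The
  Poisson part of a difference involves only ln |p| - ln |q|, whose absolute mean is at most 2X; ln
  |p| alone has no such bound. The zeros of each p satisfy \<open>S p\<close> \<le> X by Jensen. One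
  function \<open>G\<close> serves all pairs, and its square bounds the second-order terms because
  these have singularities of the form |z - a|^(-2).\<close>

theorem log_deriv_majorant:
  fixes A :: "(complex \<Rightarrow> complex) set" and M :: "complex \<Rightarrow> real"
  assumes A: "finite A" "A \<noteq> {}" and hol: "\<And>p. p \<in> A \<Longrightarrow> entire p"
    and p0: "\<And>p. p \<in> A \<Longrightarrow> p 0 \<noteq> 0" and p1: "\<And>p z. p \<in> A \<Longrightarrow> norm z = 1 \<Longrightarrow> p z \<noteq> 0"
    and p\<rho>: "\<And>p z. p \<in> A \<Longrightarrow> norm z = \<rho> \<Longrightarrow> p z \<noteq> 0"
    and \<rho>: "1 / 2 \<le> \<rho>" "\<rho> < 1" and D: "D = 1 / (1 - \<rho>)"
    and M: "continuous_on (sphere 0 1) M" "\<And>p w. p \<in> A \<Longrightarrow> norm w = 1 \<Longrightarrow> norm (p w) \<le> M w"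
    and c0: "\<And>p. p \<in> A \<Longrightarrow> - ln (norm (p 0)) \<le> c0"
    and X: "X = circle_mean 0 1 (\<lambda>w. ln (M w)) + c0"
  obtains G where "continuous_on (sphere 0 \<rho>) G" "\<And>z. norm z = \<rho> \<Longrightarrow> G z \<ge> 1"
    "\<And>p q z. p \<in> A \<Longrightarrow> q \<in> A \<Longrightarrow> norm z = \<rho> \<Longrightarrow> norm (log_deriv p z - log_deriv q z) \<le> G z"
    "\<And>p q z. p \<in> A \<Longrightarrow> q \<in> A \<Longrightarrow> norm z = \<rho> \<Longrightarrow> norm (deriv (log_deriv p) z - deriv (log_deriv q) z) \<le> (G z)\<^sup>2"
    "circle_mean 0 \<rho> (\<lambda>z. ln (G z)) \<le> 2 * ln (1 + X) + 6 * ln D + 2 * ln (33 + 2 * real (card A)) + 72"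
    "X \<ge> 0"
proof -
  have \<rho>0: "\<rho> \<ge> 0" using \<rho> by simp
  have D1: "D \<ge> 1" unfolding D using \<rho> by simp
  have D0: "D > 0" using D1 by simp
  have DD: "D ^ 2 \<le> D ^ 3" "1 \<le> D ^ 3" "D \<le> D ^ 3" 
    using D1 power_increasing[of 2 3 D] power_increasing[of 0 3 D] power_increasing[of 1 3 D] by auto
  define J where "J = (\<lambda>p. circle_mean 0 1 (\<lambda>w. ln (norm ((p::complex\<Rightarrow>complex) w))))"
  define K where "K = (\<lambda>p (n::nat) z. circle_mean 0 1 (\<lambda>w. of_real (ln (norm ((p::complex\<Rightarrow>complex) w))) * (2 * w / (w - z) ^ n)))"
  define Q where "Q = (\<lambda>p xs. set xs = {z\<in>ball 0 1. p z = 0} \<and>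
    J p = ln (norm (p 0)) + (\<Sum>a\<leftarrow>xs. - ln (norm a)) \<and>
    (\<forall>z. norm z < 1 \<longrightarrow> p z \<noteq> 0 \<longrightarrow> log_deriv p z = K p 2 z
       + (\<Sum>a\<leftarrow>xs. 1 / (z - a) + cnj a / (1 - cnj a * z))) \<and>
    (\<forall>z. norm z < 1 \<longrightarrow> p z \<noteq> 0 \<longrightarrow> deriv (log_deriv p) z = 2 * K p 3 z
       + (\<Sum>a\<leftarrow>xs. (cnj a / (1 - cnj a * z))\<^sup>2 - (1 / (z - a))\<^sup>2)))"
  have "\<exists>xs. Q p xs" if "p \<in> A" for p
    unfolding Q_def J_def K_def 
    by (rule Poisson_Jensen_unit_disc[OF hol[OF that] p1[OF that] p0[OF that]]) (assumption, blast)
  then obtain zs where "\<And>p. p \<in> A \<Longrightarrow> Q p (zs p)" by metis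
  note zsQ = this[unfolded Q_def]
  have zs: "set (zs p) = {z\<in>ball 0 1. p z = 0}"
    and J: "J p = ln (norm (p 0)) + (\<Sum>a\<leftarrow>zs p. - ln (norm a))" if "p \<in> A" for p
    using zsQ[OF that] by blast+
  have L1: "log_deriv p z = K p 2 z + (\<Sum>a\<leftarrow>zs p. 1 / (z - a) + cnj a / (1 - cnj a * z))"
    and L2: "deriv (log_deriv p) z = 2 * K p 3 z + (\<Sum>a\<leftarrow>zs p. (cnj a / (1 - cnj a * z))\<^sup>2 - (1 / (z - a))\<^sup>2)"
    if "p \<in> A" "norm z < 1" "p z \<noteq> 0" for p z
    using zsQ[OF that(1)] that(2,3) by blast+
  define S where "S = (\<lambda>p. \<Sum>a\<leftarrow>zs p. - ln (norm a))"
  have za: "0 < norm a" "norm a < 1" "p a = 0" if "p \<in> A" "a \<in> set (zs p)" for p a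
    using zs[OF that(1)] that p0[OF that(1)] by auto
  have za\<rho>: "norm a \<noteq> \<rho>" if "p \<in> A" "a \<in> set (zs p)" for p a
    using za[OF that] p\<rho>[OF that(1)] by metis
  have S0: "S p \<ge> 0" if "p \<in> A" for p
    unfolding S_def using za[OF that] by (intro sum_list_nonneg) (auto simp: less_imp_le)
  have M0: "M w > 0" if "norm w = 1" for w
  proof -
    obtain p where "p \<in> A" using A(2) by auto
    with M(2)[OF _ that] p1[OF _ that] have "norm (p w) \<le> M w" "norm (p w) > 0" by auto
    then show ?thesis by linarith
  qed
  have cM: "continuous_on (sphere 0 1) (\<lambda>w. ln (M w))"
    using M(1) M0 by (intro continuous_on_ln) (auto simp: less_le)
  have cp: "continuous_on (sphere 0 1) (\<lambda>w. ln (norm (p w)))" if "p \<in> A" for p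
    using p1[OF that] by (intro continuous_on_ln_norm hol that) auto
  have JX: "J p \<le> X - c0" if "p \<in> A" for p
    unfolding J_def X
    using p1[OF that] M0 M(2)[OF that] circle_mean_mono[OF cp[OF that] cM] by (auto intro!: ln_mono)
  have SX: "S p \<le> X" if "p \<in> A" for p
    using JX[OF that] J[OF that] c0[OF that] by (simp add: S_def)
  have X0: "X \<ge> 0" 
  proof -
    obtain p where "p \<in> A" using A(2) by auto
    with S0 SX show ?thesis by (metis order_trans)
  qed
  have XM: "X - c0 = circle_mean 0 1 (\<lambda>w. ln (M w))" using X by simp
  have mX: "circle_mean 0 1 (\<lambda>w. \<bar>ln (norm (p w)) - ln (norm (q w))\<bar>) \<le> 2 * X" if "p \<in> A" "q \<in> A" for p q
  proof -
    have "circle_mean 0 1 (\<lambda>w. \<bar>ln (norm (p w)) - ln (norm (q w))\<bar>) \<le> 2 * (X - c0) - J p - J q"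
      unfolding XM J_def by (intro ln_norm_difference_mean hol that p1 M)
    then show ?thesis
      using J[OF that(1)] J[OF that(2)] S0[OF that(1)] S0[OF that(2)] c0[OF that(1)] c0[OF that(2)] by (simp add: S_def)
  qed
  have KX: "norm (K p n z - K q n z) \<le> 4 * D ^ n * X" if "p \<in> A" "q \<in> A" "norm z = \<rho>" for p q n z
  proof -
    have ne: "w \<noteq> z" if "norm w = 1" for w using that \<open>norm z = \<rho>\<close> \<rho> by auto
    have "K p n z - K q n z = circle_mean 0 1 (\<lambda>w. of_real (ln (norm (p w))) * (2 * w / (w - z) ^ n) - 
        of_real (ln (norm (q w))) * (2 * w / (w - z) ^ n))"
      unfolding K_def using ne by (subst circle_mean_diff) (auto intro!: continuous_intros cp that)
    also have "\<dots> = circle_mean 0 1 (\<lambda>w. of_real (ln (norm (p w)) - ln (norm (q w))) * (2 * w / (w - z) ^ n))"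
      by (intro circle_mean_cong) (auto simp: left_diff_distrib diff_divide_distrib)
    also have "norm \<dots> \<le> 2 * D ^ n * circle_mean 0 1 (\<lambda>w. \<bar>ln (norm (p w)) - ln (norm (q w))\<bar>)"
      by (intro Schwarz_kernel_bound[OF _ that(3) \<rho>(2) D] continuous_intros cp that)
    also have "\<dots> \<le> 2 * D ^ n * (2 * X)" using mX[OF that(1,2)] D0 by (intro mult_left_mono) auto
    finally show ?thesis by simp
  qed
  define ys where "ys = (\<lambda>p. filter (\<lambda>a. norm a \<le> (1 + \<rho>) / 2) (zs p))"
  define Z where "Z = (\<lambda>p z. \<Sum>a\<leftarrow>ys p. 1 / norm (z - a))"
  \<comment> \<open>The constant 32 is 8 + 12 + 12 from the second-order estimate: twice the kernel
    bound 4, and 12 for the zeros of each of p and q. The first-order constants are smaller.\<close>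
  define Y where "Y = 1 + 32 * D ^ 3 * X"
  define G where "G = (\<lambda>z. Y + (\<Sum>p\<in>A. Z p z))"
  have ysz: "a \<in> set (zs p)" "norm a \<le> (1 + \<rho>) / 2" if "a \<in> set (ys p)" for a p
    using that by (auto simp: ys_def)
  have Z0: "Z p z \<ge> 0" for p z
    unfolding Z_def by (intro sum_list_nonneg) auto
  have Y1: "Y \<ge> 1" using X0 D0 by (simp add: Y_def)
  have G1: "G z \<ge> 1" for z using Y1 Z0 by (simp add: G_def add_increasing2 sum_nonneg)
  have cZ: "continuous_on (sphere 0 \<rho>) (Z p)" if "p \<in> A" for p
  proof -
    have "\<forall>a\<in>set (ys p). continuous_on (sphere 0 \<rho>) (\<lambda>z. 1 / norm (z - a))"
      using za\<rho>[OF that] ysz by (fastforce intro!: continuous_intros)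
    then have "continuous_on (sphere 0 \<rho>) (\<lambda>z. \<Sum>a\<leftarrow>ys p. 1 / norm (z - a))"
      by (induction ("ys p")) (auto intro!: continuous_intros)
    then show ?thesis by (simp add: Z_def)
  qed
  have cG: "continuous_on (sphere 0 \<rho>) G"
    unfolding G_def by (intro continuous_intros cZ)
  have B: "norm (\<Sum>a\<leftarrow>zs p. 1 / (z - a) + cnj a / (1 - cnj a * z)) \<le> Z p z + 4 * D ^ 2 * S p"
     "norm (\<Sum>a\<leftarrow>zs p. (cnj a / (1 - cnj a * z))\<^sup>2 - (1 / (z - a))\<^sup>2) \<le> (Z p z)\<^sup>2 + 12 * D ^ 3 * S p"
    if "p \<in> A" "norm z = \<rho>" for p z
  proof -
    have az: "a \<noteq> z" if "a \<in> set (zs p)" for a using za(3)[OF \<open>p \<in> A\<close> that] p\<rho>[OF \<open>p \<in> A\<close> \<open>norm z = \<rho>\<close>] by auto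
    note bb = Blaschke_term_bounds[OF that(2) \<rho>(2) za(1,2)[OF that(1)] az D]
    have "norm (\<Sum>a\<leftarrow>zs p. 1 / (z - a) + cnj a / (1 - cnj a * z)) \<le> 
      (\<Sum>a\<leftarrow>zs p. if norm a \<le> (1 + \<rho>) / 2 then 1 / norm (z - a) else 0) + 4 * D ^ 2 * S p"
      unfolding S_def by (intro norm_sum_list_le2 bb)
    then show "norm (\<Sum>a\<leftarrow>zs p. 1 / (z - a) + cnj a / (1 - cnj a * z)) \<le> Z p z + 4 * D ^ 2 * S p"
      by (simp add: Z_def ys_def sum_list_filter_if)
    have "norm (\<Sum>a\<leftarrow>zs p. (cnj a / (1 - cnj a * z))\<^sup>2 - (1 / (z - a))\<^sup>2) \<le> 
      (\<Sum>a\<leftarrow>zs p. (if norm a \<le> (1 + \<rho>) / 2 then 1 / norm (z - a) else 0)\<^sup>2) + 12 * D ^ 3 * S p"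
      unfolding S_def by (intro norm_sum_list_le2 bb)
    also have "(\<Sum>a\<leftarrow>zs p. (if norm a \<le> (1 + \<rho>) / 2 then 1 / norm (z - a) else 0)\<^sup>2) \<le>
       (\<Sum>a\<leftarrow>zs p. (if norm a \<le> (1 + \<rho>) / 2 then 1 / norm (z - a) else 0))\<^sup>2"
      by (rule sum_list_squares_le) auto
    finally show "norm (\<Sum>a\<leftarrow>zs p. (cnj a / (1 - cnj a * z))\<^sup>2 - (1 / (z - a))\<^sup>2) \<le> (Z p z)\<^sup>2 + 12 * D ^ 3 * S p"
      by (simp add: Z_def ys_def sum_list_filter_if)
  qed
  have main: "norm (log_deriv p z - log_deriv q z) \<le> G z \<and> norm (deriv (log_deriv p) z - deriv (log_deriv q) z) \<le> (G z)\<^sup>2"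
    if "p \<in> A" "q \<in> A" "norm z = \<rho>" for p q z
  proof (cases "p = q")
    case True
    then show ?thesis using G1[of z] by auto
  next
    case False
    have nz: "norm z < 1" "p z \<noteq> 0" "q z \<noteq> 0" using that p\<rho> \<rho> by auto
    have ZZ: "Z p z + Z q z \<le> (\<Sum>p\<in>A. Z p z)"
      using sum_mono2[of A "{p, q}" "\<lambda>p. Z p z"] A(1) that Z0 False by auto
    have DX: "D ^ 2 * X \<le> D ^ 3 * X" using DD X0 by (intro mult_right_mono) auto
    have DS: "D ^ n * S p \<le> D ^ n * X" "D ^ n * S q \<le> D ^ n * X" for n
      using SX[OF that(1)] SX[OF that(2)] D0 by (auto intro!: mult_left_mono)
    have DX0: "D ^ 3 * X \<ge> 0" using X0 D0 by auto
    let ?Sp = "\<Sum>a\<leftarrow>zs p. 1 / (z - a) + cnj a / (1 - cnj a * z)" and ?Sq = "\<Sum>a\<leftarrow>zs q. 1 / (z - a) + cnj a / (1 - cnj a * z)"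
    let ?Tp = "\<Sum>a\<leftarrow>zs p. (cnj a / (1 - cnj a * z))\<^sup>2 - (1 / (z - a))\<^sup>2" and ?Tq = "\<Sum>a\<leftarrow>zs q. (cnj a / (1 - cnj a * z))\<^sup>2 - (1 / (z - a))\<^sup>2"
    have tri: "norm (a + b - (c + d)) \<le> norm (a - c) + norm b + norm d" for a b c d :: complex
      using norm_triangle_ineq4[of "(a - c) + b" d] norm_triangle_ineq[of "a - c" b] by (simp add: algebra_simps)
    have "norm (log_deriv p z - log_deriv q z) \<le> norm (K p 2 z - K q 2 z) + norm ?Sp + norm ?Sq"
      unfolding L1[OF that(1) nz(1,2)] L1[OF that(2) nz(1,3)] by (rule tri)
    also have "\<dots> \<le> 4 * D ^ 2 * X + (Z p z + 4 * D ^ 2 * S p) + (Z q z + 4 * D ^ 2 * S q)"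
      by (intro add_mono KX B that)
    also have "\<dots> \<le> G z" using DX DS[of 2] ZZ DX0 by (simp add: G_def Y_def)
    finally have 1: "norm (log_deriv p z - log_deriv q z) \<le> G z" .
    have "norm (deriv (log_deriv p) z - deriv (log_deriv q) z) \<le> norm (2 * K p 3 z - 2 * K q 3 z) + norm ?Tp + norm ?Tq"
      unfolding L2[OF that(1) nz(1,2)] L2[OF that(2) nz(1,3)] by (rule tri)
    also have "2 * K p 3 z - 2 * K q 3 z = 2 * (K p 3 z - K q 3 z)" by simp
    also have "norm (2 * (K p 3 z - K q 3 z)) + norm ?Tp + norm ?Tq \<le> 2 * (4 * D ^ 3 * X) + ((Z p z)\<^sup>2 + 12 * D ^ 3 * S p) + ((Z q z)\<^sup>2 + 12 * D ^ 3 * S q)"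
      unfolding norm_mult norm_numeral by (intro add_mono B that mult_left_mono KX) simp
    also have "\<dots> \<le> Y + ((Z p z)\<^sup>2 + (Z q z)\<^sup>2)" using DS[of 3] by (simp add: Y_def algebra_simps)
    also have "\<dots> \<le> Y\<^sup>2 + (Z p z + Z q z)\<^sup>2"
      using Y1 self_le_power[of Y 2] Z0[of p z] Z0[of q z] by (intro add_mono) (auto simp: power2_sum)
    also have "\<dots> \<le> (Y + (Z p z + Z q z))\<^sup>2"
      using Y1 Z0[of p z] Z0[of q z] by (simp add: power2_sum[of Y])
    also have "\<dots> \<le> (G z)\<^sup>2"
      unfolding G_def using Y1 Z0[of p z] Z0[of q z] ZZ by (intro power_mono) auto
    finally show ?thesis using 1 by blast
  qed
  define N where "N = (\<Sum>p\<in>A. real (length (ys p)))"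
  have N0: "N \<ge> 0" by (simp add: N_def sum_nonneg)
  have len: "real (length (ys p)) \<le> 2 * D * X" if "p \<in> A" for p
  proof -
    \<comment> \<open>The counting estimate concerns the zero only, so any point of the circle may
      serve as z.\<close>
    define z :: complex where "z = of_real \<rho>"
    have nz: "norm z = \<rho>" using \<rho> by (simp add: z_def)
    have "a \<in> set (zs p) \<Longrightarrow> a \<noteq> z" for a using za\<rho>[OF that] nz by auto
    note bb = Blaschke_term_bounds(3)[OF nz \<rho>(2) za(1,2)[OF that] this D]
    have "real (length (ys p)) = (\<Sum>a\<leftarrow>ys p. 1)" by (simp add: sum_list_triv)
    also have "\<dots> \<le> (\<Sum>a\<leftarrow>ys p. 2 * D * (- ln (norm a)))"
      by (intro sum_list_mono bb) (use ysz in auto)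
    also have "\<dots> \<le> (\<Sum>a\<leftarrow>zs p. 2 * D * (- ln (norm a)))"
      unfolding ys_def sum_list_filter_if
      using za[OF that] D0 by (intro sum_list_mono) (auto simp: mult_nonneg_nonpos less_imp_le)
    also have "\<dots> = 2 * D * S p" unfolding S_def by (rule sum_list_const_mult)
    also have "\<dots> \<le> 2 * D * X" using SX[OF that] D0 by (intro mult_left_mono) auto
    finally show ?thesis .
  qed
  have NX: "N \<le> real (card A) * (2 * D * X)"
    unfolding N_def by (rule sum_bounded_above) (use len in auto)
  \<comment> \<open>The concavity of the logarithm is used through its tangent at \<open>s\<close>:
    ln G = 2 ln (sqrt G) \<le> 2 (ln s + sqrt G / s - 1). The mean of sqrt G is at most sqrt Y + 36
    N \<le> 36 s, so this scale leaves 2 ln s plus a constant.\<close>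
  define s where "s = Y + N"
  have s1: "s \<ge> 1" using Y1 N0 by (simp add: s_def)
  have c1: "continuous_on (sphere 0 \<rho>) (\<lambda>z. 1 / sqrt (norm (z - a)))" if "p \<in> A" "a \<in> set (ys p)" for p a
    using za\<rho>[OF that(1) ysz(1)[OF that(2)]] by (auto intro!: continuous_intros)
  have c2: "continuous_on (sphere 0 \<rho>) (\<lambda>z. \<Sum>a\<leftarrow>ys p. 1 / sqrt (norm (z - a)))" if "p \<in> A" for p
  proof -
    have "\<forall>a\<in>set (ys p). continuous_on (sphere 0 \<rho>) (\<lambda>z. 1 / sqrt (norm (z - a)))" using c1[OF that] by auto
    then show ?thesis by (induction ("ys p")) (auto intro!: continuous_intros)
  qed
  have cln: "continuous_on (sphere 0 \<rho>) (\<lambda>z. ln (G z))"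
    using G1 by (intro continuous_on_ln cG) (metis less_irrefl not_one_le_zero)
  let ?R = "\<lambda>z. sqrt Y + (\<Sum>p\<in>A. \<Sum>a\<leftarrow>ys p. 1 / sqrt (norm (z - a)))"
  have cR: "continuous_on (sphere 0 \<rho>) ?R" by (intro continuous_on_add continuous_on_const continuous_on_sum c2)
  have cR': "continuous_on (sphere 0 \<rho>) (\<lambda>z. (2 / s) * ?R z)"
    by (rule continuous_on_mult[OF continuous_on_const cR])
  have "circle_mean 0 \<rho> (\<lambda>z. ln (G z)) \<le> circle_mean 0 \<rho> (\<lambda>z. (2 * ln s - 2) + (2 / s) * ?R z)"
  proof (rule circle_mean_mono[OF cln])
    show "continuous_on (sphere 0 \<rho>) (\<lambda>z. (2 * ln s - 2) + (2 / s) * ?R z)"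
      by (rule continuous_on_add[OF continuous_on_const cR'])
    show "\<rho> \<ge> 0" using \<rho> by simp
    fix z :: complex
    have "sqrt (G z) \<le> sqrt Y + sqrt (\<Sum>p\<in>A. Z p z)"
      unfolding G_def using Y1 Z0 by (intro sqrt_add_le_add_sqrt sum_nonneg) auto
    also have "sqrt (\<Sum>p\<in>A. Z p z) \<le> (\<Sum>p\<in>A. sqrt (Z p z))" using A(1) Z0 by (intro sqrt_sum_le) auto
    also have "\<dots> \<le> (\<Sum>p\<in>A. \<Sum>a\<leftarrow>ys p. sqrt (1 / norm (z - a)))"
      unfolding Z_def by (intro sum_mono sqrt_sum_list_le) auto
    finally have "sqrt (G z) \<le> ?R z" by (simp add: real_sqrt_divide)
    then have "sqrt (G z) / s \<le> ?R z / s" using s1 by (intro divide_right_mono) auto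
    moreover have "ln (sqrt (G z)) \<le> ln s + sqrt (G z) / s - 1"
      using G1[of z] s1 by (intro ln_le_ln_tangent) auto
    moreover have "ln (sqrt (G z)) = ln (G z) / 2" using G1[of z] by (intro ln_sqrt) auto
    moreover have "(2 / s) * ?R z = 2 * (?R z / s)" by simp
    ultimately show "ln (G z) \<le> (2 * ln s - 2) + (2 / s) * ?R z" by linarith
  qed
  also have "\<dots> = (2 * ln s - 2) + (2 / s) * circle_mean 0 \<rho> ?R"
    unfolding circle_mean_add[OF continuous_on_const cR' \<rho>0] circle_mean_const circle_mean_cmult ..
  also have "circle_mean 0 \<rho> ?R = sqrt Y + (\<Sum>p\<in>A. \<Sum>a\<leftarrow>ys p. circle_mean 0 \<rho> (\<lambda>z. 1 / sqrt (norm (z - a))))"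
    using \<rho> A(1) c1 c2 by (simp add: circle_mean_add circle_mean_sum circle_mean_sum_list continuous_on_sum cong: sum.cong)
  also have "(\<Sum>p\<in>A. \<Sum>a\<leftarrow>ys p. circle_mean 0 \<rho> (\<lambda>z. 1 / sqrt (norm (z - a)))) \<le> (\<Sum>p\<in>A. \<Sum>a\<leftarrow>ys p. 36)"
    using za\<rho> ysz by (intro sum_mono sum_list_mono circle_mean_inverse_sqrt_le \<rho>) auto
  also have "\<dots> = 36 * N" by (simp add: N_def sum_list_triv sum_distrib_right mult.commute[of 36])
  also have "sqrt Y \<le> 36 * Y" 
    using Y1 real_le_lsqrt[of Y Y] self_le_power[of Y 2] by simp
  also have "36 * Y + 36 * N = 36 * s" by (simp add: s_def)
  finally have "circle_mean 0 \<rho> (\<lambda>z. ln (G z)) \<le> 2 * ln s - 2 + 2 / s * (36 * s)"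
    using s1 by (auto simp: divide_right_mono)
  then have "circle_mean 0 \<rho> (\<lambda>z. ln (G z)) \<le> 2 * ln s + 72" using s1 by simp
  also have "ln s \<le> ln ((33 + 2 * real (card A)) * (D ^ 3 * (1 + X)))"
  proof (rule ln_mono)
    have "D * X \<le> D ^ 3 * X" using DD X0 by (intro mult_right_mono) auto
    then have "real (card A) * (2 * (D * X)) \<le> real (card A) * (2 * (D ^ 3 * X))" by (intro mult_left_mono) auto
    moreover have "real (card A) * (2 * (D ^ 3)) \<ge> 0" "D ^ 3 * X \<ge> 0" using D0 X0 by auto
    ultimately show "s \<le> (33 + 2 * real (card A)) * (D ^ 3 * (1 + X))"
      using NX DD(2) unfolding s_def Y_def by (simp add: algebra_simps)
  qed (use s1 in auto)
  also have "\<dots> = ln (33 + 2 * real (card A)) + (3 * ln D + ln (1 + X))"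
    using D0 X0 by (simp add: ln_mult ln_realpow)
  finally have "circle_mean 0 \<rho> (\<lambda>z. ln (G z)) \<le> 2 * ln (1 + X) + 6 * ln D + 2 * ln (33 + 2 * real (card A)) + 72"
    by simp
  with cG G1 main X0 show thesis by (intro that[of G]) auto
qed

section \<open>Second main theorems\<close>

lemma generic_point:
  assumes "finite B" "\<And>p. p \<in> B \<Longrightarrow> entire p \<and> (\<exists>w. p w \<noteq> (0::complex))"
  obtains z0 :: complex where "\<And>p. p \<in> B \<Longrightarrow> p z0 \<noteq> 0"
proof -
  have "countable (\<Union>p\<in>B. {z. p z = 0})"
    using assms entire_zeros_countable by (intro countable_UN) (auto intro: countable_finite)
  then have "(\<Union>p\<in>B. {z. p z = 0}) \<noteq> UNIV"
    using uncountable_UNIV_complex by metis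
  then show thesis using that by auto
qed

lemma generic_radius:
  fixes z0 :: complex
  assumes "finite B" "\<And>p. p \<in> B \<Longrightarrow> entire p \<and> (\<exists>w. p w \<noteq> (0::complex))" "a < b"
  obtains R where "a < R" "R < b" "\<And>p z. p \<in> B \<Longrightarrow> z \<in> sphere z0 R \<Longrightarrow> p z \<noteq> 0"
proof -
  let ?S = "dist z0 ` (\<Union>p\<in>B. {z. p z = 0})"
  have "countable ?S"
    using assms entire_zeros_countable by (intro countable_image countable_UN) (auto intro: countable_finite)
  moreover have "uncountable {a<..<b}" using assms(3) by (rule uncountable_open_interval[THEN iffD2])
  ultimately have "\<not> {a<..<b} \<subseteq> ?S" using countable_subset by blast
  then obtain R where "R \<in> {a<..<b}" "R \<notin> ?S" by blast
  then show thesis using that[of R] by auto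
qed

text \<open>
  This replaces Borel's growth lemma: an iteration of radii that stays below \<open>2 r0\<close> makes \<open>T\<close>
  unbounded on a bounded interval, so that \<open>T\<close> need not be monotone.
\<close>

lemma growth_contradiction:
  fixes T :: "real \<Rightarrow> real"
  assumes dense: "\<And>a b. 0 < a \<Longrightarrow> a < b \<Longrightarrow> \<exists>r. a < r \<and> r < b \<and> good r"
    and bdd: "\<And>b. \<exists>C. \<forall>r. good r \<longrightarrow> 0 < r \<longrightarrow> r \<le> b \<longrightarrow> T r \<le> C"
    and unb: "\<And>C. \<exists>r\<ge>1. good r \<and> T r \<ge> C"
    and nonneg: "\<And>r. good r \<Longrightarrow> 1 \<le> r \<Longrightarrow> T r \<ge> 0"
    and ineq: "\<And>r R. good r \<Longrightarrow> good R \<Longrightarrow> 1 \<le> r \<Longrightarrow> r < R \<Longrightarrow> R \<le> 2 * r \<Longrightarrow> 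
        T r \<le> K * (1 + ln (1 + T R) + ln (R / (R - r)))"
    and K: "K > 0"
  shows False
proof -
  \<comment> \<open>Chosen so that m = k + k0 satisfies m \<ge> 2 and m \<ge> 4K throughout the
    induction below.\<close>
  define k0 where "k0 = 2 + 4 * K"
  obtain r0 where r0: "r0 \<ge> 1" "good r0" "T r0 \<ge> 4 * K * k0" using unb by metis
  \<comment> \<open>The k-th radius is taken between \<open>?l k\<close> and \<open>?u k\<close>.
    The gap from \<open>?u k\<close> to \<open>?l (Suc k)\<close> is exactly r0 / 2^(k+2), so ln (R
    / (R - r)) grows only linearly in k while all radii stay below 2 r0.\<close>
  let ?l = "\<lambda>k. (2 - 1 / 2 ^ k) * r0" and ?u = "\<lambda>k. (2 - 1 / 2 ^ k + 1 / 2 ^ (k + 2)) * r0"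
  have "\<exists>r. ?l k \<le> r \<and> r < ?u k \<and> good r \<and> (k = 0 \<longrightarrow> r = r0)" for k :: nat
  proof (cases "k = 0")
    case True
    then show ?thesis using r0 by (intro exI[of _ r0]) (auto simp: field_simps)
  next
    case False
    have h: "(1::real) / 2 ^ k \<le> 1" "(1::real) / 2 ^ (k + 2) > 0" by (simp_all add: field_simps)
    have "2 - 1 / 2 ^ k > (0::real)" using h by linarith
    then have "?l k > 0" using r0 by (intro mult_pos_pos) auto
    moreover have "?l k < ?u k"
      using r0 h(2) by (intro mult_strict_right_mono) (simp_all only: less_add_same_cancel1)
    ultimately obtain r where "?l k < r" "r < ?u k" "good r" using dense by blast
    then show ?thesis using False by (intro exI[of _ r]) simp
  qed
  then obtain r where r: "\<And>k. ?l k \<le> r k" "\<And>k. r k < ?u k" "\<And>k. good (r k)" "r 0 = r0"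
    by metis
  have step: "r0 / 2 ^ (k + 2) \<le> r (Suc k) - r k" for k
  proof -
    have "?l (Suc k) - ?u k = r0 / 2 ^ (k + 2)" by (simp add: field_simps)
    then show ?thesis using r(1)[of "Suc k"] r(2)[of k] by linarith
  qed
  have up: "r k \<le> 2 * r0" for k
  proof -
    have "(2 - 1 / 2 ^ k + 1 / 2 ^ (k + 2)) * r0 \<le> 2 * r0"
      using r0 by (intro mult_right_mono) (auto simp: field_simps)
    then show ?thesis using r(2)[of k] by linarith
  qed
  have low: "r k \<ge> r0" for k
  proof -
    have "(1::real) / 2 ^ k \<le> 1" by (simp add: field_simps)
    then have "1 * r0 \<le> ?l k" using r0 by (intro mult_right_mono) auto
    then show ?thesis using r(1)[of k] by linarith
  qed
  have lnb: "ln (r (Suc k) / (r (Suc k) - r k)) \<le> real k + 3" for k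
  proof -
    have p: "r0 / 2 ^ (k + 2) > 0" using r0 by simp
    have "r (Suc k) / (r (Suc k) - r k) \<le> (2 * r0) / (r0 / 2 ^ (k + 2))"
      using up[of "Suc k"] step[of k] p r0 low[of "Suc k"] by (intro frac_le) auto
    also have "\<dots> = 2 ^ (k + 3)" using r0 by (simp add: power_add field_simps)
    finally have "r (Suc k) / (r (Suc k) - r k) \<le> 2 ^ (k + 3)" .
    moreover have "r (Suc k) / (r (Suc k) - r k) > 0"
      using step[of k] p r0 low[of "Suc k"] by (intro divide_pos_pos) linarith+
    ultimately have "ln (r (Suc k) / (r (Suc k) - r k)) \<le> ln (2 ^ (k + 3))"
      using ln_mono by blast
    also have "\<dots> = (real k + 3) * ln 2" by (simp add: ln_realpow)
    also have "\<dots> \<le> (real k + 3) * 1" using ln_2_less_1 by (intro mult_left_mono) auto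
    finally show ?thesis by simp
  qed
  \<comment> \<open>Induction step: with m = k + k0, the inequality and the bound k + 3 for the
    logarithmic term force ln (1 + x) \<ge> 2m for the next value x. Hence x \<ge> 2 m^2 \<ge> 8 K m
    \<ge> 4 K (m + 1).\<close>
  have claim: "T (r k) \<ge> 4 * K * (real k + k0)" for k
  proof (induction k)
    case 0
    then show ?case using r0 r(4) by simp
  next
    case (Suc k)
    define m where "m = real k + k0"
    define x where "x = T (r (Suc k))"
    have x0: "x \<ge> 0" unfolding x_def using nonneg r(3) low r0 by (meson order_trans)
    have m: "m \<ge> 2" "m \<ge> 4 * K" "m \<ge> real k + 2" using K by (auto simp: m_def k0_def)
    have "r0 / 2 ^ (k + 2) > 0" using r0 by simp
    then have "r k < r (Suc k)" using step[of k] by linarith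
    moreover have "1 \<le> r k" "r (Suc k) \<le> 2 * r k" using low[of k] up[of "Suc k"] r0 by auto
    ultimately have "T (r k) \<le> K * (1 + ln (1 + x) + ln (r (Suc k) / (r (Suc k) - r k)))"
      unfolding x_def by (intro ineq r)
    also have "\<dots> \<le> K * (1 + ln (1 + x) + (real k + 3))" using K lnb[of k] by (intro mult_left_mono) auto
    finally have "T (r k) \<le> K * (1 + ln (1 + x) + (real k + 3))" .
    moreover have "4 * K * (real k + k0) = K * (4 * m)" by (simp add: m_def)
    ultimately have "K * (4 * m) \<le> K * (1 + ln (1 + x) + (real k + 3))" using Suc by linarith
    then have "4 * m \<le> 1 + ln (1 + x) + (real k + 3)" using K by simp
    then have "2 * m \<le> ln (1 + x)" using m by simp
    then have "exp (2 * m) \<le> 1 + x" using x0 by (simp add: ln_ge_iff)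
    moreover have "1 + 2 * m + (2 * m)\<^sup>2 / 2 \<le> exp (2 * m)" using m by (intro exp_lower_Taylor_quadratic) auto
    ultimately have "x \<ge> 2 * m * m" using m by (simp add: power2_eq_square)
    moreover have "2 * m * m \<ge> 2 * (4 * K) * m" using m K by (intro mult_mono) auto
    moreover have "4 * K * (m - 1) \<ge> 0" using m(1) K by (intro mult_nonneg_nonneg) auto
    then have "2 * (4 * K) * m \<ge> 4 * K * (m + 1)" by (simp add: algebra_simps)
    moreover have "4 * K * (real (Suc k) + k0) = 4 * K * (m + 1)" by (simp add: m_def)
    ultimately show ?case unfolding x_def by linarith
  qed
  obtain C where C: "\<And>r. good r \<Longrightarrow> 0 < r \<Longrightarrow> r \<le> 2 * r0 \<Longrightarrow> T r \<le> C" using bdd by metis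
  have TC: "T (r k) \<le> C" for k using C[OF r(3), of k] up[of k] low[of k] r0 by simp
  obtain k :: nat where "real k > C / (4 * K)" using reals_Archimedean2 by blast
  then have "4 * K * real k > C" using K by (simp add: field_simps)
  moreover have "4 * K * k0 \<ge> 0" using K by (simp add: k0_def)
  ultimately show False using claim[of k] TC[of k] by (simp add: distrib_left)
qed

section \<open>From a pointwise inequality to a contradiction\<close>

lemma log_deriv_dilate:
  assumes p: "entire p" and nz: "p (z0 + R * w) \<noteq> 0"
  shows "log_deriv (\<lambda>w. p (z0 + R * w)) w = R * log_deriv p (z0 + R * w)"
    and "deriv (log_deriv (\<lambda>w. p (z0 + R * w))) w = R\<^sup>2 * deriv (log_deriv p) (z0 + R * w)"
proof -
  have dp: "(p has_field_derivative deriv p z) (at z)" for z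
    using p by (intro holomorphic_derivI) auto
  have d1: "deriv (\<lambda>w. p (z0 + R * w)) w = R * deriv p (z0 + R * w)" for w
  proof (rule DERIV_imp_deriv)
    have "((\<lambda>w. p (z0 + R * w)) has_field_derivative deriv p (z0 + R * w) * R) (at w)"
      by (rule DERIV_chain2[where f = p and g = "\<lambda>w. z0 + R * w", OF dp]) (auto intro!: derivative_eq_intros)
    then show "((\<lambda>w. p (z0 + R * w)) has_field_derivative R * deriv p (z0 + R * w)) (at w)"
      by (simp only: mult.commute)
  qed
  then show "log_deriv (\<lambda>w. p (z0 + R * w)) w = R * log_deriv p (z0 + R * w)" by simp
  have "log_deriv p field_differentiable at (z0 + R * w)"
    by (rule field_differentiable_divide)
       (use nz in \<open>auto intro!: holomorphic_on_imp_differentiable_at[OF _ open_UNIV] holomorphic_deriv p\<close>)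
  then have dl: "(log_deriv p has_field_derivative deriv (log_deriv p) (z0 + R * w)) (at (z0 + R * w))"
    by (rule field_differentiable_derivI)
  have "((\<lambda>w. R * log_deriv p (z0 + R * w)) has_field_derivative R * (deriv (log_deriv p) (z0 + R * w) * R)) (at w)"
    by (rule DERIV_cmult, rule DERIV_chain2[where f = "log_deriv p" and g = "\<lambda>w. z0 + R * w" and x = w, OF dl]) (auto intro!: derivative_eq_intros)
  moreover have "(\<lambda>w. R * log_deriv p (z0 + R * w)) = log_deriv (\<lambda>w. p (z0 + R * w))"
    using d1 by (auto simp: fun_eq_iff)
  ultimately show "deriv (log_deriv (\<lambda>w. p (z0 + R * w))) w = R\<^sup>2 * deriv (log_deriv p) (z0 + R * w)"
    by (simp add: DERIV_imp_deriv power2_eq_square)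
qed

lemma holomorphic_dilate:
  "entire p \<Longrightarrow> entire (\<lambda>w. p (z0 + R * w))"
  by (rule holomorphic_on_compose_gen[of "\<lambda>w. z0 + R * w" UNIV p UNIV, unfolded o_def])
     (auto intro!: holomorphic_intros)

lemma member_le_sum_list_nonneg:
  fixes f :: "'a \<Rightarrow> real"
  assumes "a \<in> set xs" "\<And>x. x \<in> set xs \<Longrightarrow> f x \<ge> 0"
  shows "f a \<le> (\<Sum>x\<leftarrow>xs. f x)"
  using assms
proof (induction xs)
  case (Cons b xs)
  have "(\<Sum>x\<leftarrow>xs. f x) \<ge> 0" using Cons.prems(2) by (intro sum_list_nonneg) auto
  then show ?case using Cons by (cases "a = b") (auto simp: add_increasing)
qed auto

text \<open>Zeros contribute nonnegative terms to Jensen's formula. Dropping all of them gives the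
  first bound; keeping one zero z1 gives the second, whose ln r is the source of unbounded
  growth.\<close>

lemma Jensen_lower_bounds:
  assumes U: "entire U" "\<And>z. z \<in> sphere z0 r \<Longrightarrow> U z \<noteq> 0" "U z0 \<noteq> 0" "r > 0"
  shows "ln (norm (U z0)) \<le> circle_mean z0 r (\<lambda>z. ln (norm (U z)))"
    and "U z1 = 0 \<Longrightarrow> norm (z1 - z0) < r \<Longrightarrow> 
      ln (norm (U z0)) + ln r - ln (norm (z1 - z0)) \<le> circle_mean z0 r (\<lambda>z. ln (norm (U z)))"
proof -
  let ?f = "\<lambda>w. U (z0 + of_real r * w)"
  have f1: "?f z \<noteq> 0" if "norm z = 1" for z
    using U(2)[of "z0 + of_real r * z"] that U(4) by (simp add: dist_norm norm_mult)
  have f0: "?f 0 \<noteq> 0" using U(3) by simp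
  obtain xs where xs: "set xs = {z\<in>ball 0 1. ?f z = 0}"
    and J: "circle_mean 0 1 (\<lambda>w. ln (norm (?f w))) = ln (norm (?f 0)) + (\<Sum>a\<leftarrow>xs. - ln (norm a))"
    by (rule Poisson_Jensen_unit_disc[OF holomorphic_dilate[OF U(1)] f1 f0]) (assumption, blast)
  have J': "circle_mean z0 r (\<lambda>z. ln (norm (U z))) = ln (norm (U z0)) + (\<Sum>a\<leftarrow>xs. - ln (norm a))"
    using J by (simp add: circle_mean_dilate[of z0 r])
  have a0: "a \<noteq> 0" "norm a < 1" if "a \<in> set xs" for a using that xs U(3) by auto
  then have nn: "- ln (norm a) \<ge> 0" if "a \<in> set xs" for a using a0[OF that] by (simp add: less_imp_le)
  then show "ln (norm (U z0)) \<le> circle_mean z0 r (\<lambda>z. ln (norm (U z)))"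
    unfolding J' using nn by (intro add_increasing2 sum_list_nonneg) auto
  assume z1: "U z1 = 0" "norm (z1 - z0) < r"
  define a where "a = (z1 - z0) / of_real r"
  have "a \<in> set xs" using xs z1 U(4) by (simp add: a_def norm_divide)
  then have "- ln (norm a) \<le> (\<Sum>a\<leftarrow>xs. - ln (norm a))" using nn by (rule member_le_sum_list_nonneg)
  moreover have "ln (norm a) = ln (norm (z1 - z0)) - ln r"
    using U(3,4) z1 by (auto simp: a_def norm_divide ln_div)
  ultimately show "ln (norm (U z0)) + ln r - ln (norm (z1 - z0)) \<le> circle_mean z0 r (\<lambda>z. ln (norm (U z)))"
    unfolding J' by simp
qed

text \<open>The analytic core common to the line and the plane. Cancelling |s| and averaging
  logarithms gives mean ln |U| + d T(r) \<le> const + e mean ln G. Jensen bounds the mean of ln |U|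
  below by ln |U(z0)|, and the majorant bounds that of ln G by logarithms of T(R) and R/(R - r). The
  nonzero function \<open>L\<close> has a zero and is dominated by \<open>M\<close>, so T is
  unbounded, against the growth argument.\<close>

theorem Nevanlinna_core:
  fixes A :: "(complex \<Rightarrow> complex) set" and M :: "complex \<Rightarrow> real"
  defines "M \<equiv> (\<lambda>z. \<Sum>p\<in>A. norm (p z))"
  assumes A: "finite A" "A \<noteq> {}" "\<And>p. p \<in> A \<Longrightarrow> entire p \<and> (\<exists>w. p w \<noteq> 0)"
    and s: "entire s" and U: "entire U" and sU: "s w * U w \<noteq> 0"
    and L: "entire L" "L w' \<noteq> 0" "L z1 = 0" "\<And>z. norm (L z) \<le> C1 * M z"
    and d: "d \<ge> 1"
    and pw: "\<And>z g. g \<ge> 1 \<Longrightarrow> (\<And>p. p \<in> A \<Longrightarrow> p z \<noteq> 0) \<Longrightarrow>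
       (\<And>p q. p \<in> A \<Longrightarrow> q \<in> A \<Longrightarrow> norm (log_deriv p z - log_deriv q z) \<le> g) \<Longrightarrow>
       (\<And>p q. p \<in> A \<Longrightarrow> q \<in> A \<Longrightarrow> norm (deriv (log_deriv p) z - deriv (log_deriv q) z) \<le> g\<^sup>2) \<Longrightarrow>
       norm (s z * U z) * M z ^ d \<le> C * norm (s z) * g ^ e"
  shows False
proof -
  \<comment> \<open>Including the product of s and U makes both of them zero-free at the centre and
    on every good circle.\<close>
  define B where "B = insert L (insert (\<lambda>z. s z * U z) A)"
  have B: "finite B" "\<And>p. p \<in> B \<Longrightarrow> entire p \<and> (\<exists>w. p w \<noteq> 0)"
    unfolding B_def using A L(1,2) s U sU by (auto intro!: holomorphic_intros)
  obtain z0 where z0: "\<And>p. p \<in> B \<Longrightarrow> p z0 \<noteq> 0" using generic_point[OF B] by blast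
  have z0': "L z0 \<noteq> 0" "U z0 \<noteq> 0" "\<And>p. p \<in> A \<Longrightarrow> p z0 \<noteq> 0"
    using z0[of L] z0[of "\<lambda>z. s z * U z"] z0 by (auto simp: B_def)
  define good where "good = (\<lambda>r. \<forall>p\<in>B. \<forall>z\<in>sphere z0 r. p z \<noteq> 0)"
  have goodD: "L z \<noteq> 0" "U z \<noteq> 0" "s z \<noteq> 0" "\<And>p. p \<in> A \<Longrightarrow> p z \<noteq> 0" if "good r" "z \<in> sphere z0 r" for r z
    using that unfolding good_def B_def by auto
  have M_ge: "norm (p z) \<le> M z" if "p \<in> A" for p z
    unfolding M_def using A(1) that by (intro member_le_sum) auto
  have M0: "M z > 0" if "good r" "z \<in> sphere z0 r" for r z
  proof -
    obtain p where p: "p \<in> A" using A(2) by auto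
    have "norm (p z) > 0" using goodD(4)[OF that p] by simp
    then show ?thesis using M_ge[OF p, of z] by linarith
  qed
  have cM: "continuous_on S M" for S
    unfolding M_def using A(3)
    by (intro continuous_intros) (auto intro: holomorphic_on_imp_continuous_on holomorphic_on_subset)
  have clM: "continuous_on (sphere z0 r) (\<lambda>z. ln (M z))" if "good r" for r
    using M0[OF that] by (intro continuous_on_ln cM) (auto simp: less_le)
  have cln: "continuous_on (sphere z0 r) (\<lambda>z. ln (norm (p z)))" if "good r" "entire p" "\<And>z. z \<in> sphere z0 r \<Longrightarrow> p z \<noteq> 0" for p r
    using that by (intro continuous_on_ln_norm) auto
  define T where "T = (\<lambda>r. circle_mean z0 r (\<lambda>z. ln (M z)))"
  define c0 where "c0 = (\<Sum>p\<in>A. \<bar>ln (norm (p z0))\<bar>)"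
  have c0: "- ln (norm (p z0)) \<le> c0" if "p \<in> A" for p
  proof -
    have "\<bar>ln (norm (p z0))\<bar> \<le> c0" unfolding c0_def using A(1) that by (intro member_le_sum) auto
    then show ?thesis by linarith
  qed
  define k where "k = \<bar>ln (\<bar>C\<bar> + 1)\<bar> + \<bar>ln (norm (U z0))\<bar> + \<bar>c0\<bar>"
  define K where "K = k + real e * (8 + 2 * ln (33 + 2 * real (card A)) + 72) + 1"
  have k0: "k \<ge> 0" by (simp add: k_def)
  have ln0: "ln (33 + 2 * real (card A)) \<ge> 0" by simp
  have K0: "K > 0" unfolding K_def using k0 ln0 by (intro add_nonneg_pos add_nonneg_nonneg mult_nonneg_nonneg) auto
  have main: "0 \<le> T R + c0 \<and> T r + c0 \<le> K * (1 + ln (1 + (T R + c0)) + ln (R / (R - r)))"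
    if gr: "good r" and gR: "good R" and rR: "1 \<le> r" "r < R" "R \<le> 2 * r" for r R
  proof -
    \<comment> \<open>The map w to z0 + R w carries the unit circle to radius R and the circle of
      radius \<open>\<rho>\<close> to radius r. It multiplies logarithmic derivatives by R and their
      derivatives by R^2; as R \<ge> 1, bounds for the dilated functions hold for the original ones
      too.\<close>
    define \<rho> where "\<rho> = r / R"
    have R0: "R > 0" "R \<ge> 1" using rR by auto
    have \<rho>: "1 / 2 \<le> \<rho>" "\<rho> < 1" using rR by (auto simp: \<rho>_def field_simps)
    have D: "R / (R - r) = 1 / (1 - \<rho>)" using rR by (simp add: \<rho>_def field_simps)
    let ?dil = "\<lambda>p w. p (z0 + of_real R * w) :: complex"
    have s1: "z0 + of_real R * w \<in> sphere z0 R" if "norm w = 1" for w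
      using that R0 by (simp add: dist_norm norm_mult)
    have s2: "z0 + of_real R * w \<in> sphere z0 r" if "norm w = \<rho>" for w
      using that R0 by (simp add: dist_norm norm_mult \<rho>_def)
    have TR: "T R = circle_mean 0 1 (\<lambda>w. ln (M (z0 + of_real R * w)))"
      unfolding T_def by (rule circle_mean_dilate)
    have "\<exists>G. continuous_on (sphere 0 \<rho>) G \<and> (\<forall>z. norm z = \<rho> \<longrightarrow> G z \<ge> 1) \<and>
      (\<forall>p\<in>?dil ` A. \<forall>q\<in>?dil ` A. \<forall>z. norm z = \<rho> \<longrightarrow> norm (log_deriv p z - log_deriv q z) \<le> G z) \<and>
      (\<forall>p\<in>?dil ` A. \<forall>q\<in>?dil ` A. \<forall>z. norm z = \<rho> \<longrightarrow> norm (deriv (log_deriv p) z - deriv (log_deriv q) z) \<le> (G z)\<^sup>2) \<and>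
      circle_mean 0 \<rho> (\<lambda>z. ln (G z)) \<le> 2 * ln (1 + (T R + c0)) + 6 * ln (R / (R - r)) + 2 * ln (33 + 2 * real (card (?dil ` A))) + 72 \<and> T R + c0 \<ge> 0"
    proof (rule log_deriv_majorant[of "?dil ` A" \<rho> "R / (R - r)" "\<lambda>w. M (z0 + of_real R * w)" c0 "T R + c0"], goal_cases)
      case 3 then show ?case using A(3) holomorphic_dilate by auto
    next
      case 4 then show ?case using z0'(3) by auto
    next
      case 5 then show ?case using goodD(4)[OF gR s1] by auto
    next
      case 6 then show ?case using goodD(4)[OF gr s2] by auto
    next
      case 10
      show ?case by (rule continuous_on_compose2[OF cM[of UNIV]]) (auto intro!: continuous_intros)
    next
      case 11 then show ?case using M_ge by auto
    next
      case 12 then show ?case using c0 by auto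
    next
      case 13 then show ?case using TR by simp
    next
      case (14 G)
      then show ?case by (intro exI[of _ G]) blast
    qed (use A D \<rho> in auto)
    then obtain G where G: "continuous_on (sphere 0 \<rho>) G" "\<And>z. norm z = \<rho> \<Longrightarrow> G z \<ge> 1"
      and G1: "\<And>p q z. p \<in> A \<Longrightarrow> q \<in> A \<Longrightarrow> norm z = \<rho> \<Longrightarrow> norm (log_deriv (?dil p) z - log_deriv (?dil q) z) \<le> G z"
      and G2: "\<And>p q z. p \<in> A \<Longrightarrow> q \<in> A \<Longrightarrow> norm z = \<rho> \<Longrightarrow> norm (deriv (log_deriv (?dil p)) z - deriv (log_deriv (?dil q)) z) \<le> (G z)\<^sup>2"
      and mG: "circle_mean 0 \<rho> (\<lambda>z. ln (G z)) \<le> 2 * ln (1 + (T R + c0)) + 6 * ln (R / (R - r)) + 2 * ln (33 + 2 * real (card (?dil ` A))) + 72"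
      and TR0: "T R + c0 \<ge> 0"
      by auto
    have pt: "ln (norm (?dil U w)) + real d * ln (M (z0 + of_real R * w)) \<le> ln (\<bar>C\<bar> + 1) + real e * ln (G w)" if w: "norm w = \<rho>" for w
    proof -
      define z where "z = z0 + of_real R * w"
      have z: "z \<in> sphere z0 r" unfolding z_def by (rule s2[OF w])
      have g1: "G w \<ge> 1" using G(2)[OF w] .
      have nz: "p (z0 + of_real R * w) \<noteq> 0" if "p \<in> A" for p using goodD(4)[OF gr z that] by (simp add: z_def)
      have "norm (s z * U z) * M z ^ d \<le> C * norm (s z) * G w ^ e"
      proof (rule pw[OF g1])
        show "p z \<noteq> 0" if "p \<in> A" for p using goodD(4)[OF gr z that] .
        fix p q assume pq: "p \<in> A" "q \<in> A"
        have hp: "entire p" "entire q" using A(3) pq by auto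
        have "log_deriv (?dil p) w - log_deriv (?dil q) w = of_real R * (log_deriv p z - log_deriv q z)"
          unfolding z_def by (simp only: log_deriv_dilate(1)[OF hp(1) nz[OF pq(1)]] log_deriv_dilate(1)[OF hp(2) nz[OF pq(2)]] right_diff_distrib)
        then have "R * norm (log_deriv p z - log_deriv q z) \<le> G w"
          using G1[OF pq w] R0(1) by (simp add: norm_mult)
        moreover have "1 * norm (log_deriv p z - log_deriv q z) \<le> R * norm (log_deriv p z - log_deriv q z)"
          using R0 by (intro mult_right_mono) auto
        ultimately show "norm (log_deriv p z - log_deriv q z) \<le> G w" by linarith
        have "deriv (log_deriv (?dil p)) w - deriv (log_deriv (?dil q)) w = of_real (R\<^sup>2) * (deriv (log_deriv p) z - deriv (log_deriv q) z)"
          unfolding z_def by (simp only: log_deriv_dilate(2)[OF hp(1) nz[OF pq(1)]] log_deriv_dilate(2)[OF hp(2) nz[OF pq(2)]] right_diff_distrib of_real_power)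
        then have "norm (of_real (R\<^sup>2) * (deriv (log_deriv p) z - deriv (log_deriv q) z)) \<le> (G w)\<^sup>2"
          using G2[OF pq w] by (simp only:)
        then have "R\<^sup>2 * norm (deriv (log_deriv p) z - deriv (log_deriv q) z) \<le> (G w)\<^sup>2"
          unfolding norm_mult norm_of_real by simp
        moreover have "1 * norm (deriv (log_deriv p) z - deriv (log_deriv q) z) \<le> R\<^sup>2 * norm (deriv (log_deriv p) z - deriv (log_deriv q) z)"
          using R0 by (intro mult_right_mono) auto
        ultimately show "norm (deriv (log_deriv p) z - deriv (log_deriv q) z) \<le> (G w)\<^sup>2" by linarith
      qed
      moreover have "norm (s z) > 0" using goodD(3)[OF gr z] by simp
      moreover have "norm (s z * U z) * M z ^ d = norm (s z) * (norm (U z) * M z ^ d)" by (simp add: norm_mult)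
      moreover have "C * norm (s z) * G w ^ e = norm (s z) * (C * G w ^ e)" by simp
      ultimately have "norm (U z) * M z ^ d \<le> C * G w ^ e" by (metis mult_le_cancel_left_pos)
      also have "\<dots> \<le> (\<bar>C\<bar> + 1) * G w ^ e" using g1 by (intro mult_right_mono) auto
      finally have "ln (norm (U z) * M z ^ d) \<le> ln ((\<bar>C\<bar> + 1) * G w ^ e)"
        using goodD(2)[OF gr z] M0[OF gr z] by (intro ln_mono) auto
      moreover have "\<bar>C\<bar> + 1 \<noteq> 0" "G w > 0" using g1 by linarith+
      ultimately show ?thesis
        using goodD(2)[OF gr z] M0[OF gr z] unfolding z_def[symmetric] by (simp add: ln_mult ln_realpow)
    qed
    have \<rho>0: "\<rho> \<ge> 0" using \<rho> by simp
    have R\<rho>: "R * \<rho> = r" using R0 by (simp add: \<rho>_def)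
    have comp: "continuous_on (sphere 0 \<rho>) (\<lambda>w. h (z0 + of_real R * w))" if "continuous_on (sphere z0 r) h" for h :: "complex \<Rightarrow> real"
      by (rule continuous_on_compose2[OF that]) (use s2 in \<open>auto intro!: continuous_intros\<close>)
    have cU: "continuous_on (sphere 0 \<rho>) (\<lambda>w. ln (norm (?dil U w)))"
      by (rule comp[OF cln[OF gr U goodD(2)[OF gr]]]) 
    have cMd: "continuous_on (sphere 0 \<rho>) (\<lambda>w. real d * ln (M (z0 + of_real R * w)))"
      by (intro continuous_on_mult continuous_on_const comp[OF clM[OF gr]])
    have clG: "continuous_on (sphere 0 \<rho>) (\<lambda>w. ln (G w))"
      using G(2) by (intro continuous_on_ln G(1)) force
    have clG': "continuous_on (sphere 0 \<rho>) (\<lambda>w. real e * ln (G w))"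
      by (intro continuous_on_mult continuous_on_const clG)
    have "circle_mean 0 \<rho> (\<lambda>w. ln (norm (?dil U w)) + real d * ln (M (z0 + of_real R * w)))
       \<le> circle_mean 0 \<rho> (\<lambda>w. ln (\<bar>C\<bar> + 1) + real e * ln (G w))"
      by (intro circle_mean_mono continuous_on_add cU cMd clG' continuous_on_const \<rho>0 pt) auto
    then have "circle_mean 0 \<rho> (\<lambda>w. ln (norm (?dil U w))) + real d * circle_mean 0 \<rho> (\<lambda>w. ln (M (z0 + of_real R * w)))
       \<le> ln (\<bar>C\<bar> + 1) + real e * circle_mean 0 \<rho> (\<lambda>w. ln (G w))"
      unfolding circle_mean_add[OF cU cMd \<rho>0] circle_mean_add[OF continuous_on_const clG' \<rho>0] circle_mean_const circle_mean_cmult .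
    also have "circle_mean 0 \<rho> (\<lambda>w. ln (norm (?dil U w))) = circle_mean z0 r (\<lambda>z. ln (norm (U z)))"
      using circle_mean_dilate2[of \<rho> "\<lambda>z. ln (norm (U z))" z0 R] by (simp only: R\<rho>)
    also have "circle_mean 0 \<rho> (\<lambda>w. ln (M (z0 + of_real R * w))) = T r"
      using circle_mean_dilate2[of \<rho> "\<lambda>z. ln (M z)" z0 R] by (simp only: R\<rho> T_def)
    finally have 1: "circle_mean z0 r (\<lambda>z. ln (norm (U z))) + real d * T r \<le> ln (\<bar>C\<bar> + 1) + real e * circle_mean 0 \<rho> (\<lambda>w. ln (G w))" .
    have 2: "ln (norm (U z0)) \<le> circle_mean z0 r (\<lambda>z. ln (norm (U z)))"
      using goodD(2)[OF gr] z0'(2) rR by (intro Jensen_lower_bounds(1) U) auto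
    define a where "a = ln (1 + (T R + c0))"
    define b where "b = ln (R / (R - r))"
    have ab: "a \<ge> 0" "b \<ge> 0" using TR0 rR by (auto simp: a_def b_def field_simps)
    have "card (?dil ` A) \<le> card A" by (rule card_image_le[OF A(1)])
    then have lc: "ln (33 + 2 * real (card (?dil ` A))) \<le> ln (33 + 2 * real (card A))" by (intro ln_mono) auto
    define q where "q = 2 * ln (33 + 2 * real (card A)) + 72"
    define P where "P = 1 + a + b"
    have q: "q \<ge> 0" using ln0 unfolding q_def by linarith
    have "circle_mean 0 \<rho> (\<lambda>w. ln (G w)) \<le> 2 * a + 6 * b + q"
      using mG lc unfolding a_def b_def q_def by linarith
    also have "\<dots> \<le> 8 * P + q * P"
    proof -
      have "q * 1 \<le> q * P" using q ab by (intro mult_left_mono) (auto simp: P_def)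
      moreover have "8 * P = 8 + 8 * a + 8 * b" by (simp add: P_def)
      ultimately show ?thesis using ab by linarith
    qed
    also have "\<dots> = (8 + q) * P" by (simp add: algebra_simps)
    finally have 3: "real e * circle_mean 0 \<rho> (\<lambda>w. ln (G w)) \<le> real e * ((8 + q) * P)"
      by (intro mult_left_mono) auto
    have k1: "k * 1 \<le> k * P" using k0 ab by (intro mult_left_mono) (auto simp: P_def)
    \<comment> \<open>T(r) may be negative. Then d \<ge> 1 gives no comparison, but the final bound
      is immediate from c0 \<le> k.\<close>
    have "T r \<le> real d * T r \<or> T r \<le> 0"
      using d by (cases "T r \<le> 0") (auto simp: mult_le_cancel_right1)
    moreover have "real d * T r + c0 \<le> k + real e * ((8 + q) * P)"
      using 1 2 3 unfolding k_def by linarith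
    moreover have "0 \<le> real e * ((8 + q) * P)"
      using ab q by (intro mult_nonneg_nonneg) (auto simp: P_def)
    moreover have "c0 \<le> k" unfolding k_def by linarith
    ultimately have "T r + c0 \<le> k + real e * ((8 + q) * P)"
      by linarith
    also have "\<dots> \<le> k * P + real e * ((8 + q) * P) + P"
      using k1 ab by (simp add: P_def)
    also have "\<dots> = (k + real e * (8 + q) + 1) * P" by (simp only: distrib_right mult_1 mult.assoc)
    also have "k + real e * (8 + q) + 1 = K" by (simp only: K_def q_def add.assoc)
    finally have "T r + c0 \<le> K * (1 + ln (1 + (T R + c0)) + ln (R / (R - r)))"
      unfolding P_def a_def b_def .
    then show ?thesis using TR0 by blast
  qed
  have dense: "\<exists>r. a < r \<and> r < b \<and> good r" if "a < b" for a b
  proof (rule generic_radius[OF B that, of z0])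
    fix R assume R: "a < R" "R < b" "\<And>p z. p \<in> B \<Longrightarrow> z \<in> sphere z0 R \<Longrightarrow> p z \<noteq> 0"
    have "good R" unfolding good_def by (intro ballI R(3))
    with R(1,2) show ?thesis by blast
  qed
  show False
  proof (rule growth_contradiction[of good "\<lambda>r. T r + c0" K])
    show "\<exists>r. a < r \<and> r < b \<and> good r" if "a < b" for a b using dense[OF that] .
    show "K > 0" by fact
    show "T r + c0 \<le> K * (1 + ln (1 + (T R + c0)) + ln (R / (R - r)))"
      if "good r" "good R" "1 \<le> r" "r < R" "R \<le> 2 * r" for r R using main[OF that] by blast
    show "T r + c0 \<ge> 0" if "good r" "1 \<le> r" for r
    proof -
      \<comment> \<open>\<open>main\<close> gives nonnegativity only at the larger of two radii that
        are at least 1, so the radius 1 itself is treated by Jensen's inequality for one p.\<close>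
      define m where "m = max 1 (r / 2)"
      show ?thesis
      proof (cases "r = 1")
        case False
        then have "m < r" using that by (auto simp: m_def)
        then obtain r' where r': "m < r'" "r' < r" "good r'" using dense by blast
        show ?thesis using main[of r' r] r' that by (auto simp: m_def)
      next
        case True
        have p: "entire p" "ln (norm (p z0)) \<le> T r" if "p \<in> A" for p
        proof -
          show hp: "entire p" using A(3) that by auto
          have "ln (norm (p z0)) \<le> circle_mean z0 r (\<lambda>z. ln (norm (p z)))"
            using goodD(4)[OF \<open>good r\<close> _ that] z0'(3)[OF that] \<open>1 \<le> r\<close> by (intro Jensen_lower_bounds(1) hp) auto
          also have "\<dots> \<le> T r"
            unfolding T_def using goodD(4)[OF \<open>good r\<close> _ that] M_ge[OF that] \<open>1 \<le> r\<close>
            by (intro circle_mean_mono cln clM hp ln_mono \<open>good r\<close>) auto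
          finally show "ln (norm (p z0)) \<le> T r" .
        qed
        obtain p where "p \<in> A" using A(2) by auto
        then show ?thesis using p(2) c0[of p] by force
      qed
    qed
    show "\<exists>C. \<forall>r. good r \<longrightarrow> 0 < r \<longrightarrow> r \<le> b \<longrightarrow> T r + c0 \<le> C" for b
    proof -
      have "compact (M ` cball z0 b)" by (intro compact_continuous_image cM) auto
      then obtain Q where Q: "\<And>z. z \<in> cball z0 b \<Longrightarrow> M z \<le> Q"
        using compact_imp_bounded bounded_imp_bdd_above unfolding bdd_above_def by (metis imageI)
      have "T r + c0 \<le> ln Q + c0" if "good r" "0 < r" "r \<le> b" for r
      proof -
        have "T r \<le> circle_mean z0 r (\<lambda>_. ln Q)"
          unfolding T_def using that M0[OF that(1)] Q
          by (intro circle_mean_mono clM continuous_on_const ln_mono) auto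
        then show ?thesis by simp
      qed
      then show ?thesis by blast
    qed
    show "\<exists>r\<ge>1. good r \<and> T r + c0 \<ge> Q" for Q
    proof -
      define q where "q = Q - c0 + ln \<bar>C1\<bar> - ln (norm (L z0)) + ln (norm (z1 - z0))"
      define m where "m = max 1 (max (norm (z1 - z0)) (exp q))"
      obtain r where r: "m < r" "good r" using dense[of m "m + 1"] by auto
      have r1: "r > 1" "norm (z1 - z0) < r" "exp q < r" using r by (auto simp: m_def)
      have "ln (norm (L z0)) + ln r - ln (norm (z1 - z0)) \<le> circle_mean z0 r (\<lambda>z. ln (norm (L z)))"
        using goodD(1)[OF r(2)] z0' r1 L by (intro Jensen_lower_bounds(2)) auto
      also have "\<dots> \<le> circle_mean z0 r (\<lambda>z. ln \<bar>C1\<bar> + ln (M z))"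
      proof (intro circle_mean_mono cln L(1) r(2) goodD(1)[OF r(2)] continuous_on_add continuous_on_const clM)
        fix z assume z: "z \<in> sphere z0 r"
        have Lz: "norm (L z) > 0" using goodD(1)[OF r(2) z] by simp
        have "norm (L z) \<le> \<bar>C1\<bar> * M z"
          using L(4)[of z] mult_right_mono[of C1 "\<bar>C1\<bar>" "M z"] M0[OF r(2) z] by linarith
        moreover from this have "C1 \<noteq> 0" using Lz by auto
        ultimately have "ln (norm (L z)) \<le> ln (\<bar>C1\<bar> * M z)" using Lz by (intro ln_mono)
        also have "\<dots> = ln \<bar>C1\<bar> + ln (M z)"
          using \<open>C1 \<noteq> 0\<close> M0[OF r(2) z] by (simp add: ln_mult)
        finally show "ln (norm (L z)) \<le> ln \<bar>C1\<bar> + ln (M z)" .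
      qed (use r1 in auto)
      also have "\<dots> = ln \<bar>C1\<bar> + T r"
        unfolding T_def by (subst circle_mean_add) (use clM[OF r(2)] r1 in auto)
      finally have "ln (norm (L z0)) + ln r - ln (norm (z1 - z0)) \<le> ln \<bar>C1\<bar> + T r" .
      moreover have "ln (exp q) \<le> ln r" using r1 by (intro ln_mono) auto
      ultimately have "T r + c0 \<ge> Q" by (simp add: q_def)
      then show ?thesis using r r1 by (intro exI[of _ r]) auto
    qed
  qed
qed

section \<open>Wronskians, divisibility and the second main theorem on the line\<close>

definition wr2 :: "(complex \<Rightarrow> complex) \<Rightarrow> (complex \<Rightarrow> complex) \<Rightarrow> complex \<Rightarrow> complex" where
  "wr2 f g z = f z * deriv g z - deriv f z * g z"

text \<open>The three-by-three Wronskian determinant, expanded along the undifferentiated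
  functions.\<close>

definition wr3 :: "(complex \<Rightarrow> complex) \<Rightarrow> (complex \<Rightarrow> complex) \<Rightarrow> (complex \<Rightarrow> complex) \<Rightarrow> complex \<Rightarrow> complex" where
  "wr3 f g h z = f z * (deriv g z * deriv (deriv h) z - deriv (deriv g) z * deriv h z)
     - g z * (deriv f z * deriv (deriv h) z - deriv (deriv f) z * deriv h z)
     + h z * (deriv f z * deriv (deriv g) z - deriv (deriv f) z * deriv g z)"

lemma entire_deriv: "entire f \<Longrightarrow> (f has_field_derivative deriv f z) (at z)"
  by (rule holomorphic_derivI) auto

lemma entire_holomorphic_deriv: "entire f \<Longrightarrow> deriv f holomorphic_on UNIV"
  by (rule holomorphic_deriv) auto

lemma holomorphic_wr2: "entire f \<Longrightarrow> entire g \<Longrightarrow> wr2 f g holomorphic_on UNIV"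
  unfolding wr2_def by (auto intro!: holomorphic_intros entire_holomorphic_deriv)

lemma holomorphic_wr3:
  "entire f \<Longrightarrow> entire g \<Longrightarrow> entire h \<Longrightarrow> wr3 f g h holomorphic_on UNIV"
  unfolding wr3_def by (intro holomorphic_intros entire_holomorphic_deriv) auto

lemma deriv_lincomb:
  assumes "entire X" "entire Y"
  shows "deriv (\<lambda>z. a * X z + b * Y z) = (\<lambda>z. a * deriv X z + b * deriv Y z)"
  by (rule ext, rule DERIV_imp_deriv) (auto intro!: derivative_eq_intros entire_deriv assms)

lemma wr2_lincomb:
  assumes "entire X" "entire Y"
  shows "wr2 (\<lambda>z. a * X z + b * Y z) (\<lambda>z. c * X z + d * Y z) z = (a * d - b * c) * wr2 X Y z"
  by (simp add: wr2_def deriv_lincomb[OF assms] algebra_simps)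

text \<open>Divisibility is local: near z the quotient F/s agrees with H/k off the zeros, and k does
  not vanish at z, so all singularities are removable. The cofactor k may depend on z, which allows
  different parts of s to be treated at different points.\<close>

lemma entire_divides:
  assumes F: "entire F" and s: "entire s" "s w' \<noteq> 0"
    and loc: "\<And>z. \<exists>k H. entire k \<and> entire H \<and> k z \<noteq> 0 \<and> (\<forall>w. F w * k w = s w * H w)"
  obtains U where "entire U" "\<And>z. F z = s z * U z"
proof -
  define q where "q = (\<lambda>z. F z / s z)"
  define U where "U = remove_sings q"
  have an: "f analytic_on {z}" if "entire f" for f z
    using that analytic_on_open[OF open_UNIV] analytic_on_subset by blast
  have "U analytic_on {z} \<and> F z = s z * U z" for z
  proof -
    obtain k H where k: "entire k" "entire H" "k z \<noteq> 0" "\<And>w. F w * k w = s w * H w"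
      using loc by blast
    have iso: "isolated_singularity_at q z"
      unfolding q_def by (intro isolated_singularity_at_divide isolated_singularity_at_analytic not_essential_analytic an F s)
    obtain m g where g: "entire g" "g z \<noteq> 0" "\<And>w. s w = (w - z) ^ m * g w"
      using entire_factor_at[OF s] by metis
    have "eventually (\<lambda>w. w \<in> {w. g w \<noteq> 0 \<and> k w \<noteq> 0}) (nhds z)"
      using g k by (intro eventually_nhds_in_open open_Collect_conj open_Collect_neq) 
        (auto intro!: holomorphic_on_imp_continuous_on)
    then have ev: "eventually (\<lambda>w. g w \<noteq> 0 \<and> k w \<noteq> 0 \<and> w \<noteq> z) (at z)"
      unfolding eventually_at_filter by eventually_elim auto
    then have "eventually (\<lambda>w. H w / k w = q w) (at z)"
    proof eventually_elim
      case (elim w)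
      then have "s w \<noteq> 0" using g(3) by auto
      then show ?case using k(4)[of w] elim by (simp add: q_def field_simps)
    qed
    moreover have "(\<lambda>w. H w / k w) \<midarrow>z\<rightarrow> H z / k z"
      using k by (intro tendsto_divide isContD) (auto intro!: analytic_at_imp_isCont an)
    ultimately have lim: "q \<midarrow>z\<rightarrow> H z / k z" by (rule Lim_transform_eventually[rotated])
    have "U z = H z / k z" unfolding U_def using lim by (rule remove_sings_eqI)
    moreover have "F z = s z * H z / k z" using k(3) k(4)[of z] by (simp add: eq_divide_eq)
    ultimately have "F z = s z * U z" by simp
    moreover have "U analytic_on {z}" unfolding U_def using iso lim by (rule remove_sings_analytic_at)
    ultimately show ?thesis by blast
  qed
  then have "U analytic_on UNIV" and 2: "\<And>z. F z = s z * U z" using analytic_on_analytic_at by blast+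
  then have "entire U" using analytic_imp_holomorphic by blast
  with 2 show thesis using that by blast
qed

text \<open>
  Nevanlinna's second main theorem for holomorphic curves \<open>(X : Y)\<close> in the projective line and the
  points \<open>J\<close>, in the form of a contradiction: \<open>s\<close> collects the multiplicities that the
  Wronskian sees.
\<close>

theorem Cartan_line:
  fixes X Y :: "complex \<Rightarrow> complex" and J :: "(complex \<times> complex) set"
  assumes X: "entire X" and Y: "entire Y" and W: "wr2 X Y w \<noteq> 0"
    and J: "finite J" "card J \<ge> 2" "\<And>i j. i \<in> J \<Longrightarrow> j \<in> J \<Longrightarrow> i \<noteq> j \<Longrightarrow> fst i * snd j - snd i * fst j \<noteq> 0"
    and s: "entire s" "entire U" "\<And>z. wr2 X Y z ^ k = s z * U z"
    and \<kappa>: "\<kappa> < k * (card J - 2)"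
    and bound: "\<And>z. norm (\<Prod>j\<in>J. fst j * X z + snd j * Y z) ^ k \<le> C * norm (s z) * (norm (X z) + norm (Y z)) ^ \<kappa>"
  shows False
proof -
  define B where "B = (\<lambda>j z. fst j * X z + snd j * Y z :: complex)"
  define det where "det = (\<lambda>i j. fst i * snd j - snd i * fst j :: complex)"
  define m where "m = (\<lambda>z. norm (X z) + norm (Y z))"
  have detn: "det i j \<noteq> 0" if "i \<in> J" "j \<in> J" "i \<noteq> j" for i j using J(3)[OF that] by (simp add: det_def)
  have hB: "B j holomorphic_on UNIV" for j unfolding B_def by (intro holomorphic_intros X Y)
  have wB: "wr2 (B i) (B j) z = det i j * wr2 X Y z" for i j z
    unfolding B_def det_def by (rule wr2_lincomb[OF X Y])
  define c where "c = (\<lambda>i j. (norm (fst i) + norm (snd i) + norm (fst j) + norm (snd j) + 1) / norm (det i j))"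
  define K where "K = 1 + (\<Sum>i\<in>J. \<Sum>j\<in>J. c i j)"
  define Q where "Q = 1 + (\<Sum>i\<in>J. \<Sum>j\<in>J. 1 / norm (det i j))"
  have c0: "c i j \<ge> 0" for i j by (simp add: c_def)
  have cK: "c i j \<le> K" if "i \<in> J" "j \<in> J" for i j
  proof -
    have "c i j \<le> (\<Sum>j\<in>J. c i j)" using that J(1) c0 by (intro member_le_sum) auto
    also have "\<dots> \<le> (\<Sum>i\<in>J. \<Sum>j\<in>J. c i j)" using that J(1) c0
      by (intro member_le_sum[of i J "\<lambda>i. \<Sum>j\<in>J. c i j"]) (auto intro!: sum_nonneg)
    finally show ?thesis by (simp add: K_def)
  qed
  have dQ: "1 / norm (det i j) \<le> Q" if "i \<in> J" "j \<in> J" for i j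
  proof -
    have "1 / norm (det i j) \<le> (\<Sum>j\<in>J. 1 / norm (det i j))" using that J(1) by (intro member_le_sum) auto
    also have "\<dots> \<le> (\<Sum>i\<in>J. \<Sum>j\<in>J. 1 / norm (det i j))" using that J(1)
      by (intro member_le_sum[of i J "\<lambda>i. \<Sum>j\<in>J. 1 / norm (det i j)"]) (auto intro!: sum_nonneg)
    finally show ?thesis by (simp add: Q_def)
  qed
  have K1: "K \<ge> 1" unfolding K_def using c0 by (simp add: sum_nonneg)
  have Q1: "Q \<ge> 1" unfolding Q_def by (simp add: sum_nonneg)
  have two: "m z \<le> K * (norm (B i z) + norm (B j z))" if "i \<in> J" "j \<in> J" "i \<noteq> j" for i j z
  proof -
    have d: "norm (det i j) > 0" using detn[OF that] by simp
    have "det i j * X z = snd j * B i z - snd i * B j z" "det i j * Y z = fst i * B j z - fst j * B i z"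
      by (simp_all add: det_def B_def algebra_simps)
    then have "norm (det i j) * norm (X z) = norm (snd j * B i z - snd i * B j z)"
       "norm (det i j) * norm (Y z) = norm (fst i * B j z - fst j * B i z)" by (metis norm_mult)+
    then have "norm (det i j) * m z \<le> (norm (snd j) * norm (B i z) + norm (snd i) * norm (B j z)) + (norm (fst i) * norm (B j z) + norm (fst j) * norm (B i z))"
      unfolding m_def distrib_left by (metis add_mono norm_mult norm_triangle_ineq4)
    also have "\<dots> \<le> (norm (fst i) + norm (snd i) + norm (fst j) + norm (snd j) + 1) * (norm (B i z) + norm (B j z))"
      by (simp add: distrib_left distrib_right)
    finally have "m z \<le> c i j * (norm (B i z) + norm (B j z))"
      using d by (simp add: c_def field_simps)
    also have "\<dots> \<le> K * (norm (B i z) + norm (B j z))" using cK[OF that(1,2)] by (intro mult_right_mono) auto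
    finally show ?thesis .
  qed
  \<comment> \<open>Two distinct forms suffice to bound |X| + |Y|, so the sum of all |B j| is
    comparable with it in both directions.\<close>
  obtain j1 j2 where j12: "j1 \<in> J" "j2 \<in> J" "j1 \<noteq> j2"
    using J(1,2) by (metis One_nat_def Suc_1 card_le_Suc0_iff_eq not_less_eq_eq)
  define S where "S = (\<Sum>j\<in>J. norm (fst j) + norm (snd j))"
  have BS: "norm (B j z) \<le> (norm (fst j) + norm (snd j)) * m z" for j z
  proof -
    have "norm (B j z) \<le> norm (fst j) * norm (X z) + norm (snd j) * norm (Y z)"
      unfolding B_def by (metis norm_mult norm_triangle_ineq)
    also have "\<dots> \<le> (norm (fst j) + norm (snd j)) * m z"
      by (simp add: m_def distrib_left distrib_right)
    finally show ?thesis .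
  qed
  define M where "M = (\<lambda>z. \<Sum>p\<in>B ` J. norm (p z))"
  have MS: "M z \<le> S * m z" for z
  proof -
    have "M z \<le> (\<Sum>j\<in>J. norm (B j z))" unfolding M_def
      using sum_image_le[OF J(1), of "\<lambda>p. norm (p z)" B] by (simp add: o_def)
    also have "\<dots> \<le> S * m z" unfolding S_def sum_distrib_right by (intro sum_mono BS)
    finally show ?thesis .
  qed
  have mM: "m z \<le> 2 * K * M z" for z
  proof -
    have le: "norm (B j z) \<le> M z" if "j \<in> J" for j unfolding M_def using J(1) that
      by (intro member_le_sum[of "B j" "B ` J" "\<lambda>p. norm (p z)"]) auto
    have "m z \<le> K * (norm (B j1 z) + norm (B j2 z))" by (rule two[OF j12])
    also have "\<dots> \<le> K * (M z + M z)" using le j12 K1 by (intro mult_left_mono add_mono) auto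
    finally show ?thesis by simp
  qed
  define q where "q = card J - 2"
  define E where "E = Q * (2 * K) ^ q"
  have E1: "E \<ge> 0" using Q1 K1 by (simp add: E_def)
  have pointwise: "norm (wr2 X Y z) * m z ^ q \<le> E * (\<Prod>j\<in>J. norm (B j z)) * g"
    if g: "g \<ge> 1" and nz: "\<And>j. j \<in> J \<Longrightarrow> B j z \<noteq> 0"
      and ld: "\<And>i j. i \<in> J \<Longrightarrow> j \<in> J \<Longrightarrow> norm (log_deriv (B i) z - log_deriv (B j) z) \<le> g" for z g
  proof -
    have "J \<noteq> {}" using j12 by auto
    \<comment> \<open>Since two forms determine X and Y, at most one of them can be small at z. With
      \<open>i\<close> the smallest, every other form is at least m z / (2K). Of the product,
      \<open>i\<close> and one further form \<open>l\<close> go into the Wronskian, and the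
      remaining card J - 2 forms supply the power of m.\<close>
    define i where "i = arg_min_on (\<lambda>j. norm (B j z)) J"
    have i1: "i \<in> J"
      unfolding i_def by (rule arg_min_if_finite(1)[OF J(1) \<open>J \<noteq> {}\<close>])
    have i2: "norm (B i z) \<le> norm (B j z)" if "j \<in> J" for j
      unfolding i_def by (rule arg_min_least[OF J(1) \<open>J \<noteq> {}\<close> that, of "\<lambda>j. norm (B j z)"])
    note i = i1 i2
    obtain l where l: "l \<in> J" "l \<noteq> i" using j12 by metis
    have "wr2 (B l) (B i) z = B l z * B i z * (log_deriv (B i) z - log_deriv (B l) z)"
      using nz[OF i(1)] nz[OF l(1)] by (simp add: wr2_def field_simps)
    then have "norm (det l i) * norm (wr2 X Y z) = norm (B l z) * norm (B i z) * norm (log_deriv (B i) z - log_deriv (B l) z)"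
      unfolding wB by (metis norm_mult)
    also have "\<dots> \<le> norm (B l z) * norm (B i z) * g"
      using ld[OF i(1) l(1)] by (intro mult_left_mono) auto
    finally have "norm (wr2 X Y z) \<le> (1 / norm (det l i)) * (norm (B l z) * norm (B i z) * g)"
      using detn[OF l(1) i(1) l(2)] by (simp add: field_simps)
    also have "\<dots> \<le> Q * (norm (B l z) * norm (B i z) * g)"
      using dQ[OF l(1) i(1)] g by (intro mult_right_mono) auto
    finally have 1: "norm (wr2 X Y z) \<le> Q * (norm (B l z) * norm (B i z) * g)" .
    have "m z \<le> 2 * K * norm (B j z)" if j: "j \<in> J - {i, l}" for j
    proof -
      have "m z \<le> K * (norm (B i z) + norm (B j z))" using two[of i j z] i j by auto
      also have "\<dots> \<le> K * (norm (B j z) + norm (B j z))" using i j K1 by (intro mult_left_mono add_mono) auto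
      finally show ?thesis by simp
    qed
    then have "(\<Prod>j\<in>J - {i, l}. m z) \<le> (\<Prod>j\<in>J - {i, l}. 2 * K * norm (B j z))"
      by (intro prod_mono) (auto simp: m_def)
    moreover have "card (J - {i, l}) = q" using J(1) i(1) l by (simp add: q_def card_Diff_subset)
    ultimately have 2: "m z ^ q \<le> (2 * K) ^ q * (\<Prod>j\<in>J - {i, l}. norm (B j z))"
      by (simp add: prod.distrib)
    have "(\<Prod>j\<in>J. norm (B j z)) = norm (B i z) * (norm (B l z) * (\<Prod>j\<in>J - {i, l}. norm (B j z)))"
      using J(1) i(1) l by (simp add: prod.remove[of J i] prod.remove[of "J - {i}" l] Diff_insert2[symmetric] insert_commute)
    then have eq: "Q * (norm (B l z) * norm (B i z) * g) * ((2 * K) ^ q * (\<Prod>j\<in>J - {i, l}. norm (B j z))) = E * (\<Prod>j\<in>J. norm (B j z)) * g"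
      by (simp add: E_def)
    have "norm (wr2 X Y z) * m z ^ q \<le> Q * (norm (B l z) * norm (B i z) * g) * ((2 * K) ^ q * (\<Prod>j\<in>J - {i, l}. norm (B j z)))"
      by (intro mult_mono 1 2) (use g Q1 in \<open>auto simp: m_def\<close>)
    also note eq
    finally show ?thesis .
  qed
  have Xw: "m w \<noteq> 0" using W by (auto simp: m_def wr2_def add_nonneg_eq_0_iff)
  \<comment> \<open>This combination vanishes at w by construction; were it identically zero, its
    derivative at w would give wr2 X Y w = 0.\<close>
  define L where "L = (\<lambda>z. Y w * X z + (- X w) * Y z)"
  have L: "entire L" unfolding L_def by (intro holomorphic_intros X Y)
  have Lw: "L w = 0" by (simp add: L_def)
  have Lnz: "\<exists>w'. L w' \<noteq> 0"
  proof (rule ccontr)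
    assume "\<not> ?thesis"
    then have "L = (\<lambda>_. 0)" by auto
    then have "deriv L w = 0" by simp
    then have "Y w * deriv X w - X w * deriv Y w = 0" unfolding L_def deriv_lincomb[OF X Y] by simp
    then show False using W by (simp add: wr2_def mult.commute)
  qed
  have LM: "norm (L z) \<le> (norm (Y w) + norm (X w)) * (2 * K) * M z" for z
  proof -
    have "norm (L z) \<le> norm (Y w * X z) + norm (- X w * Y z)" unfolding L_def by (rule norm_triangle_ineq)
    also have "\<dots> \<le> (norm (Y w) + norm (X w)) * m z" by (simp add: norm_mult m_def distrib_left distrib_right)
    also have "\<dots> \<le> (norm (Y w) + norm (X w)) * (2 * K * M z)" by (intro mult_left_mono mM) auto
    finally show ?thesis by simp
  qed
  define d where "d = k * q - \<kappa>"
  have d: "d \<ge> 1" "k * q = d + \<kappa>" using \<kappa> by (auto simp: d_def q_def)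
  have S0: "S \<ge> 0" unfolding S_def by (simp add: sum_nonneg)
  obtain w' where w': "L w' \<noteq> 0" using Lnz by blast
  have C': "\<bar>C\<bar> * E ^ k * S ^ d \<ge> 0" using E1 S0 by simp
  show False
  proof (rule Nevanlinna_core[of "B ` J" s U w L w' w "(norm (Y w) + norm (X w)) * (2 * K)" d "\<bar>C\<bar> * E ^ k * S ^ d" k])
    show "finite (B ` J)" "B ` J \<noteq> {}" using J(1) j12 by auto
    show "entire p \<and> (\<exists>w. p w \<noteq> 0)" if p: "p \<in> B ` J" for p
    proof -
      obtain i where i: "i \<in> J" "p = B i" using p by auto
      obtain j where j: "j \<in> J" "j \<noteq> i" using j12 by metis
      have "\<exists>w. B i w \<noteq> 0"
      proof (rule ccontr)
        assume "\<not> ?thesis"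
        then have "B i = (\<lambda>_. 0)" by auto
        then have "wr2 (B i) (B j) w = 0" by (simp add: wr2_def)
        then show False using wB detn[OF i(1) j(1)] j(2) W by auto
      qed
      then show ?thesis using i hB by auto
    qed
    show "s w * U w \<noteq> 0" using s(3)[of w] W by (metis power_not_zero)
    show "norm (L z) \<le> (norm (Y w) + norm (X w)) * (2 * K) * (\<Sum>p\<in>B ` J. norm (p z))" for z
      using LM by (simp add: M_def)
    fix z g
    assume g: "(1::real) \<le> g" and nz: "\<And>p. p \<in> B ` J \<Longrightarrow> p z \<noteq> 0"
      and ld: "\<And>p q. p \<in> B ` J \<Longrightarrow> q \<in> B ` J \<Longrightarrow> norm (log_deriv p z - log_deriv q z) \<le> g"
    have m0: "m z > 0"
    proof -
      have "norm (B j1 z) > 0" using nz j12 by auto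
      then show ?thesis using BS[of j1 z] by (metis less_le_trans linorder_not_less mult_nonneg_nonpos add_nonneg_nonneg norm_ge_zero not_le)
    qed
    have "norm (wr2 X Y z) * m z ^ q \<le> E * (\<Prod>j\<in>J. norm (B j z)) * g"
      by (rule pointwise[OF g]) (use nz ld in auto)
    then have "(norm (wr2 X Y z) * m z ^ q) ^ k \<le> (E * (\<Prod>j\<in>J. norm (B j z)) * g) ^ k"
      by (intro power_mono) (auto simp: m_def)
    moreover have "norm (s z * U z) = norm (wr2 X Y z) ^ k" by (simp only: s(3)[symmetric] norm_power)
    ultimately have "norm (s z * U z) * m z ^ (k * q) \<le> E ^ k * norm (\<Prod>j\<in>J. B j z) ^ k * g ^ k"
      by (simp only: power_mult_distrib power_mult[symmetric] mult.commute[of k q] prod_norm)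
    also have "\<dots> \<le> E ^ k * (C * norm (s z) * m z ^ \<kappa>) * g ^ k"
      using bound[of z] E1 g unfolding B_def m_def by (intro mult_right_mono mult_left_mono) auto
    also have "\<dots> = m z ^ \<kappa> * (C * E ^ k * norm (s z) * g ^ k)" by simp
    finally have "m z ^ \<kappa> * (norm (s z * U z) * m z ^ d) \<le> m z ^ \<kappa> * (C * E ^ k * norm (s z) * g ^ k)"
      unfolding d(2) by (simp add: power_add mult_ac)
    then have "norm (s z * U z) * m z ^ d \<le> C * E ^ k * norm (s z) * g ^ k"
      using m0 by (simp add: mult_le_cancel_left_pos)
    also have "\<dots> \<le> \<bar>C\<bar> * E ^ k * norm (s z) * g ^ k"
      using E1 g by (intro mult_right_mono) auto
    finally have *: "norm (s z * U z) * m z ^ d \<le> \<bar>C\<bar> * E ^ k * norm (s z) * g ^ k" .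
    have "norm (s z * U z) * M z ^ d \<le> norm (s z * U z) * (S * m z) ^ d"
      by (intro mult_left_mono power_mono MS) (auto simp: M_def sum_nonneg)
    also have "\<dots> = S ^ d * (norm (s z * U z) * m z ^ d)" by (simp add: power_mult_distrib)
    also have "\<dots> \<le> S ^ d * (\<bar>C\<bar> * E ^ k * norm (s z) * g ^ k)" using * S0 by (intro mult_left_mono) auto
    finally show "norm (s z * U z) * (\<Sum>p\<in>B ` J. norm (p z)) ^ d \<le> \<bar>C\<bar> * E ^ k * S ^ d * norm (s z) * g ^ k"
      by (simp add: M_def mult_ac)
  qed (use s(1,2) L w' Lw d in auto)
qed

section \<open>The second main theorem in the plane\<close>

lemma deriv_deriv_eq_log_deriv:
  assumes "entire f" "f z \<noteq> 0"
  shows "deriv (deriv f) z = f z * (deriv (log_deriv f) z + (log_deriv f z)\<^sup>2)"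
proof -
  have "(log_deriv f has_field_derivative (deriv (deriv f) z * f z - deriv f z * deriv f z) / (f z * f z)) (at z)"
    by (rule DERIV_divide entire_deriv entire_holomorphic_deriv assms)+
  then have "deriv (log_deriv f) z = (deriv (deriv f) z * f z - deriv f z * deriv f z) / (f z * f z)"
    by (rule DERIV_imp_deriv)
  then show ?thesis using assms(2) by (simp add: power2_eq_square field_simps)
qed

text \<open>Divided by f1 f2 f3, the Wronskian is a polynomial in differences of the logarithmic
  derivatives and of their derivatives. Its three terms have total weight 3 when a derivative counts
  twice, hence 3 g^3.\<close>

lemma norm_wr3_le:
  assumes hol: "entire f1" "entire f2" "entire f3"
    and nz: "f1 z \<noteq> 0" "f2 z \<noteq> 0" "f3 z \<noteq> 0"
    and ld: "norm (log_deriv f1 z - log_deriv f3 z) \<le> g" "norm (log_deriv f2 z - log_deriv f3 z) \<le> g"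
       "norm (log_deriv f2 z - log_deriv f1 z) \<le> g"
    and ld2: "norm (deriv (log_deriv f1) z - deriv (log_deriv f3) z) \<le> g\<^sup>2"
      "norm (deriv (log_deriv f2) z - deriv (log_deriv f3) z) \<le> g\<^sup>2"
  shows "norm (wr3 f1 f2 f3 z) \<le> 3 * g ^ 3 * norm (f1 z * f2 z * f3 z)"
proof -
  define l1 l2 l3 where "l1 = log_deriv f1 z" and "l2 = log_deriv f2 z" and "l3 = log_deriv f3 z"
  define m1 m2 m3 where "m1 = deriv (log_deriv f1) z" and "m2 = deriv (log_deriv f2) z" and "m3 = deriv (log_deriv f3) z"
  have d: "deriv f1 z = f1 z * l1" "deriv f2 z = f2 z * l2" "deriv f3 z = f3 z * l3"
    using nz by (simp_all add: l1_def l2_def l3_def)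
  have dd: "deriv (deriv f1) z = f1 z * (m1 + l1\<^sup>2)" "deriv (deriv f2) z = f2 z * (m2 + l2\<^sup>2)" 
    "deriv (deriv f3) z = f3 z * (m3 + l3\<^sup>2)"
    unfolding l1_def l2_def l3_def m1_def m2_def m3_def by (intro deriv_deriv_eq_log_deriv hol nz)+
  have e: "wr3 f1 f2 f3 z = (f1 z * f2 z * f3 z) *
     ((l1 - l3) * (m2 - m3) - (l2 - l3) * (m1 - m3) + (l1 - l3) * (l2 - l3) * (l2 - l1))"
    unfolding wr3_def d dd by (simp add: algebra_simps power2_eq_square)
  have g0: "g \<ge> 0" using ld(1) norm_ge_zero order_trans by blast
  have "norm ((l1 - l3) * (m2 - m3) - (l2 - l3) * (m1 - m3) + (l1 - l3) * (l2 - l3) * (l2 - l1))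
     \<le> norm (l1 - l3) * norm (m2 - m3) + norm (l2 - l3) * norm (m1 - m3) + norm (l1 - l3) * norm (l2 - l3) * norm (l2 - l1)"
    by (metis (no_types) norm_mult norm_triangle_ineq4 norm_triangle_le add_right_mono)
  also have "\<dots> \<le> g * g\<^sup>2 + g * g\<^sup>2 + g * g * g"
    using ld ld2 g0 unfolding l1_def[symmetric] l2_def[symmetric] l3_def[symmetric] m1_def[symmetric] m2_def[symmetric] m3_def[symmetric]
    by (intro add_mono mult_mono) auto
  also have "\<dots> = 3 * g ^ 3" by (simp add: power2_eq_square power3_eq_cube)
  finally have "norm (f1 z * f2 z * f3 z) * norm ((l1 - l3) * (m2 - m3) - (l2 - l3) * (m1 - m3) + (l1 - l3) * (l2 - l3) * (l2 - l1)) \<le> norm (f1 z * f2 z * f3 z) * (3 * g ^ 3)"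
    by (intro mult_left_mono) auto
  then show ?thesis unfolding e norm_mult[of "f1 z * f2 z * f3 z"] by (simp add: mult_ac)
qed

lemma wr2_eq_zero_imp:
  assumes f: "entire f" "f w \<noteq> 0" and g: "entire g"
    and W: "\<And>z. wr2 f g z = 0"
  shows "\<exists>c. \<forall>z. g z = c * f z"
proof -
  have "open {z. f z \<noteq> 0}"
    using holomorphic_on_imp_continuous_on[OF f(1)] by (intro open_Collect_neq) auto
  then obtain d where d: "d > 0" "ball w d \<subseteq> {z. f z \<noteq> 0}" using f(2) by (metis mem_Collect_eq openE)
  have "((\<lambda>z. g z / f z) has_field_derivative 0) (at x within ball w d)" if x: "x \<in> ball w d" for x
  proof -
    have nz: "f x \<noteq> 0" using d x by auto
    have "((\<lambda>z. g z / f z) has_field_derivative (deriv g x * f x - g x * deriv f x) / (f x * f x)) (at x)"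
      by (rule DERIV_divide entire_deriv f(1) g nz)+
    also have "deriv g x * f x - g x * deriv f x = wr2 f g x" by (simp add: wr2_def mult.commute)
    finally have "((\<lambda>z. g z / f z) has_field_derivative 0) (at x)" by (simp add: W)
    then show ?thesis by (rule has_field_derivative_at_within)
  qed
  then have "\<exists>c. \<forall>x\<in>ball w d. g x / f x = c"
    using has_field_derivative_zero_constant[OF convex_ball] by blast
  then obtain c where c: "\<And>x. x \<in> ball w d \<Longrightarrow> g x / f x = c" by blast
  have "g z = c * f z" for z
  proof (rule analytic_continuation_open[of "ball w d" UNIV g "\<lambda>z. c * f z"])
    show "g z = c * f z" if "z \<in> ball w d" for z
    proof -
      have "f z \<noteq> 0" using d(2) that by blast
      then show ?thesis using c[OF that] by (simp add: field_simps)
    qed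
  qed (use d f g in \<open>auto intro!: holomorphic_intros\<close>)
  then show ?thesis by blast
qed

text \<open>The coefficients are given by Cramer's rule as \<open>wr2 h g / wr2 f g\<close> and
  \<open>wr2 f h / wr2 f g\<close>. The numerators of their derivatives are multiples of
  \<open>wr3 f g h\<close>, so they are constant near w, and analytic continuation does the
  rest.\<close>

lemma wr3_eq_zero_imp:
  assumes f: "entire f" and g: "entire g" and h: "entire h"
    and w: "wr2 f g w \<noteq> 0" and W: "\<And>z. wr3 f g h z = 0"
  shows "\<exists>a b. \<forall>z. h z = a * f z + b * g z"
proof -
  have "open {z. wr2 f g z \<noteq> 0}"
    using holomorphic_on_imp_continuous_on[OF holomorphic_wr2[OF f g]] by (intro open_Collect_neq) auto
  then obtain d where d: "d > 0" "ball w d \<subseteq> {z. wr2 f g z \<noteq> 0}" using w by (metis mem_Collect_eq openE)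
  have dw: "(wr2 p q has_field_derivative p x * deriv (deriv q) x - deriv (deriv p) x * q x) (at x)"
    if "entire p" "entire q" for p q x
  proof -
    have "((\<lambda>z. p z * deriv q z - deriv p z * q z) has_field_derivative
        (deriv p x * deriv q x + deriv (deriv q) x * p x) - (deriv (deriv p) x * q x + deriv q x * deriv p x)) (at x)"
      by (rule DERIV_diff DERIV_mult entire_deriv entire_holomorphic_deriv that)+
    then show ?thesis unfolding wr2_def by (simp add: algebra_simps)
  qed
  have const: "\<exists>c. \<forall>x\<in>ball w d. wr2 p q x / wr2 f g x = c"
    if p: "entire p" "entire q" 
      and num: "\<And>x. (p x * deriv (deriv q) x - deriv (deriv p) x * q x) * wr2 f g x
         - wr2 p q x * (f x * deriv (deriv g) x - deriv (deriv f) x * g x) = 0" for p q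
  proof -
    have "((\<lambda>z. wr2 p q z / wr2 f g z) has_field_derivative 0) (at x within ball w d)" if x: "x \<in> ball w d" for x
    proof -
      have nz: "wr2 f g x \<noteq> 0" using d x by auto
      have "((\<lambda>z. wr2 p q z / wr2 f g z) has_field_derivative 0 / (wr2 f g x * wr2 f g x)) (at x)"
        unfolding num[of x, symmetric] by (rule DERIV_divide dw p f g nz)+
      then show ?thesis by (simp add: has_field_derivative_at_within)
    qed
    then show ?thesis using has_field_derivative_zero_constant[OF convex_ball] by blast
  qed
  have W': "f x * (deriv g x * deriv (deriv h) x - deriv (deriv g) x * deriv h x)
     - g x * (deriv f x * deriv (deriv h) x - deriv (deriv f) x * deriv h x)
     + h x * (deriv f x * deriv (deriv g) x - deriv (deriv f) x * deriv g x) = 0" for x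
    using W[of x] by (simp add: wr3_def)
  have "\<exists>a. \<forall>x\<in>ball w d. wr2 h g x / wr2 f g x = a"
  proof (rule const[OF h g])
    fix x
    have "(h x * deriv (deriv g) x - deriv (deriv h) x * g x) * wr2 f g x
         - wr2 h g x * (f x * deriv (deriv g) x - deriv (deriv f) x * g x) = - g x * wr3 f g h x"
      unfolding wr2_def wr3_def by (simp add: algebra_simps)
    then show "(h x * deriv (deriv g) x - deriv (deriv h) x * g x) * wr2 f g x
         - wr2 h g x * (f x * deriv (deriv g) x - deriv (deriv f) x * g x) = 0" by (simp add: W)
  qed
  then obtain a where a: "\<And>x. x \<in> ball w d \<Longrightarrow> wr2 h g x / wr2 f g x = a" by blast
  have "\<exists>b. \<forall>x\<in>ball w d. wr2 f h x / wr2 f g x = b"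
  proof (rule const[OF f h])
    fix x
    have "(f x * deriv (deriv h) x - deriv (deriv f) x * h x) * wr2 f g x
         - wr2 f h x * (f x * deriv (deriv g) x - deriv (deriv f) x * g x) = f x * wr3 f g h x"
      unfolding wr2_def wr3_def by (simp add: algebra_simps)
    then show "(f x * deriv (deriv h) x - deriv (deriv f) x * h x) * wr2 f g x
         - wr2 f h x * (f x * deriv (deriv g) x - deriv (deriv f) x * g x) = 0" by (simp add: W)
  qed
  then obtain b where b: "\<And>x. x \<in> ball w d \<Longrightarrow> wr2 f h x / wr2 f g x = b" by blast
  have "h z = a * f z + b * g z" for z
  proof (rule analytic_continuation_open[of "ball w d" UNIV h "\<lambda>z. a * f z + b * g z"])
    fix z assume z: "z \<in> ball w d"
    have nz: "wr2 f g z \<noteq> 0" using d z by auto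
    have "wr2 h g z = a * wr2 f g z" "wr2 f h z = b * wr2 f g z" using a[OF z] b[OF z] nz by (auto simp: field_simps)
    moreover have "wr2 h g z * f z + wr2 f h z * g z = h z * wr2 f g z" by (simp add: wr2_def algebra_simps)
    ultimately have "wr2 f g z * (a * f z + b * g z) = wr2 f g z * h z" by (simp add: algebra_simps)
    then show "h z = a * f z + b * g z" using nz by simp
  qed (use d f g h in \<open>auto intro!: holomorphic_intros\<close>)
  then show ?thesis by blast
qed

text \<open>Linear operations on the columns of the determinant. Up to sign the same Wronskian
  arises whichever of the four functions is omitted, so it can be estimated and factored with any
  three of them.\<close>

lemma wr3_sum_zero:
  assumes hol: "entire B1" "entire B2" "entire B3"
    and sum0: "\<And>z. B1 z + B2 z + B3 z + B4 z = 0"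
  shows "wr3 B1 B2 B4 z = - wr3 B1 B2 B3 z" "wr3 B1 B3 B4 z = wr3 B1 B2 B3 z" "wr3 B2 B3 B4 z = - wr3 B1 B2 B3 z"
proof -
  have B4: "B4 z = - (B1 z + B2 z + B3 z)" for z using sum0[of z] unfolding eq_neg_iff_add_eq_0 by (simp add: add_ac)
  have d4: "deriv B4 z = - (deriv B1 z + deriv B2 z + deriv B3 z)" for z
  proof -
    have "((\<lambda>z. - (B1 z + B2 z + B3 z)) has_field_derivative - (deriv B1 z + deriv B2 z + deriv B3 z)) (at z)"
      by (rule DERIV_minus DERIV_add entire_deriv hol)+
    then show ?thesis unfolding B4[abs_def] by (rule DERIV_imp_deriv)
  qed
  have dd4: "deriv (deriv B4) z = - (deriv (deriv B1) z + deriv (deriv B2) z + deriv (deriv B3) z)" for z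
  proof -
    have "((\<lambda>z. - (deriv B1 z + deriv B2 z + deriv B3 z)) has_field_derivative - (deriv (deriv B1) z + deriv (deriv B2) z + deriv (deriv B3) z)) (at z)"
      by (rule DERIV_minus DERIV_add entire_deriv entire_holomorphic_deriv hol)+
    moreover have "deriv B4 = (\<lambda>z. - (deriv B1 z + deriv B2 z + deriv B3 z))" using d4 by auto
    ultimately show ?thesis by (simp add: DERIV_imp_deriv)
  qed
  show "wr3 B1 B2 B4 z = - wr3 B1 B2 B3 z" "wr3 B1 B3 B4 z = wr3 B1 B2 B3 z" "wr3 B2 B3 B4 z = - wr3 B1 B2 B3 z"
    unfolding wr3_def d4 dd4 unfolding B4 by (simp_all add: algebra_simps)
qed

text \<open>Omitting each B_i in turn, |W| |B_i| \<le> 3 g^3 |B1 B2 B3 B4|; summation bounds |W|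
  (|B1| + ... + |B4|) by 12 g^3 |B1 B2 B3 B4|. Truncation is encoded in \<open>s\<close>, which
  divides W^k: what the k-th power of the product retains beyond \<open>s\<close> may cost the
  exponent \<open>\<kappa>\<close> < k, so a positive power of the sum survives.\<close>

theorem Cartan_plane:
  fixes B1 B2 B3 B4 :: "complex \<Rightarrow> complex"
  assumes hol: "entire B1" "entire B2" "entire B3" "entire B4"
    and sum0: "\<And>z. B1 z + B2 z + B3 z + B4 z = 0"
    and W: "wr3 B1 B2 B3 w \<noteq> 0"
    and s: "entire s" "entire U" "\<And>z. wr3 B1 B2 B3 z ^ k = s z * U z"
    and \<kappa>: "\<kappa> < k"
    and bound: "\<And>z. norm (B1 z * B2 z * B3 z * B4 z) ^ k \<le>
       C * norm (s z) * (norm (B1 z) + norm (B2 z) + norm (B3 z) + norm (B4 z)) ^ \<kappa>"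
  shows False
proof -
  note w124 = wr3_sum_zero(1)[OF hol(1-3) sum0] and w134 = wr3_sum_zero(2)[OF hol(1-3) sum0]
    and w234 = wr3_sum_zero(3)[OF hol(1-3) sum0]
  define A where "A = {B1, B2, B3, B4}"
  define M where "M = (\<lambda>z. \<Sum>p\<in>A. norm (p z))"
  define m where "m = (\<lambda>z. norm (B1 z) + norm (B2 z) + norm (B3 z) + norm (B4 z))"
  have Bm: "norm (p z) \<le> M z" if "p \<in> A" for p z
    unfolding M_def using that by (intro member_le_sum[of p A "\<lambda>p. norm (p z)"]) (auto simp: A_def)
  have Mm: "M z \<le> m z" for z
  proof -
    have "M z \<le> (\<Sum>p\<leftarrow>[B1, B2, B3, B4]. norm (p z))"
    proof -
      have "(\<Sum>p\<in>set xs. norm (p z)) \<le> (\<Sum>p\<leftarrow>xs. norm (p z))" for xs :: "(complex \<Rightarrow> complex) list"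
        by (induction xs) (auto simp: sum.insert_if add_increasing)
      from this[of "[B1, B2, B3, B4]"] show ?thesis by (simp add: M_def A_def)
    qed
    then show ?thesis by (simp add: m_def)
  qed
  have nz: "\<exists>w. p w \<noteq> 0" if "p \<in> A" for p
  proof (rule ccontr)
    assume "\<not> ?thesis"
    then have p: "p = (\<lambda>_. 0)" by auto
    have "wr3 B1 B2 B3 w = 0"
      using that w124[of w] w134[of w] w234[of w] unfolding A_def p by (auto simp: wr3_def)
    then show False using W by simp
  qed
  obtain L where L: "entire L" "L w = 0" "\<exists>w'. L w' \<noteq> 0" "\<exists>C1. \<forall>z. norm (L z) \<le> C1 * M z"
  proof (cases "B1 w = 0")
    case True
    show thesis
    proof (rule that[of B1])
      show "\<exists>C1. \<forall>z. norm (B1 z) \<le> C1 * M z" by (intro exI[of _ 1]) (use Bm[of B1] in \<open>auto simp: A_def\<close>)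
    qed (use True hol nz[of B1] in \<open>auto simp: A_def\<close>)
  next
    case False
    \<comment> \<open>If this combination vanished identically, B2 would be a multiple of B1 and the
      Wronskian at w would be zero.\<close>
    define L where "L = (\<lambda>z. B2 w * B1 z + (- B1 w) * B2 z)"
    show thesis
    proof (rule that[of L])
      show "entire L" unfolding L_def by (intro holomorphic_intros hol)
      show "L w = 0" by (simp add: L_def)
      show "\<exists>w'. L w' \<noteq> 0"
      proof (rule ccontr)
        assume "\<not> ?thesis"
        then have "B2 z = (B2 w / B1 w) * B1 z + 0 * B1 z" for z using False by (simp add: L_def field_simps)
        then have e: "B2 = (\<lambda>z. (B2 w / B1 w) * B1 z + 0 * B1 z)" by blast
        have d: "deriv B2 = (\<lambda>z. (B2 w / B1 w) * deriv B1 z + 0 * deriv B1 z)"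
          by (subst e, rule deriv_lincomb) (use hol in auto)
        have dd: "deriv (deriv B2) = (\<lambda>z. (B2 w / B1 w) * deriv (deriv B1) z + 0 * deriv (deriv B1) z)"
          by (subst d, rule deriv_lincomb) (use hol entire_holomorphic_deriv in auto)
        define t where "t = B2 w / B1 w"
        have "B2 w = t * B1 w" "deriv B2 w = t * deriv B1 w" "deriv (deriv B2) w = t * deriv (deriv B1) w"
          using False fun_cong[OF d, of w] fun_cong[OF dd, of w] by (simp_all add: t_def)
        then have "wr3 B1 B2 B3 w = 0" unfolding wr3_def by (simp add: algebra_simps)
        then show False using W by simp
      qed
      have "norm (L z) \<le> (norm (B2 w) + norm (B1 w)) * M z" for z
      proof -
        have "norm (L z) \<le> norm (B2 w) * norm (B1 z) + norm (B1 w) * norm (B2 z)"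
          unfolding L_def by (metis norm_minus_cancel norm_mult norm_triangle_ineq)
        also have "\<dots> \<le> norm (B2 w) * M z + norm (B1 w) * M z"
          by (intro add_mono mult_left_mono Bm) (auto simp: A_def)
        finally show ?thesis by (simp add: distrib_right)
      qed
      then show "\<exists>C1. \<forall>z. norm (L z) \<le> C1 * M z" by blast
    qed
  qed
  then obtain w' C1 where L': "L w' \<noteq> 0" "\<And>z. norm (L z) \<le> C1 * M z" by blast
  define d where "d = k - \<kappa>"
  have d: "d \<ge> 1" "k = d + \<kappa>" using \<kappa> by (auto simp: d_def)
  show False
  proof (rule Nevanlinna_core[of A s U w L w' w C1 d "12 ^ k * \<bar>C\<bar>" "3 * k"])
    show "finite A" "A \<noteq> {}" by (auto simp: A_def)
    show "entire p \<and> (\<exists>w. p w \<noteq> 0)" if "p \<in> A" for p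
      using that hol nz[OF that] by (auto simp: A_def)
    show "s w * U w \<noteq> 0" using s(3)[of w] W by (metis power_not_zero)
    show "norm (L z) \<le> C1 * (\<Sum>p\<in>A. norm (p z))" for z using L' by (simp add: M_def)
    fix z g
    assume g: "(1::real) \<le> g" and nzz: "\<And>p. p \<in> A \<Longrightarrow> p z \<noteq> 0"
      and ld: "\<And>p q. p \<in> A \<Longrightarrow> q \<in> A \<Longrightarrow> norm (log_deriv p z - log_deriv q z) \<le> g"
      and ld2: "\<And>p q. p \<in> A \<Longrightarrow> q \<in> A \<Longrightarrow> norm (deriv (log_deriv p) z - deriv (log_deriv q) z) \<le> g\<^sup>2"
    define P where "P = norm (B1 z * B2 z * B3 z * B4 z)"
    have w3: "norm (wr3 p q r z) \<le> 3 * g ^ 3 * norm (p z * q z * r z)" if "p \<in> A" "q \<in> A" "r \<in> A" for p q r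
      using that by (intro norm_wr3_le nzz ld ld2) (use hol in \<open>auto simp: A_def\<close>)
    have inA: "B1 \<in> A" "B2 \<in> A" "B3 \<in> A" "B4 \<in> A" by (auto simp: A_def)
    have each: "norm (wr3 B1 B2 B3 z) * norm (p z) \<le> 3 * g ^ 3 * P"
      if "norm (wr3 B1 B2 B3 z) \<le> 3 * g ^ 3 * Q" "Q * norm (p z) = P" for p and Q :: real
    proof -
      have "norm (wr3 B1 B2 B3 z) * norm (p z) \<le> (3 * g ^ 3 * Q) * norm (p z)" using that(1) by (rule mult_right_mono) auto
      then show ?thesis using that(2) by (simp add: mult.assoc)
    qed
    have "norm (wr3 B1 B2 B3 z) * m z \<le> 4 * (3 * g ^ 3 * P)"
    proof -
      have "norm (wr3 B1 B2 B3 z) * norm (B4 z) \<le> 3 * g ^ 3 * P"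
        by (rule each[OF w3[OF inA(1-3)]]) (simp add: P_def norm_mult)
      moreover have "norm (wr3 B1 B2 B3 z) * norm (B3 z) \<le> 3 * g ^ 3 * P"
        by (rule each[of "norm (B1 z * B2 z * B4 z)"]) (use w3[OF inA(1,2,4)] in \<open>simp_all add: P_def norm_mult w124\<close>)
      moreover have "norm (wr3 B1 B2 B3 z) * norm (B2 z) \<le> 3 * g ^ 3 * P"
        by (rule each[of "norm (B1 z * B3 z * B4 z)"]) (use w3[OF inA(1,3,4)] in \<open>simp_all add: P_def norm_mult w134\<close>)
      moreover have "norm (wr3 B1 B2 B3 z) * norm (B1 z) \<le> 3 * g ^ 3 * P"
        by (rule each[of "norm (B2 z * B3 z * B4 z)"]) (use w3[OF inA(2,3,4)] in \<open>simp_all add: P_def norm_mult w234\<close>)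
      ultimately show ?thesis unfolding m_def distrib_left by linarith
    qed
    then have "(norm (wr3 B1 B2 B3 z) * m z) ^ k \<le> (4 * (3 * g ^ 3 * P)) ^ k"
      by (intro power_mono) (auto simp: m_def)
    moreover have "norm (s z * U z) = norm (wr3 B1 B2 B3 z) ^ k" by (simp only: s(3)[symmetric] norm_power)
    moreover have "4 * (3 * g ^ 3 * P) = 12 * g ^ 3 * P" by simp
    ultimately have "norm (s z * U z) * m z ^ k \<le> 12 ^ k * g ^ (3 * k) * P ^ k"
      by (simp only: power_mult_distrib power_mult[symmetric])
    also have "\<dots> \<le> 12 ^ k * g ^ (3 * k) * (C * norm (s z) * m z ^ \<kappa>)"
      using bound[of z] g unfolding P_def m_def by (intro mult_left_mono) auto
    also have "\<dots> \<le> 12 ^ k * g ^ (3 * k) * (\<bar>C\<bar> * norm (s z) * m z ^ \<kappa>)"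
      using g by (intro mult_left_mono mult_right_mono) (auto simp: m_def)
    finally have "m z ^ \<kappa> * (norm (s z * U z) * m z ^ d) \<le> m z ^ \<kappa> * (12 ^ k * \<bar>C\<bar> * norm (s z) * g ^ (3 * k))"
      unfolding d(2) by (simp add: power_add mult_ac)
    moreover have "norm (B1 z) > 0" using nzz inA by auto
    then have "m z > 0" unfolding m_def by (smt (verit) norm_ge_zero)
    ultimately have "norm (s z * U z) * m z ^ d \<le> 12 ^ k * \<bar>C\<bar> * norm (s z) * g ^ (3 * k)"
      by (simp add: mult_le_cancel_left_pos)
    moreover have "norm (s z * U z) * M z ^ d \<le> norm (s z * U z) * m z ^ d"
      by (intro mult_left_mono power_mono Mm) (auto simp: M_def sum_nonneg)
    ultimately show "norm (s z * U z) * (\<Sum>p\<in>A. norm (p z)) ^ d \<le> 12 ^ k * \<bar>C\<bar> * norm (s z) * g ^ (3 * k)"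
      by (simp add: M_def)
  qed (use s(1,2) L L' d in auto)
qed

section \<open>Orders of vanishing and ramification\<close>

text \<open>If i < j, cancelling (w - z)^i shows that A tends to 0 at z. Multiplicities of the two
  sides of an identity are compared in this way.\<close>

lemma power_factor_unique:
  fixes A B :: "complex \<Rightarrow> complex"
  assumes ev: "eventually (\<lambda>w. (w - z) ^ i * A w = (w - z) ^ j * B w) (at z)"
    and "isCont A z" "isCont B z" "A z \<noteq> 0" "B z \<noteq> 0"
  shows "i = j"
proof -
  have *: False if lt: "i < j" and ev: "eventually (\<lambda>w. (w - z) ^ i * A w = (w - z) ^ j * B w) (at z)"
    and c: "isCont A z" "isCont B z" "A z \<noteq> 0" for A B :: "complex \<Rightarrow> complex" and i j
  proof -
    have "eventually (\<lambda>w. w \<noteq> z) (at z)" by (simp add: eventually_at_filter)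
    with ev have "eventually (\<lambda>w. (w - z) ^ (j - i) * B w = A w) (at z)"
    proof eventually_elim
      case (elim w)
      have "(w - z) ^ i * ((w - z) ^ (j - i) * B w) = (w - z) ^ i * A w"
        using elim(1) lt by (simp add: power_add[symmetric] mult.assoc[symmetric])
      then show ?case using elim(2) by simp
    qed
    moreover have "((\<lambda>w. (w - z) ^ (j - i) * B w) \<longlongrightarrow> (z - z) ^ (j - i) * B z) (at z)"
      using c(2) by (intro tendsto_intros isContD)
    ultimately have "(A \<longlongrightarrow> (z - z) ^ (j - i) * B z) (at z)" by (rule Lim_transform_eventually[rotated])
    moreover have "(A \<longlongrightarrow> A z) (at z)" using c(1) by (rule isContD)
    ultimately have "A z = (z - z) ^ (j - i) * B z" using tendsto_unique[OF at_neq_bot] by blast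
    then show False using c(3) lt by simp
  qed
  have "eventually (\<lambda>w. (w - z) ^ j * B w = (w - z) ^ i * A w) (at z)"
    using ev by eventually_elim simp
  then show ?thesis using *[of i j A B] *[of j i B A] assms by (meson linorder_neqE_nat)
qed

text \<open>A zero of order m of L gives the Wronskian order at least m - 1. Thus its k-th power has
  order at least k (m - 1) \<ge> r m, the order of L^r. The quotient r/k stands for the ramification
  weight 1 - 1/m; u^r is the local cofactor.\<close>

lemma ramified_power_divides:
  assumes f: "entire f" and L: "entire L"
    and u: "entire u" "\<And>w. L w = (w - z) ^ m * u w" and m: "r * m \<le> k * (m - 1)"
  shows "\<exists>v. entire v \<and> (\<forall>w. wr2 f L w ^ k * u w ^ r = L w ^ r * v w)"
proof (cases "m = 0")
  case True
  then have "L = u" using u(2) by auto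
  then show ?thesis 
    by (intro exI[of _ "\<lambda>w. wr2 f L w ^ k"]) (auto intro!: holomorphic_intros holomorphic_wr2 f u(1))
next
  case False
  then obtain l where l: "m = Suc l" by (cases m) auto
  define v0 where "v0 = (\<lambda>w. f w * (of_nat m * u w + (w - z) * deriv u w) - deriv f w * (w - z) * u w)"
  have v0: "entire v0" unfolding v0_def
    by (intro holomorphic_intros f u(1) entire_holomorphic_deriv)
  have dL: "deriv L w = (w - z) ^ l * (of_nat m * u w + (w - z) * deriv u w)" for w
  proof -
    have "((\<lambda>w. (w - z) ^ m) has_field_derivative of_nat m * (w - z) ^ l) (at w)"
      unfolding l
      by (rule DERIV_cong[OF DERIV_power_Suc[where f = "\<lambda>w. w - z" and D = 1]]) (auto intro!: derivative_eq_intros)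
    from DERIV_mult[OF this entire_deriv[OF u(1)]]
    have "((\<lambda>w. (w - z) ^ m * u w) has_field_derivative of_nat m * (w - z) ^ l * u w + deriv u w * (w - z) ^ m) (at w)" .
    also have "of_nat m * (w - z) ^ l * u w + deriv u w * (w - z) ^ m = (w - z) ^ l * (of_nat m * u w + (w - z) * deriv u w)"
      unfolding l by (simp add: algebra_simps)
    also have "(\<lambda>w. (w - z) ^ m * u w) = L" using u(2) by auto
    finally show ?thesis by (rule DERIV_imp_deriv)
  qed
  have W: "wr2 f L w = (w - z) ^ l * v0 w" for w
    unfolding wr2_def dL u(2) v0_def unfolding l by (simp add: algebra_simps)
  have "wr2 f L w ^ k * u w ^ r = L w ^ r * ((w - z) ^ (k * l - r * m) * v0 w ^ k)" for w
  proof -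
    have "k * l = r * m + (k * l - r * m)" using m l by simp
    then have "(w - z) ^ (k * l) = (w - z) ^ (r * m) * (w - z) ^ (k * l - r * m)"
      by (metis power_add)
    moreover have "wr2 f L w ^ k = (w - z) ^ (k * l) * v0 w ^ k"
      unfolding W by (simp add: power_mult_distrib power_mult[symmetric] mult.commute)
    moreover have "L w ^ r = (w - z) ^ (r * m) * u w ^ r"
      unfolding u(2) by (simp add: power_mult_distrib power_mult[symmetric] mult.commute)
    ultimately show ?thesis by simp
  qed
  then show ?thesis using v0 by (intro exI[of _ "\<lambda>w. (w - z) ^ (k * l - r * m) * v0 w ^ k"]) (auto intro!: holomorphic_intros)
qed

section \<open>The Frank--Reinders polynomial\<close>

text \<open>With \<open>n = N + 3\<close>, \<open>FR N x0 x1\<close> is the homogenised Frank--Reinders polynomial without its constant term.\<close>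

definition FRQ :: "nat \<Rightarrow> complex \<Rightarrow> complex \<Rightarrow> complex" where
  "FRQ N x0 x1 = of_nat ((N + 2) * (N + 1)) / 2 * x1\<^sup>2 - of_nat ((N + 3) * (N + 1)) * x1 * x0 + of_nat ((N + 3) * (N + 2)) / 2 * x0\<^sup>2"

definition FR :: "nat \<Rightarrow> complex \<Rightarrow> complex \<Rightarrow> complex" where
  "FR N x0 x1 = x1 ^ (N + 1) * FRQ N x0 x1"

lemma holomorphic_FR:
  "entire f0 \<Longrightarrow> entire f1 \<Longrightarrow> entire (\<lambda>z. FRQ N (f0 z) (f1 z))"
  "entire f0 \<Longrightarrow> entire f1 \<Longrightarrow> entire (\<lambda>z. FR N (f0 z) (f1 z))"
  unfolding FR_def FRQ_def by (auto intro!: holomorphic_intros)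

text \<open>The homogeneous form of P' = n(n-1)(n-2)/2 z^(n-3) (z-1)^2 with n = N + 3.\<close>

lemma wr2_FR:
  assumes "entire f0" "entire f1"
  shows "wr2 (\<lambda>z. FR N (f0 z) (f1 z)) (\<lambda>z. f0 z ^ (N + 3)) z =
     f0 z ^ (N + 2) * f1 z ^ N * (- of_nat ((N + 3) * (N + 2) * (N + 1)) / 2 * (f1 z - f0 z)\<^sup>2 * wr2 f0 f1 z)"
proof -
  have dp: "((\<lambda>z. f z ^ Suc k) has_field_derivative of_nat (Suc k) * f z ^ k * deriv f z) (at z)"
    if "entire f" for f k
    by (rule DERIV_cong[OF DERIV_power_Suc[OF entire_deriv[OF that]]]) simp
  have dQ: "((\<lambda>z. FRQ N (f0 z) (f1 z)) has_field_derivative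
     (of_nat ((N + 2) * (N + 1)) / 2 * (2 * f1 z * deriv f1 z)
       - of_nat ((N + 3) * (N + 1)) * (deriv f1 z * f0 z + f1 z * deriv f0 z)
       + of_nat ((N + 3) * (N + 2)) / 2 * (2 * f0 z * deriv f0 z))) (at z)"
    unfolding FRQ_def
    by (auto intro!: derivative_eq_intros entire_deriv assms) (simp add: algebra_simps)
  have d: "((\<lambda>z. FR N (f0 z) (f1 z)) has_field_derivative
     (of_nat (N + 1) * f1 z ^ N * deriv f1 z) * FRQ N (f0 z) (f1 z) +
     (of_nat ((N + 2) * (N + 1)) / 2 * (2 * f1 z * deriv f1 z)
       - of_nat ((N + 3) * (N + 1)) * (deriv f1 z * f0 z + f1 z * deriv f0 z)
       + of_nat ((N + 3) * (N + 2)) / 2 * (2 * f0 z * deriv f0 z)) * f1 z ^ (N + 1)) (at z)"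
    unfolding FR_def using DERIV_mult[OF dp[OF assms(2), of N] dQ] by simp
  have d2: "((\<lambda>z. f0 z ^ (N + 3)) has_field_derivative of_nat (N + 3) * f0 z ^ (N + 2) * deriv f0 z) (at z)"
    using dp[OF assms(1), of "N + 2"] by (simp add: numeral_3_eq_3)
  define x y x' y' F G where "x = f0 z" and "y = f1 z" and "x' = deriv f0 z" and "y' = deriv f1 z" 
    and "F = f0 z ^ N" and "G = f1 z ^ N"
  define t :: complex where "t = of_nat N"
  have e: "f0 z ^ (N + 3) = F * x ^ 3" "f0 z ^ (N + 2) = F * x ^ 2" "f1 z ^ (N + 1) = G * y"
    by (simp_all add: F_def G_def x_def y_def power_add power2_eq_square power3_eq_cube)
  have c: "of_nat (N + 1) = t + 1" "of_nat (N + 3) = t + 3" "of_nat ((N + 2) * (N + 1)) = (t + 2) * (t + 1)"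
    "of_nat ((N + 3) * (N + 1)) = (t + 3) * (t + 1)" "of_nat ((N + 3) * (N + 2)) = (t + 3) * (t + 2)"
    "of_nat ((N + 3) * (N + 2) * (N + 1)) = (t + 3) * (t + 2) * (t + 1)"
    by (simp_all add: t_def algebra_simps)
  show ?thesis
    unfolding wr2_def DERIV_imp_deriv[OF d] DERIV_imp_deriv[OF d2] unfolding FR_def FRQ_def e c
    unfolding F_def[symmetric] G_def[symmetric]
    unfolding x_def[symmetric] y_def[symmetric] x'_def[symmetric] y'_def[symmetric]
    by (simp add: field_simps power2_eq_square power3_eq_cube)
qed

lemma FRQ_bound: "\<exists>C\<ge>0. \<forall>x0 x1. norm (FRQ N x0 x1) \<le> C * (norm x0 + norm x1)\<^sup>2"
proof -
  define A B D where "A = real ((N + 2) * (N + 1)) / 2" and "B = real ((N + 3) * (N + 1))" and "D = real ((N + 3) * (N + 2)) / 2"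
  have "norm (FRQ N x0 x1) \<le> (A + B + D) * (norm x0 + norm x1)\<^sup>2" for x0 x1
  proof -
    have "norm (FRQ N x0 x1) \<le> norm (of_nat ((N + 2) * (N + 1)) / 2 * x1\<^sup>2) + norm (of_nat ((N + 3) * (N + 1)) * x1 * x0) + norm (of_nat ((N + 3) * (N + 2)) / 2 * x0\<^sup>2)"
      unfolding FRQ_def by (rule norm_triangle_le[OF add_right_mono[OF norm_triangle_ineq4]])
    also have "\<dots> = A * (norm x1)\<^sup>2 + B * (norm x1 * norm x0) + D * (norm x0)\<^sup>2"
      unfolding norm_mult norm_divide norm_of_nat norm_power by (simp add: A_def B_def D_def mult.assoc)
    also have "\<dots> \<le> A * (norm x0 + norm x1)\<^sup>2 + B * (norm x0 + norm x1)\<^sup>2 + D * (norm x0 + norm x1)\<^sup>2"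
      by (intro add_mono mult_left_mono) (auto simp: A_def B_def D_def power2_sum)
    finally show ?thesis by (simp add: distrib_right)
  qed
  moreover have "A + B + D \<ge> 0" by (simp add: A_def B_def D_def)
  ultimately show ?thesis by blast
qed

text \<open>The converse of the trivial degree bound: the curve (A1 : A3) has N + 3 times the
  characteristic of (f0 : f1). Either x0 is not small against x1 and x0^(N+3) suffices, or the
  square of x1 dominates the quadratic form.\<close>

lemma FR_lower_bound: "\<exists>C\<ge>0. \<forall>x0 x1. (norm x0 + norm x1) ^ (N + 3) \<le> C * (norm (FR N x0 x1) + norm (x0 ^ (N + 3)))"
proof -
  define A B D where "A = real ((N + 2) * (N + 1)) / 2" and "B = real ((N + 3) * (N + 1))" and "D = real ((N + 3) * (N + 2)) / 2"
  have "2 \<le> (N + 2) * (N + 1)" by simp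
  then have "real ((N + 2) * (N + 1)) \<ge> 2" by (metis of_nat_le_iff of_nat_numeral)
  then have pos: "A \<ge> 1" "B > 0" "D > 0"
    unfolding A_def B_def D_def by (simp, simp_all only: of_nat_0_less_iff zero_less_divide_iff) simp_all
  \<comment> \<open>For |x1| > K |x0| the two lower terms of the quadratic form are together at most
    half of |x1|^2.\<close>
  define K where "K = 2 * (B + D) + 1"
  have K: "K \<ge> 1" using pos by (simp add: K_def)
  define C where "C = (1 + K) ^ (N + 3) + 2 * 2 ^ (N + 3)"
  have C: "C \<ge> 0" using K by (simp add: C_def)
  have "(norm x0 + norm x1) ^ (N + 3) \<le> C * (norm (FR N x0 x1) + norm (x0 ^ (N + 3)))" for x0 x1
  proof (cases "norm x1 \<le> K * norm x0")
    case True
    then have "norm x0 + norm x1 \<le> (1 + K) * norm x0" by (simp add: distrib_right)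
    then have "(norm x0 + norm x1) ^ (N + 3) \<le> ((1 + K) * norm x0) ^ (N + 3)" by (intro power_mono) auto
    also have "\<dots> = (1 + K) ^ (N + 3) * norm (x0 ^ (N + 3))" by (simp only: power_mult_distrib norm_power)
    also have "\<dots> \<le> C * (norm (FR N x0 x1) + norm (x0 ^ (N + 3)))"
      using K by (intro mult_mono) (auto simp: C_def)
    finally show ?thesis .
  next
    case False
    then have lt: "K * norm x0 < norm x1" by simp
    have le: "norm x0 \<le> norm x1" using lt K mult_right_mono[of 1 K "norm x0"] by simp
    have "A * (norm x1)\<^sup>2 = norm (of_nat ((N + 2) * (N + 1)) / 2 * x1\<^sup>2)"
      unfolding norm_mult norm_divide norm_of_nat norm_power by (simp add: A_def)
    also have "of_nat ((N + 2) * (N + 1)) / 2 * x1\<^sup>2 = FRQ N x0 x1 + (of_nat ((N + 3) * (N + 1)) * x1 * x0 - of_nat ((N + 3) * (N + 2)) / 2 * x0\<^sup>2)"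
      by (simp add: FRQ_def)
    also have "norm \<dots> \<le> norm (FRQ N x0 x1) + (norm (of_nat ((N + 3) * (N + 1)) * x1 * x0) + norm (of_nat ((N + 3) * (N + 2)) / 2 * x0\<^sup>2))"
      by (intro norm_triangle_le add_left_mono norm_triangle_ineq4)
    also have "norm (of_nat ((N + 3) * (N + 1)) * x1 * x0) + norm (of_nat ((N + 3) * (N + 2)) / 2 * x0\<^sup>2) = B * (norm x1 * norm x0) + D * (norm x0 * norm x0)"
      unfolding norm_mult norm_divide norm_of_nat norm_power by (simp add: B_def D_def power2_eq_square mult.assoc)
    also have "D * (norm x0 * norm x0) \<le> D * (norm x1 * norm x0)" using le pos by (intro mult_left_mono mult_right_mono) auto
    also have "B * (norm x1 * norm x0) + D * (norm x1 * norm x0) = (B + D) * norm x0 * norm x1" by (simp add: algebra_simps)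
    also have "(B + D) * norm x0 * norm x1 \<le> (norm x1 / 2) * norm x1"
    proof (rule mult_right_mono)
      have "2 * ((B + D) * norm x0) \<le> K * norm x0" by (simp add: K_def algebra_simps)
      then show "(B + D) * norm x0 \<le> norm x1 / 2" using lt by linarith
    qed auto
    finally have 1: "A * (norm x1)\<^sup>2 \<le> norm (FRQ N x0 x1) + (norm x1)\<^sup>2 / 2" by (simp add: power2_eq_square)
    have "1 * (norm x1)\<^sup>2 \<le> A * (norm x1)\<^sup>2" using pos by (intro mult_right_mono) auto
    with 1 have 2: "(norm x1)\<^sup>2 \<le> 2 * norm (FRQ N x0 x1)" by simp
    have "(norm x0 + norm x1) ^ (N + 3) \<le> (2 * norm x1) ^ (N + 3)" using le by (intro power_mono) auto
    also have "\<dots> = 2 ^ (N + 3) * (norm x1 ^ (N + 1) * (norm x1)\<^sup>2)"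
      by (simp add: power_mult_distrib power_add[symmetric] numeral_3_eq_3)
    also have "\<dots> \<le> 2 ^ (N + 3) * (norm x1 ^ (N + 1) * (2 * norm (FRQ N x0 x1)))"
      by (intro mult_left_mono 2) auto
    also have "\<dots> = (2 * 2 ^ (N + 3)) * norm (FR N x0 x1)" by (simp add: FR_def norm_mult norm_power)
    also have "\<dots> \<le> C * (norm (FR N x0 x1) + norm (x0 ^ (N + 3)))"
      using K by (intro mult_mono) (auto simp: C_def)
    finally show ?thesis .
  qed
  then show ?thesis using C by blast
qed

section \<open>Truncated divisors of the Wronskian\<close>

lemma deriv_power_mult:
  assumes u: "entire u" and q: "entire q"
  obtains r where "entire r" "deriv (\<lambda>z. u z ^ Suc m * q z) = (\<lambda>z. u z ^ m * r z)"
proof (rule that)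
  let ?r = "\<lambda>z. of_nat (Suc m) * deriv u z * q z + u z * deriv q z"
  show "entire ?r" by (intro holomorphic_intros u q entire_holomorphic_deriv)
  have "((\<lambda>z. u z ^ Suc m * q z) has_field_derivative (1 + of_nat m) * (deriv u z * u z ^ m) * q z + deriv q z * u z ^ Suc m) (at z)" for z
    by (rule DERIV_mult DERIV_power_Suc entire_deriv u q)+
  then show "deriv (\<lambda>z. u z ^ Suc m * q z) = (\<lambda>z. u z ^ m * ?r z)"
    by (auto simp: fun_eq_iff algebra_simps dest!: DERIV_imp_deriv)
qed

text \<open>The function s divides every entry of the column (p, p', p'') of the Wronskian
  determinant and can be taken out of it.\<close>

definition triple_divides :: "(complex \<Rightarrow> complex) \<Rightarrow> (complex \<Rightarrow> complex) \<Rightarrow> bool" where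
  "triple_divides s p \<longleftrightarrow> (\<exists>t0 t1 t2. entire t0 \<and> entire t1 \<and> entire t2 \<and>
     (\<forall>z. p z = s z * t0 z \<and> deriv p z = s z * t1 z \<and> deriv (deriv p) z = s z * t2 z))"

text \<open>Each derivative lowers the exponent of u by at most one, so of u^(m+2) the power u^m
  survives in all three entries. The missing 2 is the truncation level.\<close>

lemma triple_divides_power:
  assumes u: "entire u" and q: "entire q" and p: "\<And>z. p z = u z ^ (m + 2) * q z"
  shows "triple_divides (\<lambda>z. u z ^ m) p"
proof -
  have p': "p = (\<lambda>z. u z ^ Suc (Suc m) * q z)" using p by auto
  obtain r where r: "entire r" "deriv p = (\<lambda>z. u z ^ Suc m * r z)"
    unfolding p' by (rule deriv_power_mult[OF u q])
  obtain r' where r': "entire r'" "deriv (deriv p) = (\<lambda>z. u z ^ m * r' z)"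
    unfolding r(2) by (rule deriv_power_mult[OF u r(1)])
  have "entire (\<lambda>z. u z ^ 2 * q z)" "entire (\<lambda>z. u z * r z)"
    by (intro holomorphic_intros u q r)+
  moreover have "p z = u z ^ m * (u z ^ 2 * q z) \<and> deriv p z = u z ^ m * (u z * r z) \<and> deriv (deriv p) z = u z ^ m * r' z" for z
    by (simp only: r'(2)) (simp add: r(2) p power_add power2_eq_square)
  ultimately show ?thesis unfolding triple_divides_def using r'(1) by blast
qed

lemma wr3_divides_pair:
  assumes f: "entire f" and g: "triple_divides s g" and h: "triple_divides t h"
  shows "\<exists>H. entire H \<and> (\<forall>z. wr3 f g h z = s z * t z * H z)"
    "\<exists>H. entire H \<and> (\<forall>z. wr3 g f h z = s z * t z * H z)"
proof -
  obtain t0 t1 t2 where t: "entire t0" "entire t1" "entire t2"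
    "\<And>z. g z = s z * t0 z" "\<And>z. deriv g z = s z * t1 z" "\<And>z. deriv (deriv g) z = s z * t2 z"
    using g unfolding triple_divides_def by blast
  obtain v0 v1 v2 where v: "entire v0" "entire v1" "entire v2"
    "\<And>z. h z = t z * v0 z" "\<And>z. deriv h z = t z * v1 z" "\<And>z. deriv (deriv h) z = t z * v2 z"
    using h unfolding triple_divides_def by blast
  let ?H = "\<lambda>z. f z * (t1 z * v2 z - t2 z * v1 z) - t0 z * (deriv f z * v2 z - deriv (deriv f) z * v1 z)
     + v0 z * (deriv f z * t2 z - deriv (deriv f) z * t1 z)"
  have H: "entire ?H" by (intro holomorphic_intros t v f entire_holomorphic_deriv) auto
  have "wr3 f g h z = s z * t z * ?H z" for z
    unfolding wr3_def t(5,6) v(5,6) t(4) v(4) by (simp add: algebra_simps)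
  with H show "\<exists>H. entire H \<and> (\<forall>z. wr3 f g h z = s z * t z * H z)" by blast
  have "wr3 g f h z = s z * t z * (- ?H z)" for z
    unfolding wr3_def t(5,6) v(5,6) t(4) v(4) by (simp add: algebra_simps)
  moreover have "entire (\<lambda>z. - ?H z)" using H by (rule holomorphic_on_minus)
  ultimately show "\<exists>H. entire H \<and> (\<forall>z. wr3 g f h z = s z * t z * H z)" by blast
qed

text \<open>Zeros of s1 and s3 may coincide, but at each point one of s1, s2 and one of s3, s4 is
  nonzero. These two serve as the local cofactor, and the other two are taken out of their columns;
  the fourth function is brought in by the sum-zero relation.\<close>

lemma wr3_divides:
  assumes B: "entire B1" "entire B2" "entire B3"
    and sum0: "\<And>z. B1 z + B2 z + B3 z + B4 z = 0"
    and s: "entire s1" "entire s2" "entire s3" "entire s4"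
    and div: "triple_divides s1 B1" "triple_divides s2 B2" "triple_divides s3 B3" "triple_divides s4 B4"
    and cop: "\<And>z. s1 z \<noteq> 0 \<or> s2 z \<noteq> 0" "\<And>z. s3 z \<noteq> 0 \<or> s4 z \<noteq> 0"
    and nz: "s1 w * s2 w * s3 w * s4 w \<noteq> 0"
  obtains U where "entire U" "\<And>z. wr3 B1 B2 B3 z = (s1 z * s2 z * s3 z * s4 z) * U z"
proof -
  obtain H13 where H13: "entire H13" "\<And>z. wr3 B1 B2 B3 z = s1 z * s3 z * H13 z"
    using wr3_divides_pair(2)[OF B(2) div(1) div(3)] by blast
  obtain H23 where H23: "entire H23" "\<And>z. wr3 B1 B2 B3 z = s2 z * s3 z * H23 z"
    using wr3_divides_pair(1)[OF B(1) div(2) div(3)] by blast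
  obtain H14 where H14: "entire H14" "\<And>z. wr3 B1 B2 B4 z = s1 z * s4 z * H14 z"
    using wr3_divides_pair(2)[OF B(2) div(1) div(4)] by blast
  obtain H24 where H24: "entire H24" "\<And>z. wr3 B1 B2 B4 z = s2 z * s4 z * H24 z"
    using wr3_divides_pair(1)[OF B(1) div(2) div(4)] by blast
  have m: "wr3 B1 B2 B3 z = - wr3 B1 B2 B4 z" for z using wr3_sum_zero(1)[OF B sum0] by simp
  show thesis
  proof (rule entire_divides[of "wr3 B1 B2 B3" "\<lambda>z. s1 z * s2 z * s3 z * s4 z" w])
    show "wr3 B1 B2 B3 holomorphic_on UNIV" by (intro holomorphic_wr3 B)
    show "entire (\<lambda>z. s1 z * s2 z * s3 z * s4 z)" by (intro holomorphic_intros s)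
    show "s1 w * s2 w * s3 w * s4 w \<noteq> 0" by fact
    fix z
    have *: "\<exists>k H. entire k \<and> entire H \<and> k z \<noteq> 0 \<and>
       (\<forall>w. wr3 B1 B2 B3 w * k w = s1 w * s2 w * s3 w * s4 w * H w)"
      if "entire a" "entire b" "entire H" "a z \<noteq> 0" "b z \<noteq> 0"
        "\<And>w. wr3 B1 B2 B3 w * (a w * b w) = s1 w * s2 w * s3 w * s4 w * H w" for a b H
      using that by (intro exI[of _ "\<lambda>w. a w * b w"] exI[of _ H]) (auto intro!: holomorphic_intros)
    from cop[of z] show "\<exists>k H. entire k \<and> entire H \<and> k z \<noteq> 0 \<and>
       (\<forall>w. wr3 B1 B2 B3 w * k w = s1 w * s2 w * s3 w * s4 w * H w)"
    proof (elim disjE)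
      assume "s1 z \<noteq> 0" "s3 z \<noteq> 0"
      then show ?thesis
        by (intro *[of s1 s3 "\<lambda>w. - H24 w"] s holomorphic_on_minus H24(1)) (simp_all add: m H24(2))
    next
      assume "s1 z \<noteq> 0" "s4 z \<noteq> 0"
      then show ?thesis
        by (intro *[of s1 s4 H23] s H23(1)) (simp_all add: H23(2))
    next
      assume "s2 z \<noteq> 0" "s3 z \<noteq> 0"
      then show ?thesis
        by (intro *[of s2 s3 "\<lambda>w. - H14 w"] s holomorphic_on_minus H14(1)) (simp_all add: m H14(2))
    next
      assume "s2 z \<noteq> 0" "s4 z \<noteq> 0"
      then show ?thesis
        by (intro *[of s2 s4 H13] s H13(1)) (simp_all add: H13(2))
    qed
  qed (use that in blast)
qed

text \<open>Here the power N + 3 pays off: a leftover \<open>\<tau>\<close> of degree e in x0, x1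
  becomes the e-th power of |FR| + |x0^(N+3)|.\<close>

lemma FR_truncated_bound:
  assumes t: "\<And>x0 x1. norm (FR N x0 x1 * x0 ^ (N + 3)) = norm (\<sigma> x0 x1) * norm (\<tau> x0 x1)"
    and \<tau>: "\<And>x0 x1. norm (\<tau> x0 x1) \<le> K * (norm x0 + norm x1) ^ e"
  shows "\<exists>C\<ge>0. \<forall>x0 x1. norm (FR N x0 x1 * x0 ^ (N + 3)) ^ (N + 3) \<le>
     C * norm (\<sigma> x0 x1) ^ (N + 3) * (norm (FR N x0 x1) + norm (x0 ^ (N + 3))) ^ e"
proof -
  obtain C1 where C1: "C1 \<ge> 0" "\<And>x0 x1. (norm x0 + norm x1) ^ (N + 3) \<le> C1 * (norm (FR N x0 x1) + norm (x0 ^ (N + 3)))"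
    using FR_lower_bound[of N] by blast
  define C where "C = \<bar>K\<bar> ^ (N + 3) * C1 ^ e"
  have "norm (FR N x0 x1 * x0 ^ (N + 3)) ^ (N + 3) \<le>
     C * norm (\<sigma> x0 x1) ^ (N + 3) * (norm (FR N x0 x1) + norm (x0 ^ (N + 3))) ^ e" for x0 x1
  proof -
    define h where "h = norm x0 + norm x1"
    define M where "M = norm (FR N x0 x1) + norm (x0 ^ (N + 3))"
    have h0: "h \<ge> 0" by (simp add: h_def)
    have "K * h ^ e \<le> \<bar>K\<bar> * h ^ e" using h0 by (intro mult_right_mono) auto
    then have "norm (\<tau> x0 x1) \<le> \<bar>K\<bar> * h ^ e"
      using \<tau>[of x0 x1] unfolding h_def by (rule order_trans[rotated])
    then have "norm (\<tau> x0 x1) ^ (N + 3) \<le> (\<bar>K\<bar> * h ^ e) ^ (N + 3)" by (intro power_mono) auto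
    also have "\<dots> = \<bar>K\<bar> ^ (N + 3) * (h ^ (N + 3)) ^ e"
      by (simp only: power_mult_distrib power_mult[symmetric] mult.commute)
    also have "\<dots> \<le> \<bar>K\<bar> ^ (N + 3) * (C1 * M) ^ e"
      using C1(2)[of x0 x1] h0 by (intro mult_left_mono power_mono) (auto simp: h_def M_def)
    also have "\<dots> = C * M ^ e" by (simp add: C_def power_mult_distrib)
    finally have *: "norm (\<tau> x0 x1) ^ (N + 3) \<le> C * M ^ e" .
    have "norm (FR N x0 x1 * x0 ^ (N + 3)) ^ (N + 3) = norm (\<sigma> x0 x1) ^ (N + 3) * norm (\<tau> x0 x1) ^ (N + 3)"
      unfolding t by (rule power_mult_distrib)
    also have "\<dots> \<le> norm (\<sigma> x0 x1) ^ (N + 3) * (C * M ^ e)" using * by (intro mult_left_mono) auto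
    finally show ?thesis by (simp add: M_def mult_ac)
  qed
  moreover have "C \<ge> 0" using C1(1) by (simp add: C_def)
  ultimately show ?thesis by blast
qed

text \<open>Truncation at level 1 leaves x1 x0 \<open>FRQ\<close>, of degree 4; the removed divisor
  is the one visible in the Wronskian of \<open>FR\<close> and x0^(N+3).\<close>

lemma FR_truncated1: "\<exists>C\<ge>0. \<forall>x0 x1. norm (FR N x0 x1 * x0 ^ (N + 3)) ^ (N + 3) \<le>
     C * norm (x1 ^ N * x0 ^ (N + 2)) ^ (N + 3) * (norm (FR N x0 x1) + norm (x0 ^ (N + 3))) ^ 4"
proof -
  obtain K where K: "K \<ge> 0" "\<And>x0 x1. norm (FRQ N x0 x1) \<le> K * (norm x0 + norm x1)\<^sup>2" using FRQ_bound by blast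
  show ?thesis
  proof (rule FR_truncated_bound[of N "\<lambda>x0 x1. x1 ^ N * x0 ^ (N + 2)" "\<lambda>x0 x1. x1 * x0 * FRQ N x0 x1" K])
    show "norm (FR N x0 x1 * x0 ^ (N + 3)) = norm (x1 ^ N * x0 ^ (N + 2)) * norm (x1 * x0 * FRQ N x0 x1)" for x0 x1
      by (simp add: FR_def norm_mult norm_power power_add power2_eq_square power3_eq_cube)
    show "norm (x1 * x0 * FRQ N x0 x1) \<le> K * (norm x0 + norm x1) ^ 4" for x0 x1
    proof -
      have "norm (x1 * x0 * FRQ N x0 x1) \<le> (norm x0 + norm x1) * (norm x0 + norm x1) * (K * (norm x0 + norm x1)\<^sup>2)"
        unfolding norm_mult by (intro mult_mono K) auto
      then show ?thesis by (simp add: power4_eq_xxxx power2_eq_square mult_ac)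
    qed
  qed
qed

text \<open>Truncation at level 2 leaves x1^2 x0^2 \<open>FRQ\<close>, of degree 6 = 4 + 2.\<close>

lemma FR_truncated2: 
  assumes "N \<ge> 1"
  shows "\<exists>C\<ge>0. \<forall>x0 x1. norm (FR N x0 x1 * x0 ^ (N + 3)) ^ (N + 3) \<le>
     C * norm (x1 ^ (N - 1) * x0 ^ (N + 1)) ^ (N + 3) * (norm (FR N x0 x1) + norm (x0 ^ (N + 3))) ^ 6"
proof -
  obtain K where K: "K \<ge> 0" "\<And>x0 x1. norm (FRQ N x0 x1) \<le> K * (norm x0 + norm x1)\<^sup>2" using FRQ_bound by blast
  obtain l where l: "N = Suc l" using assms by (cases N) auto
  show ?thesis
  proof (rule FR_truncated_bound[of N "\<lambda>x0 x1. x1 ^ (N - 1) * x0 ^ (N + 1)" "\<lambda>x0 x1. x1\<^sup>2 * x0\<^sup>2 * FRQ N x0 x1" K])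
    show "norm (FR N x0 x1 * x0 ^ (N + 3)) = norm (x1 ^ (N - 1) * x0 ^ (N + 1)) * norm (x1\<^sup>2 * x0\<^sup>2 * FRQ N x0 x1)" for x0 x1
      unfolding l by (simp add: FR_def norm_mult norm_power power_add power2_eq_square power3_eq_cube power4_eq_xxxx)
    show "norm (x1\<^sup>2 * x0\<^sup>2 * FRQ N x0 x1) \<le> K * (norm x0 + norm x1) ^ 6" for x0 x1
    proof -
      have "norm (x1\<^sup>2 * x0\<^sup>2 * FRQ N x0 x1) \<le> (norm x0 + norm x1)\<^sup>2 * (norm x0 + norm x1)\<^sup>2 * (K * (norm x0 + norm x1)\<^sup>2)"
        unfolding norm_mult norm_power by (intro mult_mono K power_mono) auto
      also have "\<dots> = K * (norm x0 + norm x1) ^ 6" by (simp add: power_add[symmetric])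
      finally show ?thesis .
    qed
  qed
qed

lemma generic_point_nonzero:
  assumes "finite B" "\<And>p. p \<in> B \<Longrightarrow> entire p" "\<And>p. p \<in> B \<Longrightarrow> \<exists>w. p w \<noteq> (0::complex)"
  shows "\<exists>z. \<forall>p\<in>B. p z \<noteq> 0"
  using generic_point[of B] assms by metis

lemma wr2_nonzero_imp:
  assumes "wr2 f g w \<noteq> 0"
  shows "\<exists>z. f z \<noteq> 0" "\<exists>z. g z \<noteq> 0"
proof -
  show "\<exists>z. f z \<noteq> 0" proof (rule ccontr)
    assume "\<not> ?thesis"
    then have "f = (\<lambda>_. 0)" by auto
    then show False using assms by (simp add: wr2_def)
  qed
  show "\<exists>z. g z \<noteq> 0" proof (rule ccontr)
    assume "\<not> ?thesis"
    then have "g = (\<lambda>_. 0)" by auto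
    then show False using assms by (simp add: wr2_def)
  qed
qed

lemma wr2_FR_nonzero:
  assumes f: "entire f0" "entire f1" and W: "wr2 f0 f1 w \<noteq> 0"
  shows "\<exists>z. wr2 (\<lambda>z. FR N (f0 z) (f1 z)) (\<lambda>z. f0 z ^ (N + 3)) z \<noteq> 0"
proof -
  have "wr2 (\<lambda>z. 1 * f0 z + 0 * f1 z) (\<lambda>z. (-1) * f0 z + 1 * f1 z) w \<noteq> 0"
    using W unfolding wr2_lincomb[OF f] by simp
  from wr2_nonzero_imp(2)[OF this] obtain z where "f1 z - f0 z \<noteq> 0" by auto
  then have "\<exists>z. \<forall>p\<in>{f0, f1, \<lambda>z. f1 z - f0 z, wr2 f0 f1}. p z \<noteq> 0"
    using wr2_nonzero_imp[OF W] W by (intro generic_point_nonzero) (auto intro!: holomorphic_intros holomorphic_wr2 f)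
  then obtain z where "f0 z \<noteq> 0" "f1 z \<noteq> 0" "f1 z - f0 z \<noteq> 0" "wr2 f0 f1 z \<noteq> 0" by auto
  moreover have "of_nat ((N + 3) * (N + 2) * (N + 1)) \<noteq> (0::complex)" by (subst of_nat_eq_0_iff) simp
  ultimately have "wr2 (\<lambda>z. FR N (f0 z) (f1 z)) (\<lambda>z. f0 z ^ (N + 3)) z \<noteq> 0"
    unfolding wr2_FR[OF f] by (simp del: of_nat_mult of_nat_add)
  then show ?thesis by blast
qed

lemma holomorphic_on_power_UNIV: "entire f \<Longrightarrow> entire (\<lambda>z. f z ^ m)"
  by (rule holomorphic_on_power)

lemma FR_no_common_zero:
  assumes "FR N x0 x1 = 0" "x0 = 0"
  shows "x1 = 0"
proof -
  obtain C where "(norm x0 + norm x1) ^ (N + 3) \<le> C * (norm (FR N x0 x1) + norm (x0 ^ (N + 3)))"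
    using FR_lower_bound[of N] by blast
  then have "norm x1 ^ (N + 3) \<le> 0" using assms by (simp add: zero_power)
  moreover have "norm x1 ^ (N + 3) \<ge> 0" by simp
  ultimately have "norm x1 ^ (N + 3) = 0" by linarith
  then show ?thesis by simp
qed

section \<open>Linear relations between the four terms\<close>

text \<open>The situation after the zero-free factor has been absorbed. A Wronskian that does not
  vanish identically expresses that the quotient is not constant.\<close>

locale FR_pair =
  fixes N :: nat and c :: complex and f0 f1 g0 g1 :: "complex \<Rightarrow> complex"
  assumes N: "N \<ge> 10" and c: "c \<noteq> 0"
    and hol: "entire f0" "entire f1" "entire g0" "entire g1"
    and copf: "f0 z \<noteq> 0 \<or> f1 z \<noteq> 0" and copg: "g0 z \<noteq> 0 \<or> g1 z \<noteq> 0"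
    and Wf: "\<exists>w. wr2 f0 f1 w \<noteq> 0" and Wg: "\<exists>w. wr2 g0 g1 w \<noteq> 0"
    and eq: "FR N (f0 z) (f1 z) - c * f0 z ^ (N + 3) = FR N (g0 z) (g1 z) - c * g0 z ^ (N + 3)"
begin

abbreviation "A1 \<equiv> (\<lambda>z. FR N (f0 z) (f1 z))"
abbreviation "A2 \<equiv> (\<lambda>z. FR N (g0 z) (g1 z))"
abbreviation "A3 \<equiv> (\<lambda>z. f0 z ^ (N + 3))"
abbreviation "A4 \<equiv> (\<lambda>z. g0 z ^ (N + 3))"

lemma holA: "entire A1" "entire A2" "entire A3" "entire A4"
  by (intro holomorphic_FR holomorphic_on_power_UNIV hol)+

lemma W13: "\<exists>z. wr2 A1 A3 z \<noteq> 0" and W24: "\<exists>z. wr2 A2 A4 z \<noteq> 0"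
  using Wf Wg wr2_FR_nonzero hol by metis+

lemma nonzero: "\<exists>z. f0 z \<noteq> 0" "\<exists>z. f1 z \<noteq> 0" "\<exists>z. g0 z \<noteq> 0" "\<exists>z. g1 z \<noteq> 0"
  using Wf Wg wr2_nonzero_imp by blast+

lemma wr3_vanishes: "wr3 A1 (\<lambda>z. - c * A3 z) (\<lambda>z. - A2 z) z = 0"
proof (rule ccontr)
  assume nz: "wr3 A1 (\<lambda>z. - c * A3 z) (\<lambda>z. - A2 z) z \<noteq> 0"
  \<comment> \<open>The order matters: the first two terms come from f and the last two from g, so
    that the coprimality of f0, f1 and of g0, g1 is what \<open>wr3_divides\<close> asks
    for.\<close>
  let ?B1 = "A1" and ?B2 = "\<lambda>z. - c * A3 z" and ?B3 = "\<lambda>z. - A2 z" and ?B4 = "\<lambda>z. c * A4 z"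
  have hB: "entire ?B1" "entire ?B2" "entire ?B3" "entire ?B4"
    by (intro holomorphic_intros holA)+
  have sum0: "?B1 z + ?B2 z + ?B3 z + ?B4 z = 0" for z using eq[of z] by (simp add: algebra_simps)
  obtain l where l: "N = Suc l" using N by (cases N) auto
  let ?s1 = "\<lambda>z. f1 z ^ (N - 1)" and ?s2 = "\<lambda>z. f0 z ^ (N + 1)" and ?s3 = "\<lambda>z. g1 z ^ (N - 1)" and ?s4 = "\<lambda>z. g0 z ^ (N + 1)"
  let ?s = "\<lambda>z. ?s1 z * ?s2 z * ?s3 z * ?s4 z"
  have hs: "entire ?s1" "entire ?s2" "entire ?s3" "entire ?s4"
    by (intro holomorphic_on_power_UNIV hol)+
  have td: "triple_divides ?s1 ?B1" "triple_divides ?s3 ?B3"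
  proof -
    have "N - 1 + 2 = N + 1" using l by simp
    then show "triple_divides ?s1 ?B1" 
      by (intro triple_divides_power[where q = "\<lambda>z. FRQ N (f0 z) (f1 z)"] holomorphic_FR hol) (simp add: FR_def)
    show "triple_divides ?s3 ?B3" 
      using \<open>N - 1 + 2 = N + 1\<close>
      by (intro triple_divides_power[where q = "\<lambda>z. - FRQ N (g0 z) (g1 z)"] holomorphic_FR holomorphic_on_minus hol) (simp add: FR_def)
  qed
  have td2: "triple_divides ?s2 ?B2"
    by (rule triple_divides_power[where q = "\<lambda>z. - c"])
       (auto intro: hol simp: power_add power2_eq_square power3_eq_cube)
  have td4: "triple_divides ?s4 ?B4"
    by (rule triple_divides_power[where q = "\<lambda>z. c"])
       (auto intro: hol simp: power_add power2_eq_square power3_eq_cube)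
  have "\<exists>z. \<forall>p\<in>{f0, f1, g0, g1}. p z \<noteq> 0"
    using nonzero hol by (intro generic_point_nonzero) auto
  then obtain w where w: "f0 w \<noteq> 0" "f1 w \<noteq> 0" "g0 w \<noteq> 0" "g1 w \<noteq> 0" by auto
  obtain U where U: "entire U" "\<And>z. wr3 ?B1 ?B2 ?B3 z = ?s z * U z"
  proof (rule wr3_divides[OF hB(1-3) sum0 hs td(1) td2 td(2) td4])
    show "?s1 w * ?s2 w * ?s3 w * ?s4 w \<noteq> 0" using w by simp
    show "?s1 z \<noteq> 0 \<or> ?s2 z \<noteq> 0" "?s3 z \<noteq> 0 \<or> ?s4 z \<noteq> 0" for z using copf[of z] copg[of z] by auto
  qed blast
  obtain C where C: "C \<ge> 0" "\<And>x0 x1. norm (FR N x0 x1 * x0 ^ (N + 3)) ^ (N + 3) \<le>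
     C * norm (x1 ^ (N - 1) * x0 ^ (N + 1)) ^ (N + 3) * (norm (FR N x0 x1) + norm (x0 ^ (N + 3))) ^ 6"
    using FR_truncated2[of N] N by auto
  define m where "m = (\<lambda>z. norm (?B1 z) + norm (?B2 z) + norm (?B3 z) + norm (?B4 z))"
  define K where "K = 1 + 1 / norm c"
  have K: "K \<ge> 1" by (simp add: K_def)
  have sub: "norm a + norm b \<le> K * (norm a + norm (c * b))" for a b :: complex
  proof -
    have "norm b = (1 / norm c) * norm (c * b)" using c by (simp add: norm_mult)
    moreover have "0 \<le> (1 / norm c) * norm a" by simp
    ultimately show ?thesis unfolding K_def by (simp add: distrib_left distrib_right)
  qed
  have Mf: "norm (A1 z) + norm (A3 z) \<le> K * m z" for z
  proof -
    have "norm (A1 z) + norm (A3 z) \<le> K * (norm (A1 z) + norm (c * A3 z))" by (rule sub)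
    also have "\<dots> \<le> K * m z" using K by (intro mult_left_mono) (auto simp: m_def norm_mult)
    finally show ?thesis .
  qed
  have Mg: "norm (A2 z) + norm (A4 z) \<le> K * m z" for z
  proof -
    have "norm (A2 z) + norm (A4 z) \<le> K * (norm (A2 z) + norm (c * A4 z))" by (rule sub)
    also have "\<dots> \<le> K * m z" using K by (intro mult_left_mono) (auto simp: m_def norm_mult)
    finally show ?thesis .
  qed
  show False
  \<comment> \<open>The exponent 12 = 6 + 6 collects the level-2 leftovers of both functions and
    must stay below N + 3.\<close>
  proof (rule Cartan_plane[OF hB sum0 nz, where s = "\<lambda>z. ?s z ^ (N + 3)" and U = "\<lambda>z. U z ^ (N + 3)" and k = "N + 3"
        and \<kappa> = 12 and C = "norm c ^ (2 * (N + 3)) * C\<^sup>2 * K ^ 12"])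
    show "entire (\<lambda>z. ?s z ^ (N + 3))" "entire (\<lambda>z. U z ^ (N + 3))"
      by (intro holomorphic_intros hol U(1))+
    show "wr3 ?B1 ?B2 ?B3 z ^ (N + 3) = ?s z ^ (N + 3) * U z ^ (N + 3)" for z
      unfolding U(2) by (rule power_mult_distrib)
    show "12 < N + 3" using N by simp
    fix z
    define Sf where "Sf = norm (f1 z ^ (N - 1) * f0 z ^ (N + 1)) ^ (N + 3)"
    define Sg where "Sg = norm (g1 z ^ (N - 1) * g0 z ^ (N + 1)) ^ (N + 3)"
    have m0: "m z \<ge> 0" by (simp add: m_def)
    have S0: "Sf \<ge> 0" "Sg \<ge> 0" by (simp_all add: Sf_def Sg_def)
    have "norm (A1 z * A3 z) ^ (N + 3) \<le> C * Sf * (norm (A1 z) + norm (A3 z)) ^ 6"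
      unfolding Sf_def by (rule C(2))
    also have "\<dots> \<le> C * Sf * (K * m z) ^ 6" using C(1) S0 by (intro mult_left_mono power_mono Mf) auto
    finally have 1: "norm (A1 z * A3 z) ^ (N + 3) \<le> C * Sf * (K * m z) ^ 6" .
    have "norm (A2 z * A4 z) ^ (N + 3) \<le> C * Sg * (norm (A2 z) + norm (A4 z)) ^ 6"
      unfolding Sg_def by (rule C(2))
    also have "\<dots> \<le> C * Sg * (K * m z) ^ 6" using C(1) S0 by (intro mult_left_mono power_mono Mg) auto
    finally have 2: "norm (A2 z * A4 z) ^ (N + 3) \<le> C * Sg * (K * m z) ^ 6" .
    have "norm (?B1 z * ?B2 z * ?B3 z * ?B4 z) = norm c ^ 2 * (norm (A1 z * A3 z) * norm (A2 z * A4 z))"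
      by (simp add: norm_mult power2_eq_square)
    then have "norm (?B1 z * ?B2 z * ?B3 z * ?B4 z) ^ (N + 3) = norm c ^ (2 * (N + 3)) * (norm (A1 z * A3 z) ^ (N + 3) * norm (A2 z * A4 z) ^ (N + 3))"
      by (simp only: power_mult_distrib power_mult)
    also have "\<dots> \<le> norm c ^ (2 * (N + 3)) * ((C * Sf * (K * m z) ^ 6) * (C * Sg * (K * m z) ^ 6))"
      using 1 2 S0 C(1) m0 K by (intro mult_left_mono mult_mono) auto
    also have "\<dots> = norm c ^ (2 * (N + 3)) * C\<^sup>2 * K ^ 12 * (Sf * Sg) * m z ^ 12"
      by (simp add: power_mult_distrib power2_eq_square power_add[symmetric] mult_ac)
    also have "Sf * Sg = norm (?s z ^ (N + 3))"
      unfolding Sf_def Sg_def by (simp only: norm_power norm_mult power_mult_distrib mult_ac)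
    finally show "norm (?B1 z * ?B2 z * ?B3 z * ?B4 z) ^ (N + 3) \<le> norm c ^ (2 * (N + 3)) * C\<^sup>2 * K ^ 12 * norm (?s z ^ (N + 3)) * (norm (?B1 z) + norm (?B2 z) + norm (?B3 z) + norm (?B4 z)) ^ 12"
      by (simp only: m_def)
  qed
qed

lemma A2_lincomb: "\<exists>\<alpha> \<beta>. \<forall>z. A2 z = \<alpha> * A1 z + \<beta> * A3 z"
proof -
  obtain w where w: "wr2 A1 A3 w \<noteq> 0" using W13 by blast
  have "wr2 (\<lambda>z. 1 * A1 z + 0 * A3 z) (\<lambda>z. 0 * A1 z + (-c) * A3 z) w \<noteq> 0"
    using w c unfolding wr2_lincomb[OF holA(1,3)] by simp
  then have "wr2 A1 (\<lambda>z. - c * A3 z) w \<noteq> 0" by simp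
  then have "\<exists>a b. \<forall>z. - A2 z = a * A1 z + b * (- c * A3 z)"
    by (intro wr3_eq_zero_imp wr3_vanishes holomorphic_intros holA)
  then obtain a b where "\<And>z. - A2 z = a * A1 z + b * (- c * A3 z)" by blast
  then have "A2 z = - (a * A1 z + b * (- c * A3 z))" for z by (metis minus_minus)
  then have "A2 z = (- a) * A1 z + (b * c) * A3 z" for z by (simp add: algebra_simps)
  then show ?thesis by blast
qed

text \<open>The three values \<open>A1 = 0\<close>, \<open>A3 = 0\<close> and \<open>p = 0\<close> would be taken with too high multiplicities.\<close>

lemma no_third_value:
  assumes ab: "\<alpha> \<noteq> 0" "\<beta> \<noteq> 0" and p: "\<And>z. \<alpha> * A1 z + \<beta> * A3 z = r z ^ Suc m * q z"
    and r: "entire r" and q: "entire q" and e: "e < N - 1"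
    and bd: "\<And>z. norm (r z ^ Suc m * q z) ^ (N + 3) \<le> C' * norm (r z ^ m) ^ (N + 3) * (norm (A1 z) + norm (A3 z)) ^ e"
  shows False
proof -
  obtain w where w: "wr2 A1 A3 w \<noteq> 0" using W13 by blast
  define P where "P = (\<lambda>z. \<alpha> * A1 z + \<beta> * A3 z)"
  define s where "s = (\<lambda>z. f0 z ^ (N + 2) * f1 z ^ N * r z ^ m)"
  have hs: "entire s" unfolding s_def by (intro holomorphic_intros hol r)
  have wP: "wr2 P A3 z = \<alpha> * wr2 A1 A3 z" for z
    using wr2_lincomb[OF holA(1,3), of \<alpha> \<beta> 0 1 z] by (simp add: P_def)
  have "\<exists>z. P z \<noteq> 0" using wr2_nonzero_imp(1)[of P A3 w] w ab wP by auto
  then obtain z where "r z ^ m \<noteq> 0" unfolding P_def p by (metis mult_zero_left power_Suc mult_zero_right power_0_Suc)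
  then have rm: "\<exists>z. r z ^ m \<noteq> 0" by blast
  have "\<exists>z. \<forall>p\<in>{f0, f1, \<lambda>z. r z ^ m}. p z \<noteq> 0"
    using nonzero hol rm by (intro generic_point_nonzero) (auto intro!: holomorphic_on_power_UNIV r)
  then obtain w' where w': "f0 w' \<noteq> 0" "f1 w' \<noteq> 0" "r w' ^ m \<noteq> 0" by auto
  \<comment> \<open>The Wronskian is divided in two ways: here by the powers of f0 and f1, and with
    \<open>H1\<close> by r^m. Both divisions are then merged pointwise.\<close>
  define H0 where "H0 = (\<lambda>z. - of_nat ((N + 3) * (N + 2) * (N + 1)) / 2 * (f1 z - f0 z)\<^sup>2 * wr2 f0 f1 z)"
  have H0: "entire H0" "\<And>z. wr2 A1 A3 z = f0 z ^ (N + 2) * f1 z ^ N * H0 z"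
    unfolding H0_def by (intro holomorphic_intros hol holomorphic_wr2, simp, rule wr2_FR[OF hol(1,2)])
  obtain r' where r': "entire r'" "deriv P = (\<lambda>z. r z ^ m * r' z)"
    unfolding P_def p by (rule deriv_power_mult[OF r q])
  define H1 where "H1 = (\<lambda>z. (r z * q z * deriv A3 z - r' z * A3 z) / \<alpha>)"
  have H1: "entire H1" unfolding H1_def
    by (intro holomorphic_intros r q r' entire_holomorphic_deriv holA) (use ab in auto)
  have Pz: "P z = r z ^ Suc m * q z" for z by (simp only: P_def p)
  have WH1: "wr2 A1 A3 z = r z ^ m * H1 z" for z
  proof -
    have "\<alpha> * wr2 A1 A3 z = P z * deriv A3 z - deriv P z * A3 z"
      unfolding wP[symmetric] by (simp add: wr2_def)
    also have "\<dots> = r z ^ m * (r z * q z * deriv A3 z - r' z * A3 z)"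
      unfolding r'(2) Pz by (simp add: algebra_simps)
    finally show ?thesis using ab unfolding H1_def by (simp add: field_simps)
  qed
  obtain U where U: "entire U" "\<And>z. wr2 A1 A3 z = s z * U z"
  proof (rule entire_divides[of "wr2 A1 A3" s w'])
    show "wr2 A1 A3 holomorphic_on UNIV" by (intro holomorphic_wr2 holA)
    show "s w' \<noteq> 0" using w' by (simp add: s_def)
    fix z
    show "\<exists>k H. entire k \<and> entire H \<and> k z \<noteq> 0 \<and> (\<forall>w. wr2 A1 A3 w * k w = s w * H w)"
    proof (cases "r z ^ m = 0")
      case False
      then show ?thesis
        by (intro exI[of _ "\<lambda>z. r z ^ m"] exI[of _ H0]) (auto intro!: holomorphic_intros r H0(1) simp: H0(2) s_def)
    next
      case True
      \<comment> \<open>At a zero of r the third form vanishes. With both coefficients nonzero, a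
        zero of A1 or of A3 would force a common zero of the two, so f0 and f1 are nonzero
        there.\<close>
      then have "r z = 0" by simp
      then have "\<alpha> * A1 z + \<beta> * A3 z = 0" unfolding p by simp
      moreover have "A1 z = 0" if "f1 z = 0" using that by (simp add: FR_def)
      moreover have "A3 z = 0" if "f0 z = 0" using that by simp
      ultimately have "f0 z \<noteq> 0 \<and> f1 z \<noteq> 0"
        using copf[of z] ab FR_no_common_zero[of N "f0 z" "f1 z"] by (auto simp: zero_power)
      then show ?thesis
        by (intro exI[of _ "\<lambda>z. f0 z ^ (N + 2) * f1 z ^ N"] exI[of _ H1]) (auto intro!: holomorphic_intros hol H1 simp: WH1 s_def)
    qed
  qed (use hs in blast)+
  obtain C where C: "C \<ge> 0" "\<And>x0 x1. norm (FR N x0 x1 * x0 ^ (N + 3)) ^ (N + 3) \<le>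
     C * norm (x1 ^ N * x0 ^ (N + 2)) ^ (N + 3) * (norm (FR N x0 x1) + norm (x0 ^ (N + 3))) ^ 4"
    using FR_truncated1[of N] by auto
  define J where "J = {(1, 0), (0, 1), (\<alpha>, \<beta>)}"
  have card: "card J = 3" using ab by (simp add: J_def)
  show False
  \<comment> \<open>Three points make the right-hand side N + 3, so 4 + e is admissible exactly when
    e < N - 1; the 4 is the level-1 leftover of A1 A3.\<close>
  proof (rule Cartan_line[OF holA(1,3) w, where J = J and s = "\<lambda>z. s z ^ (N + 3)" and U = "\<lambda>z. U z ^ (N + 3)" and k = "N + 3"
        and \<kappa> = "4 + e" and C = "C * \<bar>C'\<bar>"])
    show "finite J" "2 \<le> card J" using card by (auto simp: J_def)
    show "fst i * snd j - snd i * fst j \<noteq> 0" if "i \<in> J" "j \<in> J" "i \<noteq> j" for i j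
      using that ab by (auto simp: J_def)
    show "entire (\<lambda>z. s z ^ (N + 3))" "entire (\<lambda>z. U z ^ (N + 3))"
      by (intro holomorphic_on_power_UNIV hs U(1))+
    show "wr2 A1 A3 z ^ (N + 3) = s z ^ (N + 3) * U z ^ (N + 3)" for z
      unfolding U(2) by (rule power_mult_distrib)
    show "4 + e < (N + 3) * (card J - 2)" using card e by simp
    fix z
    have "(\<Prod>j\<in>J. fst j * A1 z + snd j * A3 z) = (A1 z * A3 z) * (r z ^ Suc m * q z)"
      using ab p[of z] by (simp add: J_def)
    then have "norm (\<Prod>j\<in>J. fst j * A1 z + snd j * A3 z) ^ (N + 3) = norm (A1 z * A3 z) ^ (N + 3) * norm (r z ^ Suc m * q z) ^ (N + 3)"
      by (simp only: norm_mult power_mult_distrib)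
    also have "\<dots> \<le> (C * norm (f1 z ^ N * f0 z ^ (N + 2)) ^ (N + 3) * (norm (A1 z) + norm (A3 z)) ^ 4) *
        (\<bar>C'\<bar> * norm (r z ^ m) ^ (N + 3) * (norm (A1 z) + norm (A3 z)) ^ e)"
    proof (intro mult_mono C(2))
      have "C' * norm (r z ^ m) ^ (N + 3) * (norm (A1 z) + norm (A3 z)) ^ e \<le> \<bar>C'\<bar> * norm (r z ^ m) ^ (N + 3) * (norm (A1 z) + norm (A3 z)) ^ e"
        by (intro mult_right_mono) auto
      then show "norm (r z ^ Suc m * q z) ^ (N + 3) \<le> \<bar>C'\<bar> * norm (r z ^ m) ^ (N + 3) * (norm (A1 z) + norm (A3 z)) ^ e"
        using bd[of z] by linarith
    qed (use C(1) in auto)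
    also have "\<dots> = C * \<bar>C'\<bar> * norm (s z ^ (N + 3)) * (norm (A1 z) + norm (A3 z)) ^ (4 + e)"
      unfolding s_def by (simp only: norm_power norm_mult power_mult_distrib power_add mult_ac)
    finally show "norm (\<Prod>j\<in>J. fst j * A1 z + snd j * A3 z) ^ (N + 3) \<le> C * \<bar>C'\<bar> * norm (s z ^ (N + 3)) * (norm (A1 z) + norm (A3 z)) ^ (4 + e)" .
  qed
qed

text \<open>Both A2 and A4 are combinations of A1 and A3. If both coefficients of A2 are nonzero,
  the power g1^(N+1) in it makes a third value with leftover g1 \<open>FRQ\<close> of degree 3; for
  A4 the power g0^(N+3) has leftover g0 of degree 1. So each is a multiple of A1 or of A3, and
  \<open>eq\<close> ties the coefficients together.\<close>

lemma dichotomy: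
  "(\<forall>z. A2 z = A1 z \<and> A4 z = A3 z) \<or> (\<forall>z. A2 z = - c * A3 z \<and> A4 z = (- 1 / c) * A1 z)"
proof -
  obtain \<alpha> \<beta> where A2: "\<And>z. A2 z = \<alpha> * A1 z + \<beta> * A3 z" using A2_lincomb by blast
  define \<gamma> \<delta> where "\<gamma> = (\<alpha> - 1) / c" and "\<delta> = 1 + \<beta> / c"
  have A4: "A4 z = \<gamma> * A1 z + \<delta> * A3 z" for z
  proof -
    have "c * A4 z = A2 z - A1 z + c * A3 z" using eq[of z] by (simp add: algebra_simps)
    also have "\<dots> = c * (\<gamma> * A1 z + \<delta> * A3 z)" unfolding A2 using c by (simp add: \<gamma>_def \<delta>_def field_simps)
    finally show ?thesis using c by simp
  qed
  obtain w where w: "wr2 A2 A4 w \<noteq> 0" using W24 by blast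
  have "wr2 A2 A4 w = (\<alpha> * \<delta> - \<beta> * \<gamma>) * wr2 A1 A3 w"
    unfolding A2 A4 by (rule wr2_lincomb[OF holA(1,3)])
  then have det: "\<alpha> * \<delta> - \<beta> * \<gamma> \<noteq> 0" using w by auto
  define M where "M = (\<lambda>z. norm (A1 z) + norm (A3 z))"
  have M0: "M z \<ge> 0" for z by (simp add: M_def)
  define K where "K = norm \<alpha> + norm \<beta> + norm \<gamma> + norm \<delta>"
  have lin: "norm (a * A1 z + b * A3 z) \<le> (norm a + norm b) * M z" for a b z
  proof -
    have "norm (a * A1 z + b * A3 z) \<le> norm a * norm (A1 z) + norm b * norm (A3 z)"
      by (metis norm_mult norm_triangle_ineq)
    also have "\<dots> \<le> (norm a + norm b) * M z" by (simp add: M_def distrib_left distrib_right)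
    finally show ?thesis .
  qed
  have A24: "norm (A2 z) + norm (A4 z) \<le> K * M z" for z
    using lin[of \<alpha> z \<beta>] lin[of \<gamma> z \<delta>] unfolding A2 A4 K_def by (simp add: distrib_right)
  have 1: "\<alpha> = 0 \<or> \<beta> = 0"
  proof (rule ccontr)
    assume "\<not> ?thesis"
    then have ab: "\<alpha> \<noteq> 0" "\<beta> \<noteq> 0" by auto
    obtain C1 where C1: "C1 \<ge> 0" "\<And>x0 x1. (norm x0 + norm x1) ^ (N + 3) \<le> C1 * (norm (FR N x0 x1) + norm (x0 ^ (N + 3)))"
      using FR_lower_bound[of N] by blast
    obtain C2 where C2: "C2 \<ge> 0" "\<And>x0 x1. norm (FRQ N x0 x1) \<le> C2 * (norm x0 + norm x1)\<^sup>2" using FRQ_bound by blast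
    show False
    proof (rule no_third_value[OF ab, where r = g1 and m = N and q = "\<lambda>z. FRQ N (g0 z) (g1 z)" and e = 3 and C' = "C2 ^ (N + 3) * (C1 * K) ^ 3"])
      show "\<alpha> * A1 z + \<beta> * A3 z = g1 z ^ Suc N * FRQ N (g0 z) (g1 z)" for z
        using A2[of z] by (simp add: FR_def)
      show "entire g1" "entire (\<lambda>z. FRQ N (g0 z) (g1 z))" by (intro holomorphic_FR hol)+
      show "3 < N - 1" using N by simp
      fix z
      define h where "h = norm (g0 z) + norm (g1 z)"
      have h0: "h \<ge> 0" by (simp add: h_def)
      have "h ^ (N + 3) \<le> C1 * (norm (A2 z) + norm (A4 z))" unfolding h_def by (rule C1(2))
      also have "\<dots> \<le> C1 * (K * M z)" by (intro mult_left_mono A24 C1)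
      finally have hM: "h ^ (N + 3) \<le> C1 * K * M z" by simp
      have "norm (g1 z * FRQ N (g0 z) (g1 z)) \<le> h * (C2 * h\<^sup>2)"
        unfolding norm_mult h_def by (intro mult_mono C2) auto
      also have "\<dots> = C2 * h ^ 3" by (simp add: power2_eq_square power3_eq_cube)
      finally have "norm (g1 z * FRQ N (g0 z) (g1 z)) ^ (N + 3) \<le> (C2 * h ^ 3) ^ (N + 3)" by (intro power_mono) auto
      also have "\<dots> = C2 ^ (N + 3) * (h ^ (N + 3)) ^ 3" by (simp only: power_mult_distrib power_mult[symmetric] mult.commute)
      also have "\<dots> \<le> C2 ^ (N + 3) * (C1 * K * M z) ^ 3"
        using hM h0 C2 by (intro mult_left_mono power_mono) auto
      finally have b: "norm (g1 z * FRQ N (g0 z) (g1 z)) ^ (N + 3) \<le> C2 ^ (N + 3) * (C1 * K * M z) ^ 3" .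
      have "norm (g1 z ^ Suc N * FRQ N (g0 z) (g1 z)) ^ (N + 3) = norm (g1 z ^ N) ^ (N + 3) * norm (g1 z * FRQ N (g0 z) (g1 z)) ^ (N + 3)"
        by (simp only: power_Suc2 mult.assoc norm_mult power_mult_distrib)
      also have "\<dots> \<le> norm (g1 z ^ N) ^ (N + 3) * (C2 ^ (N + 3) * (C1 * K * M z) ^ 3)" using b by (intro mult_left_mono) auto
      also have "\<dots> = C2 ^ (N + 3) * (C1 * K) ^ 3 * norm (g1 z ^ N) ^ (N + 3) * M z ^ 3"
        by (simp only: power_mult_distrib mult_ac)
      finally show "norm (g1 z ^ Suc N * FRQ N (g0 z) (g1 z)) ^ (N + 3) \<le> C2 ^ (N + 3) * (C1 * K) ^ 3 * norm (g1 z ^ N) ^ (N + 3) * (norm (A1 z) + norm (A3 z)) ^ 3"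
        by (simp only: M_def)
    qed
  qed
  have 2: "\<gamma> = 0 \<or> \<delta> = 0"
  proof (rule ccontr)
    assume "\<not> ?thesis"
    then have ab: "\<gamma> \<noteq> 0" "\<delta> \<noteq> 0" by auto
    show False
    proof (rule no_third_value[OF ab, where r = g0 and m = "N + 2" and q = "\<lambda>z. 1" and e = 1 and C' = K])
      show "\<gamma> * A1 z + \<delta> * A3 z = g0 z ^ Suc (N + 2) * 1" for z using A4[of z] by (simp add: numeral_3_eq_3)
      show "entire g0" "(\<lambda>z. 1) holomorphic_on (UNIV :: complex set)" by (auto intro: hol)
      show "1 < N - 1" using N by simp
      fix z
      have "norm (g0 z) ^ (N + 3) \<le> K * M z"
        using A24[of z] norm_ge_zero[of "A2 z"] unfolding norm_power by linarith
      then have "norm (g0 z ^ (N + 2)) ^ (N + 3) * norm (g0 z) ^ (N + 3) \<le> norm (g0 z ^ (N + 2)) ^ (N + 3) * (K * M z)"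
        by (intro mult_left_mono) auto
      then show "norm (g0 z ^ Suc (N + 2) * 1) ^ (N + 3) \<le> K * norm (g0 z ^ (N + 2)) ^ (N + 3) * (norm (A1 z) + norm (A3 z)) ^ 1"
        unfolding mult_1_right by (simp only: power_Suc2 norm_mult power_mult_distrib M_def power_one_right mult_ac)
    qed
  qed
  show ?thesis
  proof (cases "\<alpha> = 0")
    case True
    then have "\<gamma> = -1 / c" by (simp add: \<gamma>_def)
    moreover from this have "\<delta> = 0" using 2 c by auto
    then have "\<beta> = - c" using c by (simp add: \<delta>_def field_simps eq_neg_iff_add_eq_0 add.commute)
    ultimately show ?thesis using A2 A4 True \<open>\<delta> = 0\<close> by auto
  next
    case False
    then have "\<beta> = 0" using 1 by auto
    then have "\<delta> = 1" by (simp add: \<delta>_def)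
    then have "\<gamma> = 0" using 2 by auto
    then have "\<alpha> = 1" using c by (simp add: \<gamma>_def)
    then show ?thesis using A2 A4 \<open>\<beta> = 0\<close> \<open>\<gamma> = 0\<close> \<open>\<delta> = 1\<close> by auto
  qed
qed

end

section \<open>Highly ramified values and the exclusion of the swap\<close>

text \<open>The value e of Y/X carries the weight \<open>r e\<close>/k, a lower bound for 1 - 1/m
  over its multiplicities m. The last hypothesis says that the weights add up to more than 2, the
  maximum for a nonconstant meromorphic function. Since X and Y have no common zero, at most one of
  the forms vanishes at a given point, so their contributions to the Wronskian can be
  combined.\<close>

theorem ramified_line:
  fixes X Y :: "complex \<Rightarrow> complex" and E :: "complex set" and r :: "complex \<Rightarrow> nat"
  assumes X: "entire X" and Y: "entire Y" and W: "wr2 X Y w \<noteq> 0"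
    and cop: "\<And>z. X z \<noteq> 0 \<or> Y z \<noteq> 0"
    and E: "finite E" "card E \<ge> 2"
    and ram: "\<And>e z m u. e \<in> E \<Longrightarrow> entire u \<Longrightarrow> u z \<noteq> 0 \<Longrightarrow> 
      (\<And>w. Y w - e * X w = (w - z) ^ m * u w) \<Longrightarrow> m \<ge> 1 \<Longrightarrow> r e * m \<le> k * (m - 1)"
    and r: "\<And>e. e \<in> E \<Longrightarrow> r e \<le> k" and small: "(\<Sum>e\<in>E. k - r e) < k * (card E - 2)"
  shows False
proof -
  define L where "L = (\<lambda>e z. Y z - e * X z)"
  have L: "L e holomorphic_on UNIV" for e unfolding L_def by (intro holomorphic_intros X Y)
  have WL: "wr2 X (L e) = wr2 X Y" for e
    using wr2_lincomb[OF X Y, of 1 0 "-e" 1] by (auto simp: L_def fun_eq_iff)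
  have Lnz: "\<exists>z. L e z \<noteq> 0" for e
    using wr2_nonzero_imp(2)[of X "L e" w] W by (simp add: WL)
  define s where "s = (\<lambda>z. \<Prod>e\<in>E. L e z ^ r e)"
  have s: "entire s" unfolding s_def by (intro holomorphic_intros L)
  have "\<exists>z. \<forall>p\<in>L ` E. p z \<noteq> 0"
    using E(1) L Lnz by (intro generic_point_nonzero) auto
  then obtain w' where w': "\<And>e. e \<in> E \<Longrightarrow> L e w' \<noteq> 0" by auto
  obtain U where U: "entire U" "\<And>z. wr2 X Y z ^ k = s z * U z"
  proof (rule entire_divides[of "\<lambda>z. wr2 X Y z ^ k" s w'])
    show "entire (\<lambda>z. wr2 X Y z ^ k)" by (intro holomorphic_intros holomorphic_wr2 X Y)
    show "s w' \<noteq> 0" using w' E(1) by (simp add: s_def)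
    fix z
    show "\<exists>h H. entire h \<and> entire H \<and> h z \<noteq> 0 \<and> (\<forall>w. wr2 X Y w ^ k * h w = s w * H w)"
    proof (cases "\<exists>e\<in>E. L e z = 0")
      case False
      then have "s z \<noteq> 0" using E(1) by (simp add: s_def)
      then show ?thesis using s
        by (intro exI[of _ s] exI[of _ "\<lambda>w. wr2 X Y w ^ k"]) (auto intro!: holomorphic_intros holomorphic_wr2 X Y)
    next
      case True
      then obtain e0 where e0: "e0 \<in> E" "L e0 z = 0" by blast
      have Xz: "X z \<noteq> 0" using cop[of z] e0(2) by (auto simp: L_def)
      have others: "L e z \<noteq> 0" if "e \<noteq> e0" for e
        using e0(2) that Xz by (auto simp: L_def)
      obtain w1 where "L e0 w1 \<noteq> 0" using Lnz by blast
      then obtain m u where u: "entire u" "u z \<noteq> 0" "\<And>w. L e0 w = (w - z) ^ m * u w"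
        using entire_factor_at[OF L] by metis
      have "m \<ge> 1" using e0(2) u(2) u(3)[of z] by (cases m) auto
      then have "r e0 * m \<le> k * (m - 1)" using ram[OF e0(1) u(1,2)] u(3) by (simp add: L_def)
      from ramified_power_divides[OF X L u(1,3) this] obtain v where
        v: "entire v" "\<And>w. wr2 X Y w ^ k * u w ^ r e0 = L e0 w ^ r e0 * v w"
        unfolding WL by blast
      define P where "P = (\<lambda>w. \<Prod>e\<in>E - {e0}. L e w ^ r e)"
      have P: "entire P" unfolding P_def by (intro holomorphic_intros L)
      have "P z \<noteq> 0" using others E(1) by (simp add: P_def)
      moreover have sP: "s w = L e0 w ^ r e0 * P w" for w
        unfolding s_def P_def using E(1) e0(1) by (rule prod.remove)
      have "wr2 X Y w ^ k * (u w ^ r e0 * P w) = s w * v w" for w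
        unfolding mult.assoc[symmetric] v(2) sP by (simp only: mult_ac)
      ultimately show ?thesis using u v P
        by (intro exI[of _ "\<lambda>w. u w ^ r e0 * P w"] exI[of _ v]) (auto intro!: holomorphic_intros)
    qed
  qed (use s in blast)+
  define f where "f = (\<lambda>e::complex. (- e, 1::complex))"
  have inj: "inj_on f E" by (auto simp: f_def inj_on_def)
  have card: "card (f ` E) = card E" by (rule card_image[OF inj])
  define \<kappa> where "\<kappa> = (\<Sum>e\<in>E. k - r e)"
  define C where "C = (\<Prod>e\<in>E. (1 + norm e) ^ (k - r e))"
  show False
  proof (rule Cartan_line[OF X Y W, where J = "f ` E" and s = s and U = U and k = k and \<kappa> = \<kappa> and C = C])
    show "finite (f ` E)" "2 \<le> card (f ` E)" using E card by auto
    show "fst i * snd j - snd i * fst j \<noteq> 0" if "i \<in> f ` E" "j \<in> f ` E" "i \<noteq> j" for i j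
      using that by (auto simp: f_def)
    show "\<kappa> < k * (card (f ` E) - 2)" using small by (simp add: card \<kappa>_def)
    fix z
    define M where "M = norm (X z) + norm (Y z)"
    have "(\<Prod>j\<in>f ` E. fst j * X z + snd j * Y z) = (\<Prod>e\<in>E. L e z)"
      by (subst prod.reindex[OF inj]) (simp add: f_def L_def)
    then have "norm (\<Prod>j\<in>f ` E. fst j * X z + snd j * Y z) ^ k = (\<Prod>e\<in>E. norm (L e z) ^ k)"
      by (simp add: prod_norm[symmetric] prod_power_distrib)
    also have "\<dots> = (\<Prod>e\<in>E. norm (L e z ^ r e) * norm (L e z) ^ (k - r e))"
      using r by (intro prod.cong) (auto simp: norm_power power_add[symmetric])
    also have "\<dots> = norm (s z) * (\<Prod>e\<in>E. norm (L e z) ^ (k - r e))"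
      by (simp add: prod.distrib s_def prod_norm[symmetric])
    also have "\<dots> \<le> norm (s z) * (\<Prod>e\<in>E. ((1 + norm e) * M) ^ (k - r e))"
    proof (intro mult_left_mono prod_mono conjI power_mono)
      fix e
      have "norm (L e z) \<le> norm (Y z) + norm e * norm (X z)"
        unfolding L_def by (metis norm_mult norm_triangle_ineq4)
      also have "\<dots> \<le> (1 + norm e) * M" by (simp add: M_def distrib_left distrib_right)
      finally show "norm (L e z) \<le> (1 + norm e) * M" .
    qed auto
    also have "(\<Prod>e\<in>E. ((1 + norm e) * M) ^ (k - r e)) = C * M ^ \<kappa>"
      by (simp add: C_def \<kappa>_def power_mult_distrib prod.distrib power_sum)
    finally show "norm (\<Prod>j\<in>f ` E. fst j * X z + snd j * Y z) ^ k \<le> C * norm (s z) * (norm (X z) + norm (Y z)) ^ \<kappa>"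
      by (simp add: M_def mult_ac)
  qed (use s U in auto)
qed

lemma FRQ_factor:
  "\<exists>e1 e2. e1 \<noteq> e2 \<and> e1 \<noteq> 0 \<and> e2 \<noteq> 0 \<and>
     (\<forall>x0 x1. FRQ N x0 x1 = of_nat ((N + 2) * (N + 1)) / 2 * (x1 - e1 * x0) * (x1 - e2 * x0))"
proof -
  define t :: complex where "t = of_nat N"
  have nz: "t + 1 \<noteq> 0" "t + 2 \<noteq> 0" "t + 3 \<noteq> 0"
    unfolding t_def by (metis of_nat_Suc of_nat_neq_0 add.commute, metis of_nat_add of_nat_numeral of_nat_eq_0_iff add_is_0 zero_neq_numeral,
      metis of_nat_add of_nat_numeral of_nat_eq_0_iff add_is_0 zero_neq_numeral)
  \<comment> \<open>A quarter of the discriminant of the quadratic form, doubled to clear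
    denominators, is -(t+3)(t+1), because (t+3)(t+1) = (t+2)^2 - 1.\<close>
  define s where "s = csqrt (- ((t + 3) * (t + 1)))"
  have s2: "s * s = - ((t + 3) * (t + 1))" unfolding s_def by (simp add: power2_eq_square[symmetric])
  have "(t + 3) * (t + 1) \<noteq> 0" using nz by simp
  then have s0: "s \<noteq> 0" using s2 by (metis mult_zero_left neg_equal_0_iff_equal)
  define e1 e2 where "e1 = ((t + 3) * (t + 1) + s) / ((t + 2) * (t + 1))" and "e2 = ((t + 3) * (t + 1) - s) / ((t + 2) * (t + 1))"
  have c: "of_nat ((N + 2) * (N + 1)) = (t + 2) * (t + 1)"
    "of_nat ((N + 3) * (N + 1)) = (t + 3) * (t + 1)" "of_nat ((N + 3) * (N + 2)) = (t + 3) * (t + 2)"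
    by (simp_all add: t_def algebra_simps)
  have sum: "(t + 2) * (t + 1) * (e1 + e2) = 2 * ((t + 3) * (t + 1))"
    using nz by (simp add: e1_def e2_def add_divide_distrib[symmetric])
  have "(t + 2) * (t + 1) * ((t + 2) * (t + 1)) * (e1 * e2) = ((t + 3) * (t + 1) + s) * ((t + 3) * (t + 1) - s)"
    using nz by (simp add: e1_def e2_def)
  also have "\<dots> = (t + 3) * (t + 1) * ((t + 3) * (t + 1)) - s * s" by (simp add: algebra_simps)
  also have "\<dots> = (t + 2) * (t + 1) * ((t + 3) * (t + 2))" unfolding s2 by (simp add: algebra_simps)
  finally have prod: "(t + 2) * (t + 1) * (e1 * e2) = (t + 3) * (t + 2)"
    using nz by (simp add: mult.assoc)
  have "e1 * e2 \<noteq> 0" using prod nz by (metis mult_eq_0_iff)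
  then have e0: "e1 \<noteq> 0" "e2 \<noteq> 0" by auto
  have "e1 - e2 = 2 * s / ((t + 2) * (t + 1))" by (simp add: e1_def e2_def diff_divide_distrib[symmetric])
  then have "e1 \<noteq> e2" using s0 nz by auto
  moreover have "FRQ N x0 x1 = of_nat ((N + 2) * (N + 1)) / 2 * (x1 - e1 * x0) * (x1 - e2 * x0)" for x0 x1
  proof -
    have "2 * FRQ N x0 x1 = (t + 2) * (t + 1) * x1\<^sup>2 - 2 * ((t + 3) * (t + 1)) * (x1 * x0) + (t + 3) * (t + 2) * x0\<^sup>2"
      unfolding FRQ_def c by (simp add: field_simps)
    also have "\<dots> = (t + 2) * (t + 1) * x1\<^sup>2 - (t + 2) * (t + 1) * (e1 + e2) * (x1 * x0) + (t + 2) * (t + 1) * (e1 * e2) * x0\<^sup>2"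
      by (simp only: sum prod)
    also have "\<dots> = (t + 2) * (t + 1) * ((x1 - e1 * x0) * (x1 - e2 * x0))"
      by (simp add: algebra_simps power2_eq_square)
    finally show ?thesis unfolding c by (simp add: field_simps)
  qed
  ultimately show ?thesis using e0 by blast
qed

lemma isCont_entire: "entire f \<Longrightarrow> isCont f z"
  using holomorphic_on_imp_continuous_on continuous_on_eq_continuous_at open_UNIV by blast

context FR_pair
begin

text \<open>The hypothesis makes g0^(N+3) a multiple of f1^(N+1) (f1 - e1 f0)(f1 - e2 f0). All
  orders on the left are multiples of N + 3, so f1/f0 takes e1 and e2 with multiplicity at least N +
  3, and 0 with multiplicity at least 2.\<close>

lemma no_swap: "\<not> (\<forall>z. A4 z = \<gamma> * A1 z)"
proof
  assume A4: "\<forall>z. A4 z = \<gamma> * A1 z"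
  have \<gamma>: "\<gamma> \<noteq> 0"
  proof
    assume "\<gamma> = 0"
    then have "g0 z = 0" for z using A4 by simp
    then show False using nonzero(3) by blast
  qed
  obtain e1 e2 where e: "e1 \<noteq> e2" "e1 \<noteq> 0" "e2 \<noteq> 0" 
    and fac: "\<And>x0 x1. FRQ N x0 x1 = of_nat ((N + 2) * (N + 1)) / 2 * (x1 - e1 * x0) * (x1 - e2 * x0)"
    using FRQ_factor[of N] by blast
  define a :: complex where "a = \<gamma> * (of_nat ((N + 2) * (N + 1)) / 2)"
  have a: "a \<noteq> 0" using \<gamma> unfolding a_def by (metis mult_eq_0_iff divide_eq_0_iff of_nat_eq_0_iff zero_neq_numeral add_is_0 one_neq_zero)
  have g0: "g0 z ^ (N + 3) = a * f1 z ^ (N + 1) * ((f1 z - e1 * f0 z) * (f1 z - e2 * f0 z))" for z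
    using A4 by (simp add: FR_def fac a_def)
  obtain w where w: "wr2 f0 f1 w \<noteq> 0" using Wf by blast
  \<comment> \<open>With k = 6 the weights are 1/2 for the value 0 and 5/6 for e1 and e2, where only
    multiplicity 6 is used; their sum is 13/6 > 2.\<close>
  define r where "r = (\<lambda>e::complex. if e = 0 then 3 else 5 :: nat)"
  show False
  proof (rule ramified_line[OF hol(1,2) w copf, where E = "{0, e1, e2}" and r = r and k = 6])
    show "finite {0, e1, e2}" "card {0, e1, e2} \<ge> 2" using e by auto
    show "(\<Sum>e\<in>{0, e1, e2}. 6 - r e) < 6 * (card {0, e1, e2} - 2)" using e by (simp add: r_def)
    show "r e \<le> 6" for e by (simp add: r_def)
    fix e z m u
    assume eE: "e \<in> {0, e1, e2}" and u: "entire u" "u z \<noteq> 0"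
      and fu: "\<And>w. f1 w - e * f0 w = (w - z) ^ m * u w" and m: "m \<ge> 1"
    have z0: "f1 z - e * f0 z = 0" using fu[of z] m by simp
    then have f0z: "f0 z \<noteq> 0" using copf[of z] by auto
    obtain g' where "g0 g' \<noteq> 0" using nonzero(3) by blast
    then obtain p v where v: "entire v" "v z \<noteq> 0" "\<And>w. g0 w = (w - z) ^ p * v w"
      using entire_factor_at[OF hol(3)] by metis
    have pv: "g0 w ^ (N + 3) = (w - z) ^ (p * (N + 3)) * v w ^ (N + 3)" for w
      unfolding v(3) by (simp add: power_mult_distrib power_mult[symmetric])
    have root: "6 \<le> m" if e': "e' \<in> {e1, e2}" "e = e'" and e'': "e'' \<noteq> e'" "e'' \<in> {e1, e2}"
      and g0': "\<And>z. g0 z ^ (N + 3) = a * f1 z ^ (N + 1) * ((f1 z - e' * f0 z) * (f1 z - e'' * f0 z))" for e' e''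
    proof -
      let ?B = "\<lambda>w. a * f1 w ^ (N + 1) * (u w * (f1 w - e'' * f0 w))"
      have "p * (N + 3) = m"
      proof (rule power_factor_unique)
        show "\<forall>\<^sub>F w in at z. (w - z) ^ (p * (N + 3)) * v w ^ (N + 3) = (w - z) ^ m * ?B w"
          unfolding pv[symmetric] g0' using fu e' by (intro always_eventually) (auto simp: mult_ac)
        show "isCont (\<lambda>w. v w ^ (N + 3)) z" "isCont ?B z"
          by (intro isCont_entire holomorphic_intros v hol u)+
        show "v z ^ (N + 3) \<noteq> 0" using v(2) by simp
        show "?B z \<noteq> 0" using a z0 f0z e' e'' e u(2) by auto
      qed
      then show ?thesis using m N by (cases p) auto
    qed
    show "r e * m \<le> 6 * (m - 1)"
    proof (cases "e = 0")
      case True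
      \<comment> \<open>This excludes m = 1, as N + 1 is not a multiple of N + 3.\<close>
      have "p * (N + 3) = m * (N + 1)"
      proof (rule power_factor_unique)
        let ?B = "\<lambda>w. a * u w ^ (N + 1) * ((f1 w - e1 * f0 w) * (f1 w - e2 * f0 w))"
        show "\<forall>\<^sub>F w in at z. (w - z) ^ (p * (N + 3)) * v w ^ (N + 3) = (w - z) ^ (m * (N + 1)) * ?B w"
        proof (intro always_eventually allI)
          fix w
          have "f1 w ^ (N + 1) = (w - z) ^ (m * (N + 1)) * u w ^ (N + 1)"
            using fu[of w] True by (simp only: mult_zero_left diff_zero power_mult power_mult_distrib)
          then show "(w - z) ^ (p * (N + 3)) * v w ^ (N + 3) = (w - z) ^ (m * (N + 1)) * ?B w"
            unfolding pv[symmetric] g0 by (simp only: mult_ac)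
        qed
        show "isCont (\<lambda>w. v w ^ (N + 3)) z" "isCont ?B z"
          by (intro isCont_entire holomorphic_intros v hol u)+
        show "v z ^ (N + 3) \<noteq> 0" using v(2) by simp
        show "?B z \<noteq> 0" using a z0 f0z e u(2) True by auto
      qed
      then have "m \<noteq> 1" by (cases p) auto
      then show ?thesis using m True by (simp add: r_def)
    next
      case False
      then have "e = e1 \<or> e = e2" using eE by auto
      then have "6 \<le> m"
        using root[of e1 e2] root[of e2 e1] e g0 by (auto simp: mult_ac)
      then show ?thesis using False by (simp add: r_def)
    qed
  qed
qed

lemma same: "A2 z = A1 z" "A4 z = A3 z"
  using dichotomy no_swap by blast+

end

lemma linear_power_dvd_pderiv:
  fixes p :: "complex poly"
  assumes "[:-a, 1:] ^ Suc n dvd p"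
  shows "[:-a, 1:] ^ n dvd pderiv p"
proof -
  have lin: "pderiv (l ^ Suc n * q) = l ^ n * (l * pderiv q + smult (of_nat (Suc n)) (pderiv l) * q)" for l q :: "complex poly"
    unfolding pderiv_mult pderiv_power_Suc unfolding power_Suc by (simp add: algebra_simps)
  obtain q where "p = [:-a, 1:] ^ Suc n * q" using assms by (elim dvdE)
  then have "pderiv p = [:-a, 1:] ^ n * ([:-a, 1:] * pderiv q + smult (of_nat (Suc n)) (pderiv [:-a, 1:]) * q)"
    using lin[of "[:-a, 1:]" q] by simp
  then show ?thesis by (rule dvdI)
qed

section \<open>The equation P(f) = P(g)\<close>

text \<open>The discriminant of the quadratic equation relating \<open>x = f / g\<close> and \<open>g\<close> when \<open>P(f) = P(g)\<close>, up to a constant.\<close>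

definition disc_poly :: "nat \<Rightarrow> complex poly" where
  "disc_poly m = monom 1 (2 * m) - smult (of_nat m ^ 2) (monom 1 (m + 1))
     + smult (2 * (of_nat m ^ 2 - 1)) (monom 1 m) - smult (of_nat m ^ 2) (monom 1 (m - 1)) + 1"

lemma poly_disc_poly:
  "poly (disc_poly m) x = x ^ (2 * m) - of_nat m ^ 2 * x ^ (m + 1) + 2 * (of_nat m ^ 2 - 1) * x ^ m
     - of_nat m ^ 2 * x ^ (m - 1) + 1"
  by (simp add: disc_poly_def poly_monom)

text \<open>For a multiple root, p = 0 and x p' - m p = 0 become, in y = x^m, formulas for x (y^2 +
  1) and x (y^2 - 1). The difference of the squares of these is 4 x^2 y^2, and comparing the two
  sides leaves m^2 (m^2 - 1) (x - 1)^4 y^2 = 0.\<close>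

lemma disc_poly_simple_root:
  assumes m: "m \<ge> 2" and root: "poly (disc_poly m) x = 0" and x: "x \<noteq> 1"
  shows "poly (pderiv (disc_poly m)) x \<noteq> 0"
proof
  assume d: "poly (pderiv (disc_poly m)) x = 0"
  obtain l where l: "m = l + 2" using m by (metis le_add_diff_inverse2)
  define t :: complex where "t = of_nat m"
  have tnat: "t ^ 2 - 1 \<noteq> 0" "t \<noteq> 0"
  proof -
    have "t ^ 2 - 1 = of_nat ((l + 1) * (l + 3))" unfolding t_def l by (simp add: power2_eq_square algebra_simps)
    then show "t ^ 2 - 1 \<noteq> 0" by (simp only: of_nat_eq_0_iff) simp
    show "t \<noteq> 0" using m by (simp add: t_def)
  qed
  define u where "u = x ^ (l + 1)"
  have xm: "x ^ m = u * x" "x ^ (m - 1) = u" "x ^ (m - 1 - 1) * x = u" "x ^ (m + 1) = u * (x * x)"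
    by (simp_all add: u_def l mult_ac)
  have "x ^ (2 * m) = x ^ m * x ^ m" by (simp add: mult_2 power_add)
  moreover have "x ^ (2 * m - 1) = x ^ m * x ^ (m - 1)"
  proof -
    have "2 * m - 1 = m + (m - 1)" using m by simp
    then show ?thesis by (simp only: power_add)
  qed
  ultimately have pw: "x ^ (2 * m) = u * u * (x * x)" "x ^ (m + 1) = u * (x * x)" "x ^ m = u * x" "x ^ (m - 1) = u"
    "x ^ (2 * m - 1) = u * u * x" "x ^ (m - 1 - 1) * x = u"
    using xm by (simp_all add: mult_ac)
  have 1: "u * u * (x * x) - t\<^sup>2 * (u * (x * x)) + 2 * (t\<^sup>2 - 1) * (u * x) - t\<^sup>2 * u + 1 = 0"
    using root unfolding poly_disc_poly pw t_def .
  then have x0: "x \<noteq> 0" and u0: "u \<noteq> 0" by (auto simp: u_def)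
  have "poly (pderiv (disc_poly m)) x = 2 * t * x ^ (2 * m - 1) - t\<^sup>2 * (t + 1) * x ^ m
     + 2 * (t\<^sup>2 - 1) * t * x ^ (m - 1) - t\<^sup>2 * (t - 1) * x ^ (m - 1 - 1)"
    using m by (simp add: disc_poly_def pderiv_add pderiv_diff pderiv_smult pderiv_monom poly_monom t_def of_nat_diff algebra_simps)
  then have "(2 * t * x ^ (2 * m - 1) - t\<^sup>2 * (t + 1) * x ^ m + 2 * (t\<^sup>2 - 1) * t * x ^ (m - 1) - t\<^sup>2 * (t - 1) * x ^ (m - 1 - 1)) * x = 0"
    using d by simp
  then have "2 * t * (u * u * x * x) - t\<^sup>2 * (t + 1) * (u * x * x) + 2 * (t\<^sup>2 - 1) * t * (u * x) - t\<^sup>2 * (t - 1) * (x ^ (m - 1 - 1) * x) = 0"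
    unfolding pw(3,4,5) by (simp add: algebra_simps)
  then have 2: "2 * t * (u * u * x * x) - t\<^sup>2 * (t + 1) * (u * x * x) + 2 * (t\<^sup>2 - 1) * t * (u * x) - t\<^sup>2 * (t - 1) * u = 0"
    unfolding pw(6) .
  have "t * (u * u * (x * x) - t * (u * (x * x)) + t * u - 1) =
     (2 * t * (u * u * x * x) - t\<^sup>2 * (t + 1) * (u * x * x) + 2 * (t\<^sup>2 - 1) * t * (u * x) - t\<^sup>2 * (t - 1) * u)
     - t * (u * u * (x * x) - t\<^sup>2 * (u * (x * x)) + 2 * (t\<^sup>2 - 1) * (u * x) - t\<^sup>2 * u + 1)"
    by (simp add: algebra_simps power2_eq_square)
  then have 3: "u * u * (x * x) - t * (u * (x * x)) + t * u - 1 = 0" unfolding 1 2 using tnat by simp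
  define y where "y = u * x"
  have y0: "y \<noteq> 0" using u0 x0 by (simp add: y_def)
  have A: "x * (y\<^sup>2 - 1) = t * y * (x\<^sup>2 - 1)"
  proof -
    have "x * (u * u * (x * x) - t * (u * (x * x)) + t * u - 1) = 0" using 3 by simp
    then show ?thesis by (simp add: y_def algebra_simps power2_eq_square)
  qed
  have B: "x * (y\<^sup>2 + 1) = t\<^sup>2 * y * (x\<^sup>2 + 1) - 2 * (t\<^sup>2 - 1) * x * y"
  proof -
    have "x * (u * u * (x * x) - t\<^sup>2 * (u * (x * x)) + 2 * (t\<^sup>2 - 1) * (u * x) - t\<^sup>2 * u + 1) = 0" using 1 by simp
    then show ?thesis by (simp add: y_def algebra_simps power2_eq_square)
  qed
  have "4 * x\<^sup>2 * y\<^sup>2 = (x * (y\<^sup>2 + 1))\<^sup>2 - (x * (y\<^sup>2 - 1))\<^sup>2" by (simp add: algebra_simps power2_eq_square)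
  also have "\<dots> = (t\<^sup>2 * y * (x\<^sup>2 + 1) - 2 * (t\<^sup>2 - 1) * x * y)\<^sup>2 - (t * y * (x\<^sup>2 - 1))\<^sup>2" by (simp only: A B)
  also have "\<dots> = 4 * x\<^sup>2 * y\<^sup>2 + y\<^sup>2 * (t\<^sup>2 * (t\<^sup>2 - 1) * (x - 1) ^ 4)"
    by (simp add: algebra_simps power2_eq_square power4_eq_xxxx)
  finally have "y\<^sup>2 * (t\<^sup>2 * (t\<^sup>2 - 1) * (x - 1) ^ 4) = 0" by simp
  then show False using y0 tnat x by simp
qed

text \<open>The fourth derivative at 1 equals 2 m^2 (m^2 - 1), which is not 0.\<close>

lemma disc_poly_order_one:
  assumes m: "m \<ge> 5"
  shows "order 1 (disc_poly m) \<le> 4"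
proof (rule ccontr)
  assume "\<not> ?thesis"
  then have "[:-1, 1:] ^ 5 dvd disc_poly m" by (simp add: order_divides)
  then have "[:-1, 1:] ^ Suc (Suc (Suc (Suc (Suc 0)))) dvd disc_poly m" by (simp add: eval_nat_numeral)
  from linear_power_dvd_pderiv[OF linear_power_dvd_pderiv[OF linear_power_dvd_pderiv[OF linear_power_dvd_pderiv[OF this]]]]
  have 0: "poly (pderiv (pderiv (pderiv (pderiv (disc_poly m))))) 1 = 0" by (simp add: poly_eq_0_iff_dvd)
  obtain j where j: "m = j + 5" using m by (metis le_add_diff_inverse2)
  have "poly (pderiv (pderiv (pderiv (pderiv (disc_poly m))))) 1 = 2 * of_nat ((j + 5)\<^sup>2 * ((j + 4) * (j + 6)))"
    unfolding j disc_poly_def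
    by (simp add: pderiv_add pderiv_diff pderiv_smult pderiv_monom poly_monom numeral_eq_Suc)
       (simp add: algebra_simps power2_eq_square)
  then have "(of_nat ((j + 5)\<^sup>2 * ((j + 4) * (j + 6))) :: complex) = 0" using 0 by simp
  then show False by (simp only: of_nat_eq_0_iff) simp
qed

text \<open>Of the at least 2m \<ge> 10 roots counted with multiplicity, at most 4 lie at 1 and the
  others are simple. Five are kept: with weight 1/2 each they exceed the total ramification
  2.\<close>

lemma disc_poly_roots:
  assumes m: "m \<ge> 5"
  obtains E where "finite E" "card E = 5"
    "\<And>e. e \<in> E \<Longrightarrow> poly (disc_poly m) e = 0 \<and> poly (pderiv (disc_poly m)) e \<noteq> 0"
proof -
  let ?p = "disc_poly m"
  have "coeff ?p (2 * m) = 1" using m by (simp add: disc_poly_def)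
  then have deg: "2 * m \<le> degree ?p" and p0: "?p \<noteq> 0" by (auto intro!: le_degree)
  define R where "R = {x. poly ?p x = 0} - {1}"
  have finR: "finite {x. poly ?p x = 0}" using p0 by (rule poly_roots_finite)
  have simple: "poly (pderiv ?p) e \<noteq> 0" if "e \<in> R" for e
    using disc_poly_simple_root[of m e] that m by (auto simp: R_def)
  have ord: "order e ?p = 1" if "e \<in> R" for e
  proof -
    have "order e ?p = Suc (order e (pderiv ?p))" using that by (intro order_pderiv p0) (simp add: R_def)
    moreover have "order e (pderiv ?p) = 0" using simple[OF that] by (rule order_0I)
    ultimately show ?thesis by simp
  qed
  have "degree ?p = size (proots ?p)" by (simp add: size_proots_complex)
  also have "\<dots> = (\<Sum>x\<in>{x. poly ?p x = 0}. order x ?p)"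
    unfolding size_multiset_overloaded_eq using p0 by simp
  also have "\<dots> \<le> (\<Sum>x\<in>insert 1 R. order x ?p)"
    using finR by (intro sum_mono2) (auto simp: R_def)
  also have "\<dots> = order 1 ?p + (\<Sum>x\<in>R. order x ?p)" using finR by (subst sum.insert) (auto simp: R_def)
  also have "(\<Sum>x\<in>R. order x ?p) = card R" using ord by simp
  finally have "2 * m \<le> 4 + card R" using disc_poly_order_one[OF m] deg by linarith
  then have "5 \<le> card R" using m by linarith
  then obtain E where "E \<subseteq> R" "card E = 5" "finite E" by (rule obtain_subset_with_card_n)
  then show thesis using that[of E] simple by (auto simp: R_def)
qed

section \<open>Quotients in lowest terms and quadratic relations\<close>

lemma entire_mult_eq_0:
  assumes "entire f" "entire g" "\<And>z. f z * g z = 0" "g w \<noteq> 0"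
  shows "f z = 0"
proof (rule ccontr)
  assume "f z \<noteq> 0"
  then have "\<exists>z. \<forall>p\<in>{f, g}. p z \<noteq> 0" using assms by (intro generic_point_nonzero) auto
  then show False using assms(3) by auto
qed

text \<open>The Weierstrass factorization of the meromorphic function X/Y gives numerator and
  denominator without common zeros. The denominator q is nonzero at w because X/Y has no pole
  there.\<close>

lemma coprime_representation:
  assumes X: "entire X" and Y: "entire Y" "Y w \<noteq> 0"
  obtains p q where "entire p" "entire q" "\<And>z. p z \<noteq> 0 \<or> q z \<noteq> 0" 
    "q w \<noteq> 0" "\<And>z. X z * q z = Y z * p z"
proof -
  define g where "g = remove_sings (\<lambda>z. X z / Y z)"
  have an: "(\<lambda>z. X z / Y z) analytic_on {z}" if "Y z \<noteq> 0" for z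
    using that X Y(1) by (intro analytic_on_divide) (auto intro: holomorphic_on_imp_analytic_at)
  have gY: "g z = X z / Y z" if "Y z \<noteq> 0" for z unfolding g_def by (rule remove_sings_at_analytic[OF an[OF that]])
  have "(\<lambda>z. X z / Y z) meromorphic_on UNIV"
    using X Y(1) by (intro meromorphic_on_divide analytic_on_imp_meromorphic_on) (auto simp: analytic_on_open)
  then have "g nicely_meromorphic_on UNIV" unfolding g_def by (rule remove_sings_nicely_meromorphic)
  then obtain h f1 f2 where h: "entire h" "entire f1" "entire f2"
    "\<And>z. f1 z = 0 \<longleftrightarrow> \<not>is_pole g z \<and> g z = 0" "\<And>z. f2 z = 0 \<longleftrightarrow> is_pole g z" "\<And>z. h z \<noteq> 0"
    "\<And>z. g z = h z * f1 z / f2 z"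
    by (rule weierstrass_factorization_meromorphic_UNIV) blast
  have "\<not> is_pole g w"
    using remove_sings_analytic_on[OF an[OF Y(2)]] unfolding g_def
    by (metis analytic_at_imp_no_pole)
  show thesis
  proof (rule that[of "\<lambda>z. h z * f1 z" f2])
    show "entire (\<lambda>z. h z * f1 z)" "entire f2" by (intro holomorphic_intros h)+
    show "h z * f1 z \<noteq> 0 \<or> f2 z \<noteq> 0" for z using h(4,5,6) by auto
    show fw: "f2 w \<noteq> 0" using \<open>\<not> is_pole g w\<close> h(5) by auto
    have "(X z * f2 z - Y z * (h z * f1 z)) * (Y z * f2 z) = 0" for z
    proof (cases "Y z * f2 z = 0")
      case False
      then have "X z / Y z = h z * f1 z / f2 z" using gY[of z] h(7)[of z] by simp
      then show ?thesis using False by (simp add: field_simps)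
    qed simp
    then have "X z * f2 z - Y z * (h z * f1 z) = 0" for z
      using Y(2) fw by (intro entire_mult_eq_0[where g = "\<lambda>z. Y z * f2 z" and w = w and f = "\<lambda>z. X z * f2 z - Y z * (h z * f1 z)"])
        (auto intro!: holomorphic_intros X Y(1) h)
    then show "X z * f2 z = Y z * (h z * f1 z)" for z by simp
  qed
qed

text \<open>Let U and V be the partial derivatives of the form with respect to g and f.
  Differentiation gives U g' + V f' = 0 and Euler's identity gives U g + V f = 0. Hence U times the
  Wronskian vanishes, and U = 0 is a linear relation between f and g.\<close>

lemma quadratic_form_zero:
  assumes f: "entire f" and g: "entire g" and W: "wr2 f g w \<noteq> 0"
    and Q: "\<And>z. p * g z ^ 2 + q * (g z * f z) + r * f z ^ 2 = 0"
  shows "p = 0 \<and> q = 0"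
proof -
  let ?U = "\<lambda>z. 2 * p * g z + q * f z" and ?V = "\<lambda>z. q * g z + 2 * r * f z"
  have d: "?U z * deriv g z + ?V z * deriv f z = 0" for z
  proof -
    have "((\<lambda>z. p * g z ^ 2 + q * (g z * f z) + r * f z ^ 2) has_field_derivative ?U z * deriv g z + ?V z * deriv f z) (at z)"
      by (auto intro!: derivative_eq_intros entire_deriv f g simp: algebra_simps)
    moreover have "(\<lambda>z. p * g z ^ 2 + q * (g z * f z) + r * f z ^ 2) = (\<lambda>z. 0)" using Q by auto
    ultimately show ?thesis by (metis DERIV_const DERIV_unique)
  qed
  have U: "?U z * wr2 f g z = 0" for z
  proof -
    have "?U z * wr2 f g z = f z * (?U z * deriv g z + ?V z * deriv f z) - deriv f z * 2 * (p * g z ^ 2 + q * (g z * f z) + r * f z ^ 2)"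
      by (simp add: wr2_def algebra_simps power2_eq_square)
    then show ?thesis by (simp only: d Q) simp
  qed
  have U0: "?U z = 0" for z
    by (rule entire_mult_eq_0[OF _ holomorphic_wr2[OF f g] U W]) (intro holomorphic_intros f g)
  then have "(\<lambda>z. (2 * p) * g z + q * f z) = (\<lambda>z. 0)" by auto
  then have "2 * p * deriv g w + q * deriv f w = 0" using deriv_lincomb[OF g f, of "2 * p" q] by (metis deriv_const)
  then have "2 * p * wr2 f g w = 0" "q * wr2 f g w = 0"
    using U0[of w] unfolding wr2_def by algebra+
  then show ?thesis using W by simp
qed

section \<open>Equality of the two quotients\<close>

context FR_pair
begin

text \<open>Differentiating the equality of the (N+3)-th powers makes the Wronskian of f0 and g0
  vanish; the constant of proportionality is then a root of unity.\<close>

lemma proportional_g0: "\<exists>\<zeta>. \<zeta> ^ (N + 3) = 1 \<and> (\<forall>z. g0 z = \<zeta> * f0 z)"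
proof -
  have dp: "((\<lambda>z. f z ^ (N + 3)) has_field_derivative of_nat (N + 3) * (deriv f z * f z ^ (N + 2))) (at z)"
    if "entire f" for f z
    using DERIV_power_Suc[OF entire_deriv[OF that, of z], of "N + 2"] by (simp add: numeral_3_eq_3)
  have "A4 = A3" using same by auto
  then have "of_nat (N + 3) * (deriv f0 z * f0 z ^ (N + 2)) = of_nat (N + 3) * (deriv g0 z * g0 z ^ (N + 2))" for z
    using dp[OF hol(1), of z] dp[OF hol(3), of z] by (metis DERIV_unique)
  moreover have "(of_nat (N + 3) :: complex) \<noteq> 0" by (subst of_nat_eq_0_iff) simp
  ultimately have e: "deriv f0 z * f0 z ^ (N + 2) = deriv g0 z * g0 z ^ (N + 2)" for z by simp
  have "wr2 f0 g0 z * g0 z ^ (N + 2) = 0" for z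
  proof -
    have "wr2 f0 g0 z * g0 z ^ (N + 2) = f0 z * (deriv g0 z * g0 z ^ (N + 2)) - deriv f0 z * (g0 z * g0 z ^ (N + 2))"
      by (simp add: wr2_def algebra_simps)
    also have "\<dots> = deriv f0 z * (f0 z * f0 z ^ (N + 2)) - deriv f0 z * (g0 z * g0 z ^ (N + 2))"
      unfolding e[symmetric] by (simp only: mult_ac)
    also have "\<dots> = deriv f0 z * A3 z - deriv f0 z * A4 z" by (simp add: numeral_3_eq_3)
    finally show ?thesis by (simp add: same(2))
  qed
  moreover obtain w where "g0 w \<noteq> 0" using nonzero(3) by blast
  ultimately have "wr2 f0 g0 z = 0" for z
    by (intro entire_mult_eq_0[where g = "\<lambda>z. g0 z ^ (N + 2)" and w = w and f = "wr2 f0 g0"])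
       (auto intro!: holomorphic_wr2 holomorphic_intros hol)
  moreover obtain v where v: "f0 v \<noteq> 0" using nonzero(1) by blast
  ultimately obtain \<zeta> where \<zeta>: "\<And>z. g0 z = \<zeta> * f0 z" using wr2_eq_zero_imp[OF hol(1) v hol(3)] by blast
  have "\<zeta> ^ (N + 3) * f0 v ^ (N + 3) = f0 v ^ (N + 3)" using same(2)[of v] by (simp add: \<zeta> power_mult_distrib)
  then have "\<zeta> ^ (N + 3) = 1" using v by simp
  then show ?thesis using \<zeta> by blast
qed

text \<open>The homogeneous form of \<open>disc_poly (N + 2)\<close>, of degree 2 (N + 2).\<close>

definition hdisc :: "complex \<Rightarrow> complex \<Rightarrow> complex" where
  "hdisc x y = x ^ (2 * (N + 2)) - of_nat (N + 2) ^ 2 * (x ^ (N + 3) * y ^ (N + 1))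
     + 2 * (of_nat (N + 2) ^ 2 - 1) * (x ^ (N + 2) * y ^ (N + 2))
     - of_nat (N + 2) ^ 2 * (x ^ (N + 1) * y ^ (N + 3)) + y ^ (2 * (N + 2))"

lemma hdisc_mult: "hdisc (t * x) (t * y) = t ^ (2 * (N + 2)) * hdisc x y"
proof -
  define T where "T = t ^ (2 * (N + 2))"
  have *: "(t * x) ^ i * (t * y) ^ j = T * (x ^ i * y ^ j)" if "i + j = 2 * (N + 2)" for i j
  proof -
    have "T = t ^ i * t ^ j" unfolding T_def that[symmetric] by (rule power_add)
    then show ?thesis unfolding power_mult_distrib by (simp only: mult_ac)
  qed
  have gen: "T * a - k * (T * b) + l * (T * d) - k * (T * e) + T * g = T * (a - k * b + l * d - k * e + g)" for a b d e g k l
    by (simp add: algebra_simps)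
  have pw: "(t * x) ^ (2 * (N + 2)) = T * x ^ (2 * (N + 2))" "(t * y) ^ (2 * (N + 2)) = T * y ^ (2 * (N + 2))"
    "(t * x) ^ (N + 3) * (t * y) ^ (N + 1) = T * (x ^ (N + 3) * y ^ (N + 1))"
    "(t * x) ^ (N + 2) * (t * y) ^ (N + 2) = T * (x ^ (N + 2) * y ^ (N + 2))"
    "(t * x) ^ (N + 1) * (t * y) ^ (N + 3) = T * (x ^ (N + 1) * y ^ (N + 3))"
    by (simp only: T_def power_mult_distrib, simp only: T_def power_mult_distrib, (rule *, simp)+)
  show ?thesis unfolding hdisc_def pw T_def[symmetric] by (rule gen)
qed

lemma hdisc_poly: "y \<noteq> 0 \<Longrightarrow> hdisc x y = y ^ (2 * (N + 2)) * poly (disc_poly (N + 2)) (x / y)"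
proof -
  assume y: "y \<noteq> 0"
  have "hdisc (y * (x / y)) (y * 1) = y ^ (2 * (N + 2)) * hdisc (x / y) 1" by (rule hdisc_mult)
  moreover have "hdisc (x / y) 1 = poly (disc_poly (N + 2)) (x / y)"
    unfolding hdisc_def poly_disc_poly by (simp add: numeral_3_eq_3)
  ultimately show ?thesis using y by simp
qed

text \<open>For fixed x and y the hypothesis is a quadratic equation A x0^2 - 2 B x0 + C = 0.
  Completing the square gives (A x0 - B)^2 = B^2 - A C, and the right-hand side is a multiple of
  \<open>hdisc\<close>.\<close>

lemma hdisc_square:
  assumes "FR N x0 x = FR N x0 y"
  shows "(of_nat ((N + 3) * (N + 2)) * x0 * (x ^ (N + 1) - y ^ (N + 1)) - of_nat ((N + 3) * (N + 1)) * (x ^ (N + 2) - y ^ (N + 2)))\<^sup>2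
     = - of_nat ((N + 3) * (N + 1)) * hdisc x y"
proof -
  define t u v :: complex where "t = of_nat N" and "u = x ^ (N + 1)" and "v = y ^ (N + 1)"
  have c: "of_nat ((N + 2) * (N + 1)) = (t + 2) * (t + 1)" "of_nat (N + 2) = t + 2"
    "of_nat ((N + 3) * (N + 1)) = (t + 3) * (t + 1)" "of_nat ((N + 3) * (N + 2)) = (t + 3) * (t + 2)"
    by (simp_all add: t_def algebra_simps)
  have pw: "x ^ (N + 2) = u * x" "y ^ (N + 2) = v * y" "x ^ (N + 3) = u * x * x" "y ^ (N + 3) = v * y * y"
    "x ^ (2 * (N + 2)) = u * u * x * x" "y ^ (2 * (N + 2)) = v * v * y * y"
    by (simp_all add: u_def v_def numeral_3_eq_3 numeral_2_eq_2 power_add mult_ac)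
  have two: "2 * FR N x0 w = w ^ (N + 1) * ((t + 2) * (t + 1) * w\<^sup>2 - 2 * ((t + 3) * (t + 1)) * w * x0 + (t + 3) * (t + 2) * x0\<^sup>2)" for w
  proof -
    have "2 * (p * (a / 2 * q - b * w * x0 + d / 2 * e)) = p * (a * q - 2 * b * w * x0 + d * e)" for p a q b d e :: complex
      by (simp add: algebra_simps)
    then show ?thesis unfolding FR_def FRQ_def c .
  qed
  have "u * ((t + 2) * (t + 1) * x\<^sup>2 - 2 * ((t + 3) * (t + 1)) * x * x0 + (t + 3) * (t + 2) * x0\<^sup>2) =
    v * ((t + 2) * (t + 1) * y\<^sup>2 - 2 * ((t + 3) * (t + 1)) * y * x0 + (t + 3) * (t + 2) * x0\<^sup>2)"
    using assms two[of x] two[of y] by (simp only: u_def v_def)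
  then have *: "(t + 3) * (t + 2) * x0\<^sup>2 * (u - v) = 2 * ((t + 3) * (t + 1)) * x0 * (u * x - v * y) - (t + 2) * (t + 1) * (u * x\<^sup>2 - v * y\<^sup>2)"
    by (simp add: algebra_simps)
  have "((t + 3) * (t + 2) * x0 * (u - v) - (t + 3) * (t + 1) * (u * x - v * y))\<^sup>2
    = (t + 3) * (t + 2) * (u - v) * ((t + 3) * (t + 2) * x0\<^sup>2 * (u - v)) - 2 * ((t + 3) * (t + 2) * x0 * (u - v)) * ((t + 3) * (t + 1) * (u * x - v * y)) + ((t + 3) * (t + 1) * (u * x - v * y))\<^sup>2"
    by (simp add: power2_eq_square algebra_simps)
  also have "\<dots> = ((t + 3) * (t + 1) * (u * x - v * y))\<^sup>2 - (t + 3) * (t + 2) * (u - v) * ((t + 2) * (t + 1) * (u * x\<^sup>2 - v * y\<^sup>2))"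
    unfolding * by (simp add: power2_eq_square algebra_simps)
  also have "\<dots> = - ((t + 3) * (t + 1)) * (u * u * x * x - (t + 2)\<^sup>2 * (u * x * x * v) + 2 * ((t + 2)\<^sup>2 - 1) * (u * x * (v * y)) - (t + 2)\<^sup>2 * (u * (v * y * y)) + v * v * y * y)"
    by (simp add: power2_eq_square algebra_simps)
  finally show ?thesis unfolding hdisc_def pw c u_def[symmetric] v_def[symmetric] .
qed

end

lemma FR_scale: "FR N (t * x0) (t * x1) = t ^ (N + 3) * FR N x0 x1"
proof -
  have "FRQ N (t * x0) (t * x1) = t\<^sup>2 * FRQ N x0 x1"
    unfolding FRQ_def by (simp add: power2_eq_square algebra_simps)
  moreover have "t ^ (N + 3) = t ^ (N + 1) * t\<^sup>2" by (simp add: power_add[symmetric] numeral_3_eq_3)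
  ultimately show ?thesis unfolding FR_def by (simp only: power_mult_distrib mult_ac)
qed

context FR_pair
begin

lemma ratio_eq: "f1 z * g0 z = g1 z * f0 z"
proof -
  obtain \<zeta> where \<zeta>: "\<zeta> ^ (N + 3) = 1" "\<And>z. g0 z = \<zeta> * f0 z" using proportional_g0 by blast
  have \<zeta>0: "\<zeta> \<noteq> 0" using \<zeta>(1) by (auto simp: zero_power)
  \<comment> \<open>Dividing by the root of unity gives f and g the same denominator f0, so that
    only f1 and Y remain to be compared.\<close>
  define Y where "Y = (\<lambda>z. g1 z / \<zeta>)"
  have Y: "entire Y" unfolding Y_def by (intro holomorphic_intros hol) (use \<zeta>0 in auto)
  have g1: "g1 z = \<zeta> * Y z" for z using \<zeta>0 by (simp add: Y_def)
  have FReq: "FR N (f0 z) (f1 z) = FR N (f0 z) (Y z)" for z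
    using same(1)[of z] unfolding \<zeta>(2) g1 FR_scale \<zeta>(1) by simp
  obtain v where v: "wr2 g0 g1 v \<noteq> 0" using Wg by blast
  have "g0 = (\<lambda>z. \<zeta> * f0 z + 0 * Y z)" "g1 = (\<lambda>z. 0 * f0 z + \<zeta> * Y z)" using \<zeta>(2) g1 by auto
  then have "wr2 g0 g1 v = (\<zeta> * \<zeta> - 0 * 0) * wr2 f0 Y v" using wr2_lincomb[OF hol(1) Y] by metis
  then have WY: "wr2 f0 Y v \<noteq> 0" using v by auto
  obtain y where y: "Y y \<noteq> 0" using wr2_nonzero_imp(2)[OF WY] by blast
  obtain p q where p: "entire p" and q: "entire q" and cop: "\<And>z. p z \<noteq> 0 \<or> q z \<noteq> 0"
    and qy: "q y \<noteq> 0" and XY: "\<And>z. f1 z * q z = Y z * p z"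
    using coprime_representation[OF hol(2) Y y] by blast
  have "f1 z = Y z" for z
  proof (cases "\<exists>w. wr2 q p w \<noteq> 0")
    case False
    then obtain t where t: "\<And>z. p z = t * q z" using wr2_eq_zero_imp[OF q qy p] by blast
    have f1: "f1 z = t * Y z" for z
    proof -
      have "(f1 z - t * Y z) * q z = 0" for z using XY[of z] by (simp add: t algebra_simps)
      then have "f1 z - t * Y z = 0" using qy
        by (intro entire_mult_eq_0[where g = q and w = y and f = "\<lambda>z. f1 z - t * Y z"]) (auto intro!: holomorphic_intros hol Y q)
      then show ?thesis by simp
    qed
    \<comment> \<open>Constant ratio t: \<open>FReq\<close> becomes a quadratic form in Y and f0
      with constant coefficients. Their vanishing gives t^(N+3) = t^(N+2) = 1, hence t = 1.\<close>
    define a b d :: complex where "a = of_nat ((N + 2) * (N + 1)) / 2" and "b = of_nat ((N + 3) * (N + 1))" and "d = of_nat ((N + 3) * (N + 2)) / 2"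
    have ab: "a \<noteq> 0" "b \<noteq> 0" unfolding a_def b_def
      by (subst divide_eq_0_iff, subst of_nat_eq_0_iff, simp, subst of_nat_eq_0_iff, simp)
    let ?F = "\<lambda>z. (a * (t ^ (N + 3) - 1)) * Y z ^ 2 + (- b * (t ^ (N + 2) - 1)) * (Y z * f0 z) + (d * (t ^ (N + 1) - 1)) * f0 z ^ 2"
    have F0: "?F z * Y z ^ (N + 1) = 0" for z
    proof -
      have "t ^ (N + 3) = t ^ (N + 1) * t * t" "t ^ (N + 2) = t ^ (N + 1) * t" by (simp_all add: numeral_3_eq_3)
      then have "?F z * Y z ^ (N + 1) = FR N (f0 z) (t * Y z) - FR N (f0 z) (Y z)"
        unfolding FR_def FRQ_def a_def[symmetric] b_def[symmetric] d_def[symmetric] power_mult_distrib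
        by (simp add: algebra_simps power2_eq_square)
      then show ?thesis using FReq[of z] unfolding f1 by simp
    qed
    have "?F z = 0" for z
    proof (rule entire_mult_eq_0[where f = "?F" and g = "\<lambda>z. Y z ^ (N + 1)" and w = y])
      show "entire ?F" "entire (\<lambda>z. Y z ^ (N + 1))"
        by (intro holomorphic_intros hol Y)+
      show "?F z * Y z ^ (N + 1) = 0" for z by (rule F0)
      show "Y y ^ (N + 1) \<noteq> 0" using y by simp
    qed
    from quadratic_form_zero[OF hol(1) Y WY this] have "t ^ (N + 3) = 1" "t ^ (N + 2) = 1" using ab by auto
    then have "t = 1" by (simp add: numeral_3_eq_3)
    then show ?thesis using f1 by simp
  next
    case True
    then obtain w where w: "wr2 q p w \<noteq> 0" by blast
    define m where "m = N + 2"
    obtain E where E: "finite E" "card E = 5" 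
      and root: "\<And>e. e \<in> E \<Longrightarrow> poly (disc_poly m) e = 0 \<and> poly (pderiv (disc_poly m)) e \<noteq> 0"
      using disc_poly_roots[of m] N by (auto simp: m_def)
    define K where "K = (\<lambda>z. of_nat ((N + 3) * (N + 2)) * f0 z * (f1 z ^ (N + 1) - Y z ^ (N + 1)) - of_nat ((N + 3) * (N + 1)) * (f1 z ^ (N + 2) - Y z ^ (N + 2)))"
    define k :: complex where "k = - of_nat ((N + 3) * (N + 1))"
    have k0: "k \<noteq> 0" unfolding k_def by (subst neg_equal_0_iff_equal, subst of_nat_eq_0_iff) simp
    have K: "entire K" unfolding K_def by (intro holomorphic_intros hol Y)
    have K2: "K z ^ 2 = k * hdisc (f1 z) (Y z)" for z
      unfolding K_def k_def by (rule hdisc_square[OF FReq])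
    have main: "Y z ^ (2 * m) * (k * hdisc (p z) (q z)) = (q z ^ m * K z) ^ 2" for z
    proof -
      have "Y z ^ (2 * m) * hdisc (p z) (q z) = hdisc (Y z * p z) (Y z * q z)" unfolding m_def by (rule hdisc_mult[symmetric])
      also have "\<dots> = hdisc (q z * f1 z) (q z * Y z)" using XY[of z] by (simp only: mult.commute)
      also have "\<dots> = q z ^ (2 * m) * hdisc (f1 z) (Y z)" unfolding m_def by (rule hdisc_mult)
      finally have "Y z ^ (2 * m) * (k * hdisc (p z) (q z)) = q z ^ (2 * m) * (k * hdisc (f1 z) (Y z))" by simp
      also have "\<dots> = (q z ^ m * K z) ^ 2" unfolding K2[symmetric] by (simp add: power_mult_distrib power_mult[symmetric] mult.commute[of m])
      finally show ?thesis .
    qed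
    have False
    \<comment> \<open>Each of the five roots e is a value of p/q that is taken with even
      multiplicities only, hence weight 1/2, and 5/2 > 2.\<close>
    proof (rule ramified_line[OF q p w _ E(1), where r = "\<lambda>_. 1" and k = 2])
      show "q z \<noteq> 0 \<or> p z \<noteq> 0" for z using cop[of z] by blast
      show "2 \<le> card E" "(\<Sum>e\<in>E. 2 - 1) < 2 * (card E - 2)" using E by simp_all
      fix e z \<mu> u
      assume e: "e \<in> E" and u: "entire u" "u z \<noteq> 0" 
        and pu: "\<And>w. p w - e * q w = (w - z) ^ \<mu> * u w" and \<mu>: "1 \<le> (\<mu>::nat)"
      have "p z - e * q z = 0" using pu[of z] \<mu> by simp
      then have qz: "q z \<noteq> 0" and pq: "p z / q z = e" using cop[of z] by (auto simp: field_simps)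
      obtain R where R: "disc_poly m = [:-e, 1:] * R" using root[OF e] by (auto simp: poly_eq_0_iff_dvd elim!: dvdE)
      have "poly (pderiv (disc_poly m)) e = poly R e" unfolding R pderiv_mult by (simp add: pderiv_pCons)
      then have Re: "poly R e \<noteq> 0" using root[OF e] by simp
      define T where "T = (\<lambda>w. k * (q w ^ (2 * m - 1) * (u w * poly R (p w / q w))))"
      have cT: "isCont T z" unfolding T_def
        using qz by (intro continuous_intros isCont_entire p q u) auto
      have Tz: "T z \<noteq> 0" using qz k0 u(2) Re pq by (simp add: T_def)
      have evq: "\<forall>\<^sub>F w in at z. q w \<noteq> 0"
        by (rule tendsto_imp_eventually_ne[OF isContD[OF isCont_entire[OF q]] qz])
      have eqT: "k * hdisc (p w) (q w) = (w - z) ^ \<mu> * T w" if "q w \<noteq> 0" for w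
      proof -
        have "hdisc (p w) (q w) = q w ^ (2 * m) * poly (disc_poly m) (p w / q w)"
          unfolding m_def by (rule hdisc_poly[OF that])
        also have "poly (disc_poly m) (p w / q w) = (p w / q w - e) * poly R (p w / q w)"
          unfolding R by (simp add: left_diff_distrib)
        also have "q w ^ (2 * m) = q w ^ (2 * m - 1) * q w" by (simp add: m_def)
        finally have "hdisc (p w) (q w) = q w ^ (2 * m - 1) * ((q w * (p w / q w - e)) * poly R (p w / q w))" by (simp only: mult_ac)
        also have "q w * (p w / q w - e) = (w - z) ^ \<mu> * u w" unfolding pu[symmetric] using that by (simp add: field_simps)
        finally show ?thesis unfolding T_def by (simp only: mult_ac)
      qed
      obtain i y' where y': "entire y'" "y' z \<noteq> 0" "\<And>w. Y w = (w - z) ^ i * y' w"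
        using entire_factor_at[OF Y y] by metis
      \<comment> \<open>The left-hand side of \<open>main\<close> is nonzero close to z, so K has a
        finite order j there. Comparing orders gives 2 m i + \<mu> = 2 j, and \<mu> is even.\<close>
      have "\<exists>w. K w \<noteq> 0"
      proof -
        have "isCont (\<lambda>w. y' w ^ (2 * m) * T w) z" by (intro continuous_intros isCont_entire y' cT)
        moreover have "y' z ^ (2 * m) * T z \<noteq> 0" using y'(2) Tz by simp
        ultimately have "\<forall>\<^sub>F w in at z. y' w ^ (2 * m) * T w \<noteq> 0"
          by (rule tendsto_imp_eventually_ne[OF isContD])
        moreover have "\<forall>\<^sub>F w in at z. w \<noteq> z" by (simp add: eventually_at_filter)
        ultimately have "\<forall>\<^sub>F w in at z. K w \<noteq> 0" using evq
        proof eventually_elim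
          case (elim w)
          have "Y w ^ (2 * m) * (k * hdisc (p w) (q w)) \<noteq> 0"
            unfolding eqT[OF elim(3)] y'(3) using elim by simp
          then show ?case unfolding main by auto
        qed
        then show ?thesis by (rule eventually_happens'[OF at_neq_bot])
      qed
      then obtain K0 where "K K0 \<noteq> 0" by blast
      then obtain j \<kappa> where \<kappa>: "entire \<kappa>" "\<kappa> z \<noteq> 0" "\<And>w. K w = (w - z) ^ j * \<kappa> w"
        using entire_factor_at[OF K] by metis
      have "2 * m * i + \<mu> = 2 * j"
      proof (rule power_factor_unique)
        show "\<forall>\<^sub>F w in at z. (w - z) ^ (2 * m * i + \<mu>) * (y' w ^ (2 * m) * T w) = (w - z) ^ (2 * j) * (q w ^ m * \<kappa> w) ^ 2"
          using evq
        proof eventually_elim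
          case (elim w)
          have "(w - z) ^ (2 * m * i + \<mu>) * (y' w ^ (2 * m) * T w) = Y w ^ (2 * m) * ((w - z) ^ \<mu> * T w)"
            unfolding y'(3) power_mult_distrib power_add by (simp only: power_mult[symmetric] mult_ac)
          also have "\<dots> = (q w ^ m * K w) ^ 2" unfolding eqT[OF elim, symmetric] by (rule main)
          also have "\<dots> = (w - z) ^ (2 * j) * (q w ^ m * \<kappa> w) ^ 2"
            unfolding \<kappa>(3) power_mult_distrib by (simp only: power_mult[symmetric] mult_ac)
          finally show ?case .
        qed
        show "isCont (\<lambda>w. y' w ^ (2 * m) * T w) z" by (intro continuous_intros isCont_entire y' cT)
        show "isCont (\<lambda>w. (q w ^ m * \<kappa> w) ^ 2) z" by (intro continuous_intros isCont_entire q \<kappa>)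
        show "y' z ^ (2 * m) * T z \<noteq> 0" using y'(2) Tz by simp
        show "(q z ^ m * \<kappa> z) ^ 2 \<noteq> 0" using qz \<kappa>(2) by simp
      qed
      then have "even (2 * m * i + \<mu>)" by simp
      then have "\<mu> \<noteq> 1" by auto
      then show "1 * \<mu> \<le> 2 * (\<mu> - 1)" using \<mu> by simp
    qed simp
    then show ?thesis ..
  qed
  then show ?thesis unfolding \<zeta>(2) g1 by simp
qed

end

section \<open>Meromorphic functions sharing the roots\<close>

text \<open>A vanishing Wronskian would make the numerator a constant multiple of the denominator;
  without common zeros the denominator is then zero-free and f is constant. At a pole the quotient
  reads x/0 = 0, which is the value of the normalised representative.\<close>

lemma meromorphic_quotient:
  assumes f: "f nicely_meromorphic_on UNIV" "\<not> f constant_on UNIV"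
  obtains f0 f1 where "entire f0" "entire f1" "\<And>z. f0 z \<noteq> 0 \<or> f1 z \<noteq> 0"
    "\<And>z. is_pole f z \<longleftrightarrow> f0 z = 0" "\<And>z. f z = f1 z / f0 z" "\<exists>w. wr2 f0 f1 w \<noteq> 0"
proof -
  obtain h p q where h: "entire h" "entire p" "entire q"
    "\<And>z. p z = 0 \<longleftrightarrow> \<not> is_pole f z \<and> f z = 0" "\<And>z. q z = 0 \<longleftrightarrow> is_pole f z" "\<And>z. h z \<noteq> 0"
    "\<And>z. f z = h z * p z / q z"
    by (rule weierstrass_factorization_meromorphic_UNIV[OF f(1)]) blast
  have hp: "entire (\<lambda>z. h z * p z)" by (intro holomorphic_intros h)
  have cop: "q z \<noteq> 0 \<or> h z * p z \<noteq> 0" for z using h(4,5,6) by auto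
  have "\<exists>w. wr2 q (\<lambda>z. h z * p z) w \<noteq> 0"
  proof (rule ccontr)
    assume W: "\<not> ?thesis"
    have "\<exists>w. q w \<noteq> 0"
    proof (rule ccontr)
      assume "\<not> ?thesis"
      then have "f z = 0" for z using h(7) by simp
      then show False using f(2) by (auto simp: constant_on_def)
    qed
    then obtain c where c: "\<And>z. h z * p z = c * q z"
      using wr2_eq_zero_imp[OF h(3) _ hp] W by blast
    then have "q z \<noteq> 0" for z using cop[of z] by auto
    then have "f z = c" for z using h(7)[of z] c[of z] by simp
    then show False using f(2) by (auto simp: constant_on_def)
  qed
  then show thesis using that[OF h(3) hp cop] h(5,7) by blast
qed

section \<open>Simple roots and shared multiplicities\<close>

definition fr_poly :: "nat \<Rightarrow> complex \<Rightarrow> complex poly" where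
  "fr_poly N c = monom (of_nat ((N + 2) * (N + 1)) / 2) (N + 3) - monom (of_nat ((N + 3) * (N + 1))) (N + 2)
     + monom (of_nat ((N + 3) * (N + 2)) / 2) (N + 1) - [:c:]"

lemma poly_fr_poly: "poly (fr_poly N c) x = FR N 1 x - c"
  by (simp add: fr_poly_def poly_monom FR_def FRQ_def power2_eq_square numeral_3_eq_3 distrib_left right_diff_distrib mult_ac)

lemma frank_reinders_eq: "frank_reinders (N + 3) c x = FR N 1 x - c"
proof -
  define t u :: complex where "t = of_nat N" and "u = x ^ (N + 1)"
  have c: "of_nat ((N + 2) * (N + 1)) = (t + 2) * (t + 1)" "of_nat ((N + 3) * (N + 1)) = (t + 3) * (t + 1)"
    "of_nat ((N + 3) * (N + 2)) = (t + 3) * (t + 2)" "of_nat (N + 3) = t + 3"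
    by (simp_all add: t_def algebra_simps)
  have "x ^ (N + 3) = u * x * x" "x ^ (N + 3 - 1) = u * x" "x ^ (N + 3 - 2) = u"
    by (simp_all add: u_def numeral_3_eq_3 numeral_2_eq_2)
  moreover have "t + 3 - 1 = t + 2" "t + 3 - 2 = t + 1" by simp_all
  ultimately show ?thesis
    unfolding frank_reinders_def FR_def FRQ_def c u_def[symmetric] by (simp add: algebra_simps power2_eq_square)
qed

text \<open>The only critical points are 0 and 1, where the polynomial takes the values -c and 1 -
  c.\<close>

lemma fr_poly_simple_root:
  assumes c: "c \<noteq> 0" "c \<noteq> 1" and a: "poly (fr_poly N c) a = 0"
  shows "poly (pderiv (fr_poly N c)) a \<noteq> 0"
proof -
  have e: "poly (pderiv (fr_poly N c)) a = of_nat ((N + 3) * (N + 2) * (N + 1)) / 2 * a ^ N * (a - 1)\<^sup>2"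
    by (simp add: fr_poly_def pderiv_add pderiv_diff pderiv_monom poly_monom pderiv_pCons numeral_3_eq_3 numeral_2_eq_2 field_simps)
  have "a \<noteq> 0" using a c(1) unfolding poly_fr_poly FR_def by auto
  moreover have "a \<noteq> 1"
  proof
    assume "a = 1"
    have "FR N 1 1 = 1" unfolding FR_def FRQ_def by (simp add: field_simps)
    then show False using a c(2) \<open>a = 1\<close> unfolding poly_fr_poly by simp
  qed
  moreover have "(of_nat ((N + 3) * (N + 2) * (N + 1)) :: complex) \<noteq> 0" by (subst of_nat_eq_0_iff) simp
  moreover have "k \<noteq> 0 \<Longrightarrow> a \<noteq> 0 \<Longrightarrow> a \<noteq> 1 \<Longrightarrow> k / 2 * a ^ N * (a - 1)\<^sup>2 \<noteq> 0" for k by simp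
  ultimately show ?thesis unfolding e by blast
qed

text \<open>Off the poles F = f0^(N+3) P(f), and a simple root of P contributes exactly the order of
  f - f z. At a zero of f0 the leading term of \<open>FR\<close> keeps F from vanishing.\<close>

lemma zorder_FR:
  fixes N :: nat and f f0 f1 F :: "complex \<Rightarrow> complex"
  assumes hol: "entire f0" "entire f1" and cop: "\<And>z. f0 z \<noteq> 0 \<or> f1 z \<noteq> 0"
    and f: "\<And>z. f z = f1 z / f0 z" and W: "wr2 f0 f1 w0 \<noteq> 0" and c: "c \<noteq> 0" "c \<noteq> 1"
    and F: "\<And>z. F z = FR N (f0 z) (f1 z) - c * f0 z ^ (N + 3)"
  shows "F z = 0 \<longleftrightarrow> f0 z \<noteq> 0 \<and> frank_reinders (N + 3) c (f z) = 0" (is ?A)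
    and "F z = 0 \<Longrightarrow> zorder F z = zorder (\<lambda>w. f w - f z) z \<and> zorder F z \<ge> 1"
proof -
  have Ff: "F w = f0 w ^ (N + 3) * poly (fr_poly N c) (f w)" if "f0 w \<noteq> 0" for w
    using FR_scale[of N "f0 w" 1 "f w"] that by (simp add: F poly_fr_poly f algebra_simps)
  show A: ?A
  proof (cases "f0 z = 0")
    case True
    then have "F z \<noteq> 0" using FR_no_common_zero[of N "f0 z" "f1 z"] cop[of z] by (auto simp: F)
    then show ?thesis using True by simp
  next
    case False
    then show ?thesis by (simp add: Ff frank_reinders_eq poly_fr_poly)
  qed
  assume Fz: "F z = 0"
  then have f0z: "f0 z \<noteq> 0" and root: "poly (fr_poly N c) (f z) = 0"
    using A by (auto simp: frank_reinders_eq poly_fr_poly)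
  obtain R where R: "fr_poly N c = [:- f z, 1:] * R" using root by (auto simp: poly_eq_0_iff_dvd elim!: dvdE)
  have "poly (pderiv (fr_poly N c)) (f z) = poly R (f z)" unfolding R pderiv_mult by (simp add: pderiv_pCons)
  then have Rz: "poly R (f z) \<noteq> 0" using fr_poly_simple_root[OF c root] by simp
  define L where "L = (\<lambda>w. f1 w - f z * f0 w)"
  have L: "entire L" unfolding L_def by (intro holomorphic_intros hol)
  have "wr2 f0 L w0 = wr2 f0 f1 w0"
    using wr2_lincomb[OF hol, of 1 0 "- f z" 1 w0] by (simp add: L_def)
  then obtain w1 where "L w1 \<noteq> 0" using W wr2_nonzero_imp(2)[of f0 L w0] by auto
  then obtain m u where u: "entire u" "u z \<noteq> 0" "\<And>w. L w = (w - z) ^ m * u w"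
    using entire_factor_at[OF L] by metis
  have "L z = 0" using f0z by (simp add: L_def f)
  then have m: "m \<ge> 1" using u(2) u(3)[of z] by (cases m) auto
  define S where "S = {w. f0 w \<noteq> 0}"
  have S: "open S" "z \<in> S"
    using f0z holomorphic_on_imp_continuous_on[OF hol(1)] by (auto simp: S_def intro!: open_Collect_neq)
  have hS: "p holomorphic_on S" if "entire p" for p using that by (rule holomorphic_on_subset) auto
  have fL: "f w - f z = u w / f0 w * (w - z) ^ m" if "w \<in> S" for w
  proof -
    have "f w - f z = L w / f0 w" using that by (simp add: L_def S_def f[of w] diff_divide_distrib)
    then show ?thesis by (simp add: u(3) mult.commute)
  qed
  have 1: "zorder (\<lambda>w. f w - f z) z = int m"
  proof (rule zorder_eqI[OF S])
    show "(\<lambda>w. u w / f0 w) holomorphic_on S" by (intro holomorphic_intros hS u hol) (auto simp: S_def)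
    show "u z / f0 z \<noteq> 0" using u(2) f0z by simp
    show "f w - f z = u w / f0 w * (w - z) powi int m" if "w \<in> S" for w using fL[OF that] by simp
  qed
  have 2: "zorder F z = int m"
  proof (rule zorder_eqI[OF S])
    show "(\<lambda>w. f0 w ^ (N + 3) * (u w / f0 w) * poly R (f w)) holomorphic_on S"
      unfolding f by (intro holomorphic_intros hS u hol) (auto simp: S_def)
    show "f0 z ^ (N + 3) * (u z / f0 z) * poly R (f z) \<noteq> 0" using u(2) f0z Rz by simp
    show "F w = f0 w ^ (N + 3) * (u w / f0 w) * poly R (f w) * (w - z) powi int m" if "w \<in> S" for w
    proof -
      have "F w = f0 w ^ (N + 3) * ((f w - f z) * poly R (f w))"
        using Ff[of w] that unfolding R by (simp add: S_def left_diff_distrib)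
      then show ?thesis unfolding fL[OF that] by (simp add: mult_ac)
    qed
  qed
  show "zorder F z = zorder (\<lambda>w. f w - f z) z \<and> zorder F z \<ge> 1" using 1 2 m by simp
qed

definition recorded_mult :: "nat \<Rightarrow> nat" where
  "recorded_mult p = (if enat p \<le> 1 then p else p + 1)"

text \<open>The values are 0, 1, 3, 4, 5, and so on: 2 is skipped, and no two multiplicities are
  merged.\<close>

lemma recorded_mult_inj: "recorded_mult p = recorded_mult q \<longleftrightarrow> p = q"
  by (auto simp: recorded_mult_def one_enat_def split: if_splits)

lemma weighted_preimage_FR:
  fixes N :: nat and f f0 f1 F :: "complex \<Rightarrow> complex"
  assumes hol: "entire f0" "entire f1" and cop: "\<And>z. f0 z \<noteq> 0 \<or> f1 z \<noteq> 0"
    and pole: "\<And>z. is_pole f z \<longleftrightarrow> f0 z = 0" and f: "\<And>z. f z = f1 z / f0 z" 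
    and W: "wr2 f0 f1 w0 \<noteq> 0" and c: "c \<noteq> 0" "c \<noteq> 1"
    and F: "\<And>z. F z = FR N (f0 z) (f1 z) - c * f0 z ^ (N + 3)"
  shows "(z, t) \<in> weighted_preimage f (Finite ` {z. frank_reinders (N + 3) c z = 0}) 1 \<longleftrightarrow>
     F z = 0 \<and> t = recorded_mult (nat (zorder F z))"
proof -
  note zF = zorder_FR[OF hol cop f W c F]
  have "(z, t) \<in> weighted_preimage f (Finite ` {z. frank_reinders (N + 3) c z = 0}) 1 \<longleftrightarrow>
     (\<exists>p\<ge>1. frank_reinders (N + 3) c (f z) = 0 \<and> f0 z \<noteq> 0 \<and> zorder (\<lambda>w. f w - f z) z = int p \<and> t = recorded_mult p)"
    unfolding weighted_preimage_def recorded_mult_def by (auto simp: pole)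
  also have "\<dots> \<longleftrightarrow> F z = 0 \<and> t = recorded_mult (nat (zorder F z))"
  proof
    assume "\<exists>p\<ge>1. frank_reinders (N + 3) c (f z) = 0 \<and> f0 z \<noteq> 0 \<and> zorder (\<lambda>w. f w - f z) z = int p \<and> t = recorded_mult p"
    then show "F z = 0 \<and> t = recorded_mult (nat (zorder F z))" using zF[of z] by auto
  next
    assume "F z = 0 \<and> t = recorded_mult (nat (zorder F z))"
    then show "\<exists>p\<ge>1. frank_reinders (N + 3) c (f z) = 0 \<and> f0 z \<noteq> 0 \<and> zorder (\<lambda>w. f w - f z) z = int p \<and> t = recorded_mult p"
      using zF[of z] by (intro exI[of _ "nat (zorder F z)"]) auto
  qed
  finally show ?thesis .
qed

lemma zorder_entire_nonzero:
  assumes "entire F" "F z \<noteq> 0"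
  shows "zorder F z = 0"
proof -
  obtain m g where "F z = (z - z) ^ m * g z" "zorder F z = int m"
    using entire_factor_at[OF assms(1,2), of z] by metis
  then show ?thesis using assms(2) by (cases m) auto
qed

theorem theorem2p1:
  fixes n :: nat and c :: complex and S :: "complex set" and f g :: "complex \<Rightarrow> complex"
  assumes "n \<ge> 13"
    and "c \<noteq> 0" and "c \<noteq> 1"
    and "S = {z. frank_reinders n c z = 0}"
    and "f nicely_meromorphic_on UNIV" and "\<not> f constant_on UNIV"
    and "g nicely_meromorphic_on UNIV" and "\<not> g constant_on UNIV"
    and "weighted_preimage f (Finite ` S) 1 = weighted_preimage g (Finite ` S) 1"
  shows "f = g"
proof -
  define N where "N = n - 3"
  have n: "n = N + 3" and N: "N \<ge> 10" using assms(1) by (auto simp: N_def)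
  obtain f0 f1 where f0: "entire f0" "entire f1" "\<And>z. f0 z \<noteq> 0 \<or> f1 z \<noteq> 0"
    "\<And>z. is_pole f z \<longleftrightarrow> f0 z = 0" "\<And>z. f z = f1 z / f0 z" "\<exists>w. wr2 f0 f1 w \<noteq> 0"
    using meromorphic_quotient[OF assms(5,6)] by blast
  obtain g0 g1 where g0: "entire g0" "entire g1" "\<And>z. g0 z \<noteq> 0 \<or> g1 z \<noteq> 0"
    "\<And>z. is_pole g z \<longleftrightarrow> g0 z = 0" "\<And>z. g z = g1 z / g0 z" "\<exists>w. wr2 g0 g1 w \<noteq> 0"
    using meromorphic_quotient[OF assms(7,8)] by blast
  obtain wf wg where wf: "wr2 f0 f1 wf \<noteq> 0" and wg: "wr2 g0 g1 wg \<noteq> 0" using f0(6) g0(6) by blast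
  define F where "F = (\<lambda>z. FR N (f0 z) (f1 z) - c * f0 z ^ (N + 3))"
  define G where "G = (\<lambda>z. FR N (g0 z) (g1 z) - c * g0 z ^ (N + 3))"
  have hF: "entire F" "entire G"
    unfolding F_def G_def by (intro holomorphic_intros holomorphic_FR f0 g0)+
  have Fz: "F z = FR N (f0 z) (f1 z) - c * f0 z ^ (N + 3)" and Gz: "G z = FR N (g0 z) (g1 z) - c * g0 z ^ (N + 3)" for z
    by (simp_all add: F_def G_def)
  note pf = weighted_preimage_FR[OF f0(1-5) wf assms(2,3) Fz]
    and pg = weighted_preimage_FR[OF g0(1-5) wg assms(2,3) Gz]
  have same: "F z = 0 \<and> t = recorded_mult (nat (zorder F z)) \<longleftrightarrow> G z = 0 \<and> t = recorded_mult (nat (zorder G z))" for z t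
    using assms(9) unfolding assms(4) n by (simp only: pf[symmetric] pg[symmetric])
  have zeros: "F z = 0 \<longleftrightarrow> G z = 0" for z using same[of z] by blast
  have orders: "zorder F z = zorder G z" for z
  proof (cases "F z = 0")
    case True
    then have "recorded_mult (nat (zorder F z)) = recorded_mult (nat (zorder G z))" using same[of z] by blast
    moreover have "zorder F z \<ge> 1" "zorder G z \<ge> 1"
      using zorder_FR(2)[OF f0(1,2,3,5) wf assms(2,3) Fz, of z] zorder_FR(2)[OF g0(1,2,3,5) wg assms(2,3) Gz, of z]
        True zeros by auto
    ultimately show ?thesis by (simp add: recorded_mult_inj)
  next
    case False
    then show ?thesis using zorder_entire_nonzero hF zeros by metis
  qed
  obtain h where h: "entire h" "\<And>z. h z \<noteq> 0" "\<And>z. F z = h z * G z"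
    using holomorphic_zorder_factorization[OF hF(1) open_UNIV connected_UNIV hF(2)] zeros orders by (metis UNIV_I)
  obtain k where k: "entire k" "\<And>z. exp (k z) = h z"
    using holomorphic_logarithm_exists[OF convex_UNIV open_UNIV h(1) _ UNIV_I] h(2) by (metis UNIV_I)
  \<comment> \<open>An (N+3)-th root of h. As G is homogeneous of degree N + 3 in g0 and g1,
    multiplying both by \<open>e\<close> replaces G by h G = F.\<close>
  define e where "e = (\<lambda>z. exp (k z / of_nat (N + 3)))"
  have e: "entire e" "\<And>z. e z \<noteq> 0"
    unfolding e_def by (intro holomorphic_intros k) auto
  have en: "e z ^ (N + 3) = h z" for z
  proof -
    have "e z ^ (N + 3) = exp (of_nat (N + 3) * (k z / of_nat (N + 3)))" unfolding e_def by (rule exp_of_nat_mult[symmetric])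
    also have "(of_nat (N + 3) :: complex) \<noteq> 0" by (subst of_nat_eq_0_iff) simp
    then have "of_nat (N + 3) * (k z / of_nat (N + 3)) = k z" by (rule nonzero_mult_div_cancel_left[of _ "k z", unfolded times_divide_eq_right[symmetric]])
    finally show ?thesis by (simp only: k(2))
  qed
  interpret FR_pair N c f0 f1 "\<lambda>z. e z * g0 z" "\<lambda>z. e z * g1 z"
  proof
    show "entire (\<lambda>z. e z * g0 z)" "entire (\<lambda>z. e z * g1 z)"
      by (intro holomorphic_intros e g0)+
    show "e z * g0 z \<noteq> 0 \<or> e z * g1 z \<noteq> 0" for z using e(2) g0(3) by simp
    have "wr2 (\<lambda>z. e z * g0 z) (\<lambda>z. e z * g1 z) wg = e wg ^ 2 * wr2 g0 g1 wg"
    proof -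
      have d: "deriv (\<lambda>z. e z * p z) wg = e wg * deriv p wg + deriv e wg * p wg" if "entire p" for p
        by (rule DERIV_imp_deriv, rule DERIV_cong[OF DERIV_mult[OF entire_deriv[OF e(1)] entire_deriv[OF that]]]) simp
      show ?thesis unfolding wr2_def d[OF g0(1)] d[OF g0(2)] by (simp add: algebra_simps power2_eq_square)
    qed
    then show "\<exists>w. wr2 (\<lambda>z. e z * g0 z) (\<lambda>z. e z * g1 z) w \<noteq> 0" using wg e(2) by (intro exI[of _ wg]) simp
    show "FR N (f0 z) (f1 z) - c * f0 z ^ (N + 3) = FR N (e z * g0 z) (e z * g1 z) - c * (e z * g0 z) ^ (N + 3)" for z
      using h(3)[of z] unfolding FR_scale power_mult_distrib en F_def G_def by (simp add: algebra_simps)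
  qed (use N assms(2) f0 in auto)
  have r: "f1 z * g0 z = g1 z * f0 z" for z
    using ratio_eq[of z] e(2)[of z] by simp
  show "f = g"
  proof
    fix z
    show "f z = g z"
    proof (cases "f0 z = 0")
      case True
      \<comment> \<open>A common pole: both quotients are x/0 = 0, in accordance with the
        normalisation.\<close>
      then have "g0 z = 0" using r[of z] f0(3)[of z] by simp
      then show ?thesis using True f0(5) g0(5) by simp
    next
      case False
      then have "g0 z \<noteq> 0" using r[of z] g0(3)[of z] by auto
      then show ?thesis using False r[of z] f0(5)[of z] g0(5)[of z] by (simp add: frac_eq_eq)
    qed
  qed
qed

end
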